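(* Let $q\in(0,1)$ and $n\ge1$. The following is a complete (up to unitary equivalence) list of irreducible representations of the $C^*$-algebra $C(B^{2n}_q)=C^*(z_1,\ldots,z_n)$: $$\{\rho_1^\theta,\rho_2^\theta,\ldots,\rho_n^\theta:\theta\in\mathbb C,\ |\theta|=1\}\cup\{\sigma\}.$$ Here the representations $\rho_1^\theta$ are $1$-dimensional, $\rho_j^\theta$, $j=2,\ldots,n$, act on $\mathcal H_{j-1}$, and $\sigma$ acts on $\mathcal H_n$. On the generators $z_1,\ldots,z_n$ these representations are given by the following formulae: $$\rho_1^\theta(z_i)=\begin{cases}0,&1\le i\le n-1\\ \theta,&i=n,\end{cases}$$ $$\rho_j^\theta(z_i)\xi_{k_1,\ldots,k_{j-1}}=\begin{cases}0,&1\le i\le n-j\\ \theta q^{(k_1+k_2+\cdots+k_{j-1})/2}\xi_{k_1,\ldots,k_{j-1}},&i=n-j+1\\ S_{i+j-n-1}(\xi_{k_1,\ldots,k_{j-1}}),&n-j+2\le i\le n,\end{cases}$$ $$\sigma(z_i)\xi_{k_1,\ldots,k_n}=S_i(\xi_{k_1,\ldots,k_n}),\quad 1\le i\le n.$$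
   Context: $C(B^{2n}_q)$ is the universal unital $C^*$-algebra generated by $z_1,\ldots,z_n$ subject to $z_iz_j=q^{1/2}z_jz_i$ and $z_iz_j^*=q^{-1/2}z_j^*z_i$ for $i<j$, and $z_i^*z_i-qz_iz_i^*=(1-q)(1-\sum_{j=i+1}^nz_jz_j^* )$ for $i=1,\ldots,n$. For $m\ge1$, $\mathcal H_m$ is a Hilbert space with orthonormal basis $\{\xi_{k_1,\ldots,k_m}:k_i=0,1,\ldots\}$, and for $1\le r\le m$, $S_r$ is the weighted shift on $\mathcal H_m$ defined by $$S_r(\xi_{k_1,\ldots,k_m})=\begin{cases}\sqrt{(1-q^{1+k_r})q^{k_{r+1}+k_{r+2}+\cdots+k_m}}\;\xi_{k_1,\ldots,k_{r-1},1+k_r,k_{r+1},\ldots,k_m},&1\le r\le m-1\\ \sqrt{1-q^{1+k_m}}\;\xi_{k_1,\ldots,k_{m-1},1+k_m},&r=m.\end{cases}$$ *)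

theory Defs
  imports "HOL-Analysis.Analysis" "HOL-Algebra.Ring"
begin

section \<open>Complex Hilbert spaces\<close>

text \<open>
  The inner product is linear in its first argument. Its real part is the inner product
  of \<^class>\<open>real_inner\<close>, so norm and topology are those of the library.
\<close>

class complex_hilbert = real_inner + complete_space +
  fixes scaleC :: "complex \<Rightarrow> 'a \<Rightarrow> 'a" (infixr \<open>*\<^sub>C\<close> 75)
    and cinner :: "'a \<Rightarrow> 'a \<Rightarrow> complex"
  assumes scaleC_add_right: "c *\<^sub>C (x + y) = c *\<^sub>C x + c *\<^sub>C y"
    and scaleC_add_left: "(c + d) *\<^sub>C x = c *\<^sub>C x + d *\<^sub>C x"
    and scaleC_scaleC: "c *\<^sub>C (d *\<^sub>C x) = (c * d) *\<^sub>C x"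
    and scaleR_scaleC: "r *\<^sub>R x = complex_of_real r *\<^sub>C x"
    and cinner_commute: "cinner x y = cnj (cinner y x)"
    and cinner_add_left: "cinner (x + y) w = cinner x w + cinner y w"
    and cinner_scaleC_left: "cinner (c *\<^sub>C x) y = c * cinner x y"
    and inner_eq_Re_cinner: "inner x y = Re (cinner x y)"

definition closed_csubspace :: "'h::complex_hilbert set \<Rightarrow> bool" where
  "closed_csubspace X \<longleftrightarrow>
     closed X \<and> 0 \<in> X \<and> (\<forall>x\<in>X. \<forall>y\<in>X. x + y \<in> X) \<and> (\<forall>c. \<forall>x\<in>X. c *\<^sub>C x \<in> X)"

text \<open>
  Hilbert spaces are closed subspaces \<open>X\<close> of types of class \<^class>\<open>complex_hilbert\<close>
  (\<open>X = UNIV\<close> being the whole type). An operator on \<open>X\<close> is a function on the type of which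
  only the values on \<open>X\<close> matter.
\<close>

definition bounded_operator_on :: "'h::complex_hilbert set \<Rightarrow> ('h \<Rightarrow> 'h) \<Rightarrow> bool" where
  "bounded_operator_on X T \<longleftrightarrow>
     (\<forall>x\<in>X. T x \<in> X) \<and>
     (\<forall>x\<in>X. \<forall>y\<in>X. T (x + y) = T x + T y) \<and>
     (\<forall>c. \<forall>x\<in>X. T (c *\<^sub>C x) = c *\<^sub>C T x) \<and>
     (\<exists>K. \<forall>x\<in>X. norm (T x) \<le> K * norm x)"

section \<open>The spaces of square-summable functions\<close>

typedef 'k ell2 = "{f :: 'k \<Rightarrow> complex. (\<lambda>k. (cmod (f k))\<^sup>2) summable_on UNIV}"
  morphisms ell2_apply Abs_ell2
  by (rule exI[of _ "\<lambda>_. 0"]) simp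

setup_lifting type_definition_ell2

lemma ell2_summable_add:
  fixes f g :: "'k \<Rightarrow> complex"
  assumes "(\<lambda>k. (cmod (f k))\<^sup>2) summable_on A" and "(\<lambda>k. (cmod (g k))\<^sup>2) summable_on A"
  shows "(\<lambda>k. (cmod (f k + g k))\<^sup>2) summable_on A"
proof (rule summable_on_comparison_test)
  show "(\<lambda>k. 2 * (cmod (f k))\<^sup>2 + 2 * (cmod (g k))\<^sup>2) summable_on A"
    using assms by (intro summable_on_add summable_on_cmult_right)
  fix k
  have "(cmod (f k + g k))\<^sup>2 \<le> (cmod (f k) + cmod (g k))\<^sup>2"
    by (intro power_mono norm_triangle_ineq) simp
  also have "\<dots> \<le> 2 * (cmod (f k))\<^sup>2 + 2 * (cmod (g k))\<^sup>2"
    using sum_squares_bound[of "cmod (f k)" "cmod (g k)"] by (simp add: power2_sum)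
  finally show "(cmod (f k + g k))\<^sup>2 \<le> 2 * (cmod (f k))\<^sup>2 + 2 * (cmod (g k))\<^sup>2" .
qed simp

lemma ell2_summable_scale:
  fixes f :: "'k \<Rightarrow> complex"
  assumes "(\<lambda>k. (cmod (f k))\<^sup>2) summable_on A"
  shows "(\<lambda>k. (cmod (c * f k))\<^sup>2) summable_on A"
  using summable_on_cmult_right[OF assms, of "(cmod c)\<^sup>2"]
  by (simp add: norm_mult power_mult_distrib)

lemma ell2_summable_mult:
  fixes f g :: "'k \<Rightarrow> complex"
  assumes "(\<lambda>k. (cmod (f k))\<^sup>2) summable_on A" and "(\<lambda>k. (cmod (g k))\<^sup>2) summable_on A"
  shows "(\<lambda>k. f k * cnj (g k)) summable_on A"
proof (rule abs_summable_summable, rule summable_on_comparison_test)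
  show "(\<lambda>k. (cmod (f k))\<^sup>2 + (cmod (g k))\<^sup>2) summable_on A"
    using assms by (intro summable_on_add)
  fix k
  have "0 \<le> cmod (f k) * cmod (g k)" by simp
  moreover have "2 * (cmod (f k) * cmod (g k)) \<le> (cmod (f k))\<^sup>2 + (cmod (g k))\<^sup>2"
    using sum_squares_bound[of "cmod (f k)" "cmod (g k)"] by (simp only: mult.assoc)
  ultimately have "cmod (f k) * cmod (g k) \<le> (cmod (f k))\<^sup>2 + (cmod (g k))\<^sup>2"
    by linarith
  then show "norm (f k * cnj (g k)) \<le> (cmod (f k))\<^sup>2 + (cmod (g k))\<^sup>2"
    by (simp only: norm_mult complex_mod_cnj)
qed simp

instantiation ell2 :: (type) real_vector
begin

lift_definition zero_ell2 :: "'a ell2" is "\<lambda>_. 0" by simp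

lift_definition plus_ell2 :: "'a ell2 \<Rightarrow> 'a ell2 \<Rightarrow> 'a ell2" is "\<lambda>f g k. f k + g k"
  by (rule ell2_summable_add)

lift_definition uminus_ell2 :: "'a ell2 \<Rightarrow> 'a ell2" is "\<lambda>f k. - f k" by simp

definition minus_ell2 :: "'a ell2 \<Rightarrow> 'a ell2 \<Rightarrow> 'a ell2" where
  "minus_ell2 f g = f + (- g)"

lift_definition scaleR_ell2 :: "real \<Rightarrow> 'a ell2 \<Rightarrow> 'a ell2" is "\<lambda>r f k. complex_of_real r * f k"
  by (rule ell2_summable_scale)

instance
  by standard (unfold minus_ell2_def, (transfer, auto simp: algebra_simps)+)

end

lift_definition ell2_scale :: "complex \<Rightarrow> 'a ell2 \<Rightarrow> 'a ell2" is "\<lambda>c f k. c * f k"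
  by (rule ell2_summable_scale)

lift_definition ell2_inner :: "'a ell2 \<Rightarrow> 'a ell2 \<Rightarrow> complex"
  is "\<lambda>f g. \<Sum>\<^sub>\<infinity>k. f k * cnj (g k)" .

lemma ell2_summable: "(\<lambda>k. (cmod (ell2_apply f k))\<^sup>2) summable_on UNIV"
  using ell2_apply[of f] by simp

lemma ell2_inner_self:
  "ell2_inner f f = complex_of_real (\<Sum>\<^sub>\<infinity>k. (cmod (ell2_apply f k))\<^sup>2)"
proof -
  have "((\<lambda>k. complex_of_real ((cmod (ell2_apply f k))\<^sup>2)) has_sum
      complex_of_real (\<Sum>\<^sub>\<infinity>k. (cmod (ell2_apply f k))\<^sup>2)) UNIV"
    unfolding has_sum_of_real_iff by (rule has_sum_infsum[OF ell2_summable])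
  then show ?thesis
    unfolding ell2_inner.rep_eq by (simp only: complex_norm_square infsumI)
qed

lemma ell2_inner_add: "ell2_inner (f + g) h = ell2_inner f h + ell2_inner g h"
  by transfer (simp add: ring_distribs infsum_add ell2_summable_mult)

lemma ell2_inner_scale: "ell2_inner (ell2_scale c f) g = c * ell2_inner f g"
  by transfer (simp add: mult.assoc infsum_cmult_right')

lemma ell2_inner_commute: "ell2_inner f g = cnj (ell2_inner g f)"
  by transfer (simp flip: infsum_cnj add: mult.commute)

lemma ell2_scaleR: "r *\<^sub>R f = ell2_scale (complex_of_real r) f"
  by transfer simp

lemma ell2_finite_sum_le:
  "finite F \<Longrightarrow> (\<Sum>k\<in>F. (cmod (ell2_apply f k))\<^sup>2) \<le> Re (ell2_inner f f)"
  unfolding ell2_inner_self Re_complex_of_real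
  by (rule finite_sum_le_infsum[OF ell2_summable]) auto

instantiation ell2 :: (type) real_inner
begin

definition inner_ell2 :: "'a ell2 \<Rightarrow> 'a ell2 \<Rightarrow> real" where
  "inner_ell2 f g = Re (ell2_inner f g)"

definition norm_ell2 :: "'a ell2 \<Rightarrow> real" where
  "norm_ell2 f = sqrt (inner f f)"

definition dist_ell2 :: "'a ell2 \<Rightarrow> 'a ell2 \<Rightarrow> real" where
  "dist_ell2 f g = norm (f - g)"

definition sgn_ell2 :: "'a ell2 \<Rightarrow> 'a ell2" where
  "sgn_ell2 f = f /\<^sub>R norm f"

definition uniformity_ell2 :: "('a ell2 \<times> 'a ell2) filter" where
  "uniformity_ell2 = (INF e\<in>{0 <..}. principal {(x, y). dist x y < e})"

definition open_ell2 :: "'a ell2 set \<Rightarrow> bool" where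
  "open_ell2 U \<longleftrightarrow> (\<forall>x\<in>U. eventually (\<lambda>(x', y). x' = x \<longrightarrow> y \<in> U) uniformity)"

instance
proof
  fix x y w :: "'a ell2" and r :: real
  show "dist x y = norm (x - y)" by (rule dist_ell2_def)
  show "sgn x = x /\<^sub>R norm x" by (rule sgn_ell2_def)
  show "(uniformity :: ('a ell2 \<times> 'a ell2) filter) =
      (INF e\<in>{0 <..}. principal {(x, y). dist x y < e})"
    by (rule uniformity_ell2_def)
  show "open U \<longleftrightarrow> (\<forall>x\<in>U. \<forall>\<^sub>F (x', y) in uniformity. x' = x \<longrightarrow> y \<in> U)" for U :: "'a ell2 set"
    by (rule open_ell2_def)
  show "inner x y = inner y x"
    using ell2_inner_commute[of x y] by (simp add: inner_ell2_def)
  show "inner (x + y) w = inner x w + inner y w"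
    by (simp add: inner_ell2_def ell2_inner_add)
  show "inner (r *\<^sub>R x) y = r * inner x y"
    by (simp add: inner_ell2_def ell2_scaleR ell2_inner_scale)
  show "0 \<le> inner x x"
    using ell2_finite_sum_le[of "{}" x] by (simp add: inner_ell2_def)
  show "inner x x = 0 \<longleftrightarrow> x = 0"
  proof
    assume "inner x x = 0"
    then have "ell2_apply x k = 0" for k
      using ell2_finite_sum_le[of "{k}" x] by (simp add: inner_ell2_def)
    then show "x = 0"
      by transfer auto
  next
    assume "x = 0"
    then show "inner x x = 0"
      by (simp add: inner_ell2_def ell2_inner_self zero_ell2.rep_eq)
  qed
  show "norm x = sqrt (inner x x)" by (rule norm_ell2_def)
qed

end

lemma ell2_norm_finite_le:
  "finite F \<Longrightarrow> (\<Sum>k\<in>F. (cmod (ell2_apply f k))\<^sup>2) \<le> (norm f)\<^sup>2"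
  using ell2_finite_sum_le[of F f] by (simp add: power2_norm_eq_inner inner_ell2_def)

lemma ell2_coord_le: "cmod (ell2_apply f k) \<le> norm f"
proof (rule power2_le_imp_le)
  show "(cmod (ell2_apply f k))\<^sup>2 \<le> (norm f)\<^sup>2"
    using ell2_norm_finite_le[of "{k}" f] by simp
qed simp

lemma ell2_norm_leI:
  assumes "\<And>F. finite F \<Longrightarrow> (\<Sum>k\<in>F. (cmod (ell2_apply f k))\<^sup>2) \<le> e\<^sup>2" and "0 \<le> e"
  shows "norm f \<le> e"
proof (rule power2_le_imp_le)
  have "(norm f)\<^sup>2 = (\<Sum>\<^sub>\<infinity>k. (cmod (ell2_apply f k))\<^sup>2)"
    by (simp add: power2_norm_eq_inner inner_ell2_def ell2_inner_self)
  also have "\<dots> \<le> e\<^sup>2"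
    by (rule infsum_le_finite_sums[OF ell2_summable]) (use assms(1) in auto)
  finally show "(norm f)\<^sup>2 \<le> e\<^sup>2" .
qed (rule assms(2))

lemma ell2_apply_diff: "ell2_apply (f - g) k = ell2_apply f k - ell2_apply g k"
  unfolding minus_ell2_def plus_ell2.rep_eq uminus_ell2.rep_eq by simp

lemma ell2_Cauchy_convergent:
  fixes X :: "nat \<Rightarrow> 'a ell2"
  assumes "Cauchy X"
  shows "convergent X"
proof -
  have "Cauchy (\<lambda>n. ell2_apply (X n) k)" for k
  proof (rule CauchyI)
    fix e :: real assume "0 < e"
    then obtain M where "\<forall>m\<ge>M. \<forall>n\<ge>M. norm (X m - X n) < e"
      using CauchyD[OF assms] by blast
    then show "\<exists>M. \<forall>m\<ge>M. \<forall>n\<ge>M. norm (ell2_apply (X m) k - ell2_apply (X n) k) < e"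
      by (metis ell2_apply_diff ell2_coord_le order.strict_trans1)
  qed
  then have "\<exists>l. (\<lambda>n. ell2_apply (X n) k) \<longlonglongrightarrow> l" for k
    by (simp add: Cauchy_convergent_iff convergent_def)
  then obtain l where l: "\<And>k. (\<lambda>n. ell2_apply (X n) k) \<longlonglongrightarrow> l k"
    by metis
  have tail: "\<exists>M. \<forall>m\<ge>M. \<forall>F. finite F \<longrightarrow> (\<Sum>k\<in>F. (cmod (ell2_apply (X m) k - l k))\<^sup>2) \<le> e\<^sup>2"
    if "0 < e" for e :: real
  proof -
    obtain M where M: "\<forall>m\<ge>M. \<forall>n\<ge>M. norm (X m - X n) < e"
      using CauchyD[OF assms \<open>0 < e\<close>] by blast
    have "(\<Sum>k\<in>F. (cmod (ell2_apply (X m) k - l k))\<^sup>2) \<le> e\<^sup>2" if "m \<ge> M" "finite F" for m F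
    proof (rule LIMSEQ_le_const2)
      show "(\<lambda>n. \<Sum>k\<in>F. (cmod (ell2_apply (X m) k - ell2_apply (X n) k))\<^sup>2)
          \<longlonglongrightarrow> (\<Sum>k\<in>F. (cmod (ell2_apply (X m) k - l k))\<^sup>2)"
        by (intro tendsto_intros l)
      have "(\<Sum>k\<in>F. (cmod (ell2_apply (X m) k - ell2_apply (X n) k))\<^sup>2) \<le> e\<^sup>2" if "n \<ge> M" for n
      proof -
        have "(\<Sum>k\<in>F. (cmod (ell2_apply (X m) k - ell2_apply (X n) k))\<^sup>2) \<le> (norm (X m - X n))\<^sup>2"
          using ell2_norm_finite_le[OF \<open>finite F\<close>, of "X m - X n"] by (simp add: ell2_apply_diff)
        also have "\<dots> \<le> e\<^sup>2"
          using M \<open>m \<ge> M\<close> that by (intro power_mono) (auto intro: less_imp_le)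
        finally show ?thesis .
      qed
      then show "\<exists>N. \<forall>n\<ge>N. (\<Sum>k\<in>F. (cmod (ell2_apply (X m) k - ell2_apply (X n) k))\<^sup>2) \<le> e\<^sup>2"
        by blast
    qed
    then show ?thesis by blast
  qed
  obtain M where M: "\<And>F. finite F \<Longrightarrow> (\<Sum>k\<in>F. (cmod (ell2_apply (X M) k - l k))\<^sup>2) \<le> 1"
    using tail[of 1] by auto
  have "(\<lambda>k. (cmod (ell2_apply (X M) k - l k))\<^sup>2) summable_on UNIV"
    by (rule nonneg_bdd_above_summable_on) (use M in \<open>auto intro!: bdd_aboveI2[of _ _ 1]\<close>)
  then have "(\<lambda>k. (cmod (ell2_apply (X M) k + (-1) * (ell2_apply (X M) k - l k)))\<^sup>2) summable_on UNIV"
    by (intro ell2_summable_add ell2_summable ell2_summable_scale)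
  then have sl: "(\<lambda>k. (cmod (l k))\<^sup>2) summable_on UNIV" by simp
  define L where "L = Abs_ell2 l"
  have L: "ell2_apply L k = l k" for k
    using sl by (simp add: L_def Abs_ell2_inverse)
  have "X \<longlonglongrightarrow> L"
  proof (rule LIMSEQ_I)
    fix e :: real assume "0 < e"
    then obtain N where N: "\<forall>m\<ge>N. \<forall>F. finite F \<longrightarrow>
        (\<Sum>k\<in>F. (cmod (ell2_apply (X m) k - l k))\<^sup>2) \<le> (e / 2)\<^sup>2"
      using tail[of "e / 2"] by auto
    have "norm (X m - L) \<le> e / 2" if "m \<ge> N" for m
      by (rule ell2_norm_leI) (use N that \<open>0 < e\<close> in \<open>auto simp: ell2_apply_diff L\<close>)
    then show "\<exists>N. \<forall>m\<ge>N. norm (X m - L) < e"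
      using \<open>0 < e\<close> by (intro exI[of _ N]) force
  qed
  then show ?thesis by (rule convergentI)
qed

instantiation ell2 :: (type) complex_hilbert
begin

definition scaleC_ell2 :: "complex \<Rightarrow> 'a ell2 \<Rightarrow> 'a ell2" where
  "scaleC_ell2 = ell2_scale"

definition cinner_ell2 :: "'a ell2 \<Rightarrow> 'a ell2 \<Rightarrow> complex" where
  "cinner_ell2 = ell2_inner"

instance
proof
  fix x y w :: "'a ell2" and c d :: complex and r :: real
  show "convergent X" if "Cauchy X" for X :: "nat \<Rightarrow> 'a ell2"
    using that by (rule ell2_Cauchy_convergent)
  show "c *\<^sub>C (x + y) = c *\<^sub>C x + c *\<^sub>C y"
    unfolding scaleC_ell2_def by transfer (simp add: ring_distribs)
  show "(c + d) *\<^sub>C x = c *\<^sub>C x + d *\<^sub>C x"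
    unfolding scaleC_ell2_def by transfer (simp add: ring_distribs)
  show "c *\<^sub>C (d *\<^sub>C x) = (c * d) *\<^sub>C x"
    unfolding scaleC_ell2_def by transfer (simp add: mult.assoc)
  show "r *\<^sub>R x = complex_of_real r *\<^sub>C x"
    unfolding scaleC_ell2_def by (rule ell2_scaleR)
  show "cinner x y = cnj (cinner y x)"
    unfolding cinner_ell2_def by (rule ell2_inner_commute)
  show "cinner (x + y) w = cinner x w + cinner y w"
    unfolding cinner_ell2_def by (rule ell2_inner_add)
  show "cinner (c *\<^sub>C x) y = c * cinner x y"
    unfolding cinner_ell2_def scaleC_ell2_def by (rule ell2_inner_scale)
  show "inner x y = Re (cinner x y)"
    unfolding cinner_ell2_def by (rule inner_ell2_def)
qed

end

lift_definition ket :: "'k \<Rightarrow> 'k ell2" is "\<lambda>k l. if l = k then 1 else 0"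
proof -
  fix k :: 'k
  have "{l. (cmod (if l = k then 1 else 0))\<^sup>2 \<noteq> 0} \<subseteq> {k}"
    by (auto split: if_splits)
  then have "finite {l \<in> UNIV. (cmod (if l = k then 1 else 0))\<^sup>2 \<noteq> 0}"
    using finite_subset by auto
  then show "(\<lambda>l. (cmod (if l = k then 1 else 0))\<^sup>2) summable_on UNIV"
    by (rule finite_nonzero_values_imp_summable_on)
qed

section \<open>Unital C*-algebras\<close>

record 'a cstar = "'a ring" +
  ascale :: "complex \<Rightarrow> 'a \<Rightarrow> 'a"
  astar :: "'a \<Rightarrow> 'a"
  anorm :: "'a \<Rightarrow> real"

locale unital_cstar_algebra = ring A for A :: "('a, 'm) cstar_scheme" (structure) +
  assumes ascale_closed: "x \<in> carrier A \<Longrightarrow> ascale A c x \<in> carrier A"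
    and ascale_add_right:
      "\<lbrakk>x \<in> carrier A; y \<in> carrier A\<rbrakk> \<Longrightarrow> ascale A c (x \<oplus> y) = ascale A c x \<oplus> ascale A c y"
    and ascale_add_left: "x \<in> carrier A \<Longrightarrow> ascale A (c + d) x = ascale A c x \<oplus> ascale A d x"
    and ascale_ascale: "x \<in> carrier A \<Longrightarrow> ascale A c (ascale A d x) = ascale A (c * d) x"
    and ascale_one: "x \<in> carrier A \<Longrightarrow> ascale A 1 x = x"
    and ascale_mult_left:
      "\<lbrakk>x \<in> carrier A; y \<in> carrier A\<rbrakk> \<Longrightarrow> ascale A c x \<otimes> y = ascale A c (x \<otimes> y)"
    and ascale_mult_right:
      "\<lbrakk>x \<in> carrier A; y \<in> carrier A\<rbrakk> \<Longrightarrow> x \<otimes> ascale A c y = ascale A c (x \<otimes> y)"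
    and astar_closed: "x \<in> carrier A \<Longrightarrow> astar A x \<in> carrier A"
    and astar_astar: "x \<in> carrier A \<Longrightarrow> astar A (astar A x) = x"
    and astar_add:
      "\<lbrakk>x \<in> carrier A; y \<in> carrier A\<rbrakk> \<Longrightarrow> astar A (x \<oplus> y) = astar A x \<oplus> astar A y"
    and astar_ascale: "x \<in> carrier A \<Longrightarrow> astar A (ascale A c x) = ascale A (cnj c) (astar A x)"
    and astar_mult:
      "\<lbrakk>x \<in> carrier A; y \<in> carrier A\<rbrakk> \<Longrightarrow> astar A (x \<otimes> y) = astar A y \<otimes> astar A x"
    and anorm_ge_zero: "x \<in> carrier A \<Longrightarrow> 0 \<le> anorm A x"
    and anorm_eq_zero: "x \<in> carrier A \<Longrightarrow> anorm A x = 0 \<longleftrightarrow> x = \<zero>"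
    and anorm_triangle:
      "\<lbrakk>x \<in> carrier A; y \<in> carrier A\<rbrakk> \<Longrightarrow> anorm A (x \<oplus> y) \<le> anorm A x + anorm A y"
    and anorm_ascale: "x \<in> carrier A \<Longrightarrow> anorm A (ascale A c x) = cmod c * anorm A x"
    and anorm_mult:
      "\<lbrakk>x \<in> carrier A; y \<in> carrier A\<rbrakk> \<Longrightarrow> anorm A (x \<otimes> y) \<le> anorm A x * anorm A y"
    and cstar_identity: "x \<in> carrier A \<Longrightarrow> anorm A (astar A x \<otimes> x) = (anorm A x)\<^sup>2"
    and complete:
      "\<lbrakk>\<forall>k. s k \<in> carrier A; \<forall>e>0. \<exists>N. \<forall>k\<ge>N. \<forall>l\<ge>N. anorm A (s k \<ominus> s l) < e\<rbrakk>
       \<Longrightarrow> \<exists>x\<in>carrier A. (\<lambda>k. anorm A (s k \<ominus> x)) \<longlonglongrightarrow> 0"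

definition star_hom ::
  "('a, 'm) cstar_scheme \<Rightarrow> ('b, 'k) cstar_scheme \<Rightarrow> ('a \<Rightarrow> 'b) \<Rightarrow> bool" where
  "star_hom A B \<phi> \<longleftrightarrow>
     (\<forall>x\<in>carrier A. \<phi> x \<in> carrier B) \<and>
     (\<forall>x\<in>carrier A. \<forall>y\<in>carrier A. \<phi> (x \<oplus>\<^bsub>A\<^esub> y) = \<phi> x \<oplus>\<^bsub>B\<^esub> \<phi> y) \<and>
     (\<forall>x\<in>carrier A. \<forall>y\<in>carrier A. \<phi> (x \<otimes>\<^bsub>A\<^esub> y) = \<phi> x \<otimes>\<^bsub>B\<^esub> \<phi> y) \<and>
     (\<forall>c. \<forall>x\<in>carrier A. \<phi> (ascale A c x) = ascale B c (\<phi> x)) \<and>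
     (\<forall>x\<in>carrier A. \<phi> (astar A x) = astar B (\<phi> x)) \<and>
     \<phi> \<one>\<^bsub>A\<^esub> = \<one>\<^bsub>B\<^esub>"

definition cstar_subalgebra :: "('a, 'm) cstar_scheme \<Rightarrow> 'a set \<Rightarrow> bool" where
  "cstar_subalgebra A S \<longleftrightarrow>
     S \<subseteq> carrier A \<and> \<one>\<^bsub>A\<^esub> \<in> S \<and>
     (\<forall>x\<in>S. \<forall>y\<in>S. x \<oplus>\<^bsub>A\<^esub> y \<in> S \<and> x \<otimes>\<^bsub>A\<^esub> y \<in> S) \<and>
     (\<forall>c. \<forall>x\<in>S. ascale A c x \<in> S) \<and>
     (\<forall>x\<in>S. astar A x \<in> S) \<and>
     (\<forall>s x. (\<forall>k. s k \<in> S) \<and> x \<in> carrier A \<and> (\<lambda>k::nat. anorm A (s k \<ominus>\<^bsub>A\<^esub> x)) \<longlonglongrightarrow> 0 \<longrightarrow> x \<in> S)"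

section \<open>The algebra of the quantum ball\<close>

text \<open>The generators \<open>z\<^sub>1, \<dots>, z\<^sub>n\<close> are the values of \<open>z\<close> at \<open>1, \<dots>, n\<close>.\<close>

definition ball_relations ::
  "real \<Rightarrow> nat \<Rightarrow> ('a, 'm) cstar_scheme \<Rightarrow> (nat \<Rightarrow> 'a) \<Rightarrow> bool" where
  "ball_relations q n A z \<longleftrightarrow>
     (\<forall>i\<in>{1..n}. z i \<in> carrier A) \<and>
     (\<forall>i\<in>{1..n}. \<forall>j\<in>{1..n}. i < j \<longrightarrow>
        z i \<otimes>\<^bsub>A\<^esub> z j = ascale A (complex_of_real (q powr (1/2))) (z j \<otimes>\<^bsub>A\<^esub> z i) \<and>
        z i \<otimes>\<^bsub>A\<^esub> astar A (z j)
          = ascale A (complex_of_real (q powr (-1/2))) (astar A (z j) \<otimes>\<^bsub>A\<^esub> z i)) \<and>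
     (\<forall>i\<in>{1..n}.
        (astar A (z i) \<otimes>\<^bsub>A\<^esub> z i) \<ominus>\<^bsub>A\<^esub> ascale A (complex_of_real q) (z i \<otimes>\<^bsub>A\<^esub> astar A (z i))
          = ascale A (complex_of_real (1 - q))
              (\<one>\<^bsub>A\<^esub> \<ominus>\<^bsub>A\<^esub> (\<Oplus>\<^bsub>A\<^esub>j\<in>{i+1..n}. z j \<otimes>\<^bsub>A\<^esub> astar A (z j))))"

text \<open>
  Universality: every tuple satisfying the relations in a unital C*-algebra \<open>B\<close> is the image
  of \<open>z\<close> under a unital *-homomorphism (unique, since \<open>A\<close> is generated by \<open>z\<close> and
  *-homomorphisms are continuous). A quantifier cannot range over types, so \<open>B\<close> is taken with
  carrier inside one type of cardinality at least that of the continuum. This is no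
  restriction: a C*-algebra generated by finitely many elements has at most the cardinality
  of the continuum, so the C*-subalgebra generated by any such tuple, in any C*-algebra of any
  type, has an isomorphic copy with carrier inside this type.
\<close>

definition universal_ball_algebra ::
  "real \<Rightarrow> nat \<Rightarrow> ('a, 'm) cstar_scheme \<Rightarrow> (nat \<Rightarrow> 'a) \<Rightarrow> bool" where
  "universal_ball_algebra q n A z \<longleftrightarrow>
     unital_cstar_algebra A \<and> ball_relations q n A z \<and>
     (\<forall>S. cstar_subalgebra A S \<and> (\<forall>i\<in>{1..n}. z i \<in> S) \<longrightarrow> S = carrier A) \<and>
     (\<forall>(B :: (nat list ell2 \<Rightarrow> nat list ell2) cstar) w.
        unital_cstar_algebra B \<and> ball_relations q n B w \<longrightarrow>
        (\<exists>\<phi>. star_hom A B \<phi> \<and> (\<forall>i\<in>{1..n}. \<phi> (z i) = w i)))"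

section \<open>Representations\<close>

text \<open>
  A unital *-homomorphism from \<open>A\<close> into the bounded operators on \<open>X\<close>; the last conjunct says
  that \<open>\<pi> (a\<^sup>*)\<close> is the adjoint of \<open>\<pi> a\<close>.
\<close>

definition representation ::
  "('a, 'm) cstar_scheme \<Rightarrow> 'h::complex_hilbert set \<Rightarrow> ('a \<Rightarrow> 'h \<Rightarrow> 'h) \<Rightarrow> bool" where
  "representation A X \<pi> \<longleftrightarrow>
     closed_csubspace X \<and>
     (\<forall>a\<in>carrier A. bounded_operator_on X (\<pi> a)) \<and>
     (\<forall>a\<in>carrier A. \<forall>b\<in>carrier A. \<forall>x\<in>X. \<pi> (a \<oplus>\<^bsub>A\<^esub> b) x = \<pi> a x + \<pi> b x) \<and>
     (\<forall>a\<in>carrier A. \<forall>b\<in>carrier A. \<forall>x\<in>X. \<pi> (a \<otimes>\<^bsub>A\<^esub> b) x = \<pi> a (\<pi> b x)) \<and>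
     (\<forall>c. \<forall>a\<in>carrier A. \<forall>x\<in>X. \<pi> (ascale A c a) x = c *\<^sub>C \<pi> a x) \<and>
     (\<forall>x\<in>X. \<pi> \<one>\<^bsub>A\<^esub> x = x) \<and>
     (\<forall>a\<in>carrier A. \<forall>x\<in>X. \<forall>y\<in>X. cinner (\<pi> (astar A a) x) y = cinner x (\<pi> a y))"

definition irreducible_representation ::
  "('a, 'm) cstar_scheme \<Rightarrow> 'h::complex_hilbert set \<Rightarrow> ('a \<Rightarrow> 'h \<Rightarrow> 'h) \<Rightarrow> bool" where
  "irreducible_representation A X \<pi> \<longleftrightarrow>
     representation A X \<pi> \<and> X \<noteq> {0} \<and>
     (\<forall>M. closed_csubspace M \<and> M \<subseteq> X \<and> (\<forall>a\<in>carrier A. \<forall>x\<in>M. \<pi> a x \<in> M) \<longrightarrow> M = {0} \<or> M = X)"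

definition unitarily_equivalent ::
  "('a, 'm) cstar_scheme \<Rightarrow> 'h::complex_hilbert set \<Rightarrow> ('a \<Rightarrow> 'h \<Rightarrow> 'h) \<Rightarrow>
   'k::complex_hilbert set \<Rightarrow> ('a \<Rightarrow> 'k \<Rightarrow> 'k) \<Rightarrow> bool" where
  "unitarily_equivalent A X \<pi> Y \<rho> \<longleftrightarrow>
     (\<exists>U. bij_betw U X Y \<and>
        (\<forall>x\<in>X. \<forall>y\<in>X. U (x + y) = U x + U y) \<and>
        (\<forall>c. \<forall>x\<in>X. U (c *\<^sub>C x) = c *\<^sub>C U x) \<and>
        (\<forall>x\<in>X. \<forall>y\<in>X. cinner (U x) (U y) = cinner x y) \<and>
        (\<forall>a\<in>carrier A. \<forall>x\<in>X. U (\<pi> a x) = \<rho> a (U x)))"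

section \<open>The weighted shifts and the listed representations\<close>

text \<open>
  \<open>\<H> m\<close> has the orthonormal basis \<open>ket [k\<^sub>1, \<dots>, k\<^sub>m]\<close>; in particular \<open>\<H> 0\<close> is
  one-dimensional. List positions start at 0, so \<open>k\<^sub>r\<close> is \<open>k ! (r - 1)\<close> and
  \<open>k\<^sub>r\<^sub>+\<^sub>1 + \<dots> + k\<^sub>m\<close> is \<open>sum_list (drop r k)\<close>, which is 0 for \<open>r = m\<close>.
  Bounded operators on \<open>\<H> m\<close> are determined by their values on the basis, and the operators
  below are given by these values.
\<close>

definition hilbert_H :: "nat \<Rightarrow> nat list ell2 set" (\<open>\<H>\<close>) where
  "\<H> m = {f. \<forall>k. length k \<noteq> m \<longrightarrow> ell2_apply f k = 0}"

definition weighted_shift :: "real \<Rightarrow> nat \<Rightarrow> nat list \<Rightarrow> nat list ell2" where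
  "weighted_shift q r k =
     complex_of_real (sqrt ((1 - q ^ (1 + k ! (r - 1))) * q ^ sum_list (drop r k)))
       *\<^sub>C ket (k[r - 1 := 1 + k ! (r - 1)])"

text \<open>
  The value of \<open>\<rho>\<^sub>j\<^sup>\<theta>(z\<^sub>i)\<close> at \<open>ket k\<close>, \<open>length k = j - 1\<close>. For \<open>j = 1\<close> only \<open>k = []\<close> and the first
  two cases occur, and the values are \<open>0\<close> for \<open>i \<le> n - 1\<close> and \<open>\<theta> *\<^sub>C ket []\<close> for \<open>i = n\<close>.
\<close>

definition rho_on_basis :: "real \<Rightarrow> nat \<Rightarrow> nat \<Rightarrow> complex \<Rightarrow> nat \<Rightarrow> nat list \<Rightarrow> nat list ell2" where
  "rho_on_basis q n j \<theta> i k =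
     (if i \<le> n - j then 0
      else if i = n - j + 1 then (\<theta> * complex_of_real (q powr (real (sum_list k) / 2))) *\<^sub>C ket k
      else weighted_shift q (i + j - n - 1) k)"

definition sigma_on_basis :: "real \<Rightarrow> nat \<Rightarrow> nat list \<Rightarrow> nat list ell2" where
  "sigma_on_basis q i k = weighted_shift q i k"

end

theory Submission
  imports Defs
begin

text \<open>
  All listed representations are instances of one family, indexed by a number \<open>N\<close> with
  \<open>0 \<le> N \<le> n\<close> and a phase \<open>\<theta>\<close>: for \<open>N = 0\<close> it is \<open>\<sigma>\<close>, for \<open>N = n - j + 1\<close> it is
  \<open>\<rho>\<^sub>j\<^sup>\<theta>\<close>. The generators below \<open>N\<close> act as zero, \<open>z\<^sub>N\<close> acts diagonally, and the generators
  above \<open>N\<close> are weighted shifts. Writing \<open>D\<^sub>i = 1 - \<Sum>\<^sub>j\<^sub>>\<^sub>i z\<^sub>j z\<^sub>j\<^sup>*\<close>, the relations read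
  \<open>z\<^sub>i\<^sup>* z\<^sub>i = q z\<^sub>i z\<^sub>i\<^sup>* + (1 - q) D\<^sub>i\<close>, and they imply \<open>D\<^sub>i z\<^sub>j = q z\<^sub>j D\<^sub>i\<close> for \<open>j > i\<close>
  and \<open>D\<^sub>i z\<^sub>j = z\<^sub>j D\<^sub>i\<close> for \<open>j \<le> i\<close>.

  Let an irreducible representation be given and let \<open>N\<close> be the least index with \<open>D\<^sub>N \<noteq> 0\<close>
  (lemma \<open>threshold\<close>). Then \<open>z\<^sub>i z\<^sub>i\<^sup>* = D\<^sub>i - D\<^sub>i\<^sub>-\<^sub>1 = 0\<close> for \<open>i < N\<close>, and if \<open>N \<ge> 1\<close>, then
  \<open>z\<^sub>N\<close> is normal with \<open>z\<^sub>N\<^sup>* z\<^sub>N = D\<^sub>N\<close>. As \<open>z\<^sub>j\<^sup>*\<close> with \<open>j > N\<close> multiplies eigenvalues of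
  \<open>D\<^sub>N\<close> by \<open>1/q\<close> and \<open>D\<^sub>N\<close> is bounded, vectors near the top of its spectrum are almost
  killed by all these \<open>z\<^sub>j\<^sup>*\<close>, and the powers of \<open>D\<^sub>N\<close> push such a vector to an exact vacuum
  \<open>\<Omega>\<close> (lemma \<open>vacuum_exists\<close>). On the space of vacua \<open>z\<^sub>N\<close> is unitary; it is a scalar
  \<open>\<theta>\<close> there, since a reducing subspace of the vacua would generate a reducing subspace of the
  whole representation (lemma \<open>vacuum_eigenvalue\<close>). Such a subspace comes from the
  absolute value of a self-adjoint operator (lemma \<open>self_adjoint_splits\<close>).

  Now \<open>N\<close>, \<open>\<theta>\<close> and the relations determine all inner products of words in the \<open>z\<^sub>j\<close>,
  \<open>j > N\<close>, applied to \<open>\<Omega>\<close>. So the representation is unitarily equivalent to the model with the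
  same \<open>N\<close> and \<open>\<theta>\<close>: the relation that matches equal words in both is isometric and
  compatible with the generators and their adjoints, and its closure is the graph of a unitary
  (lemmas \<open>words_invariant\<close>, \<open>words_inner\<close> and \<open>unitarily_equivalentI\<close>). To pass from the
  generators to the whole algebra one needs that representations are continuous (lemma
  \<open>representation_contractive\<close>).

  The models exist by universality, once the operators on the space \<open>\<H> (n - N)\<close> are seen to form
  a C*-algebra in which the model operators satisfy the relations. They are irreducible because
  the powers of \<open>D\<^sub>N\<close>, which multiplies the basis vector of \<open>k\<close> by \<open>q\<^bsup>|k|\<^esup>\<close>, converge to the
  projection to the vacuum. They are pairwise inequivalent because \<open>N\<close> and \<open>\<theta>\<close> can be read off
  from the joint eigenvalues of the \<open>z\<^sub>i\<^sup>*\<close>.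
\<close>

section \<open>Sequences with telescoping increments\<close>

text \<open>
  Stated for an abstract distance \<open>d k l\<close> between the members of a sequence, so that it applies
  to a C*-algebra given by a record as well as to normed spaces.
\<close>

lemma telescoping_distance:
  fixes d :: "nat \<Rightarrow> nat \<Rightarrow> real"
  assumes "\<And>k. d k k \<le> 0" and triangle: "\<And>j k l. d j l \<le> d j k + d k l"
    and step: "\<And>k. d (Suc k) k \<le> b (Suc k) - b k" and "k \<le> l"
  shows "d l k \<le> b l - b k"
  using \<open>k \<le> l\<close>
proof (induction l rule: dec_induct)
  case (step l)
  then show ?case using triangle[of "Suc l" k l] assms(3)[of l] by linarith
qed (use assms(1) in simp)

lemma telescoping_Cauchy:
  fixes d :: "nat \<Rightarrow> nat \<Rightarrow> real"
  assumes "\<And>k. d k k \<le> 0" and "\<And>j k l. d j l \<le> d j k + d k l"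
    and "\<And>k. d (Suc k) k \<le> b (Suc k) - b k"
    and sym: "\<And>k l. d k l = d l k" and b: "convergent b" and e: "0 < e"
  shows "\<exists>N. \<forall>k\<ge>N. \<forall>l\<ge>N. d k l < e"
proof -
  obtain N where N: "\<And>k l. N \<le> k \<Longrightarrow> N \<le> l \<Longrightarrow> norm (b k - b l) < e"
    using CauchyD[OF convergent_Cauchy[OF b] e] by blast
  have "d k l < e" if "N \<le> k" "N \<le> l" for k l
    using telescoping_distance[of d b, OF assms(1-3), of k l] N[OF that] sym[of k l]
      telescoping_distance[of d b, OF assms(1-3), of l k]
    by (cases "k \<le> l") auto
  then show ?thesis by blast
qed

lemma norm_telescoping:
  fixes f :: "nat \<Rightarrow> 'a::real_normed_vector"
  assumes step: "\<And>t. norm (f (Suc t) - f t) \<le> b (Suc t) - b t"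
  shows "s \<le> t \<Longrightarrow> norm (f t - f s) \<le> b t - b s" and "convergent b \<Longrightarrow> Cauchy f"
proof -
  have triangle: "norm (f j - f l) \<le> norm (f j - f k) + norm (f k - f l)" for j k l
    using norm_triangle_ineq[of "f j - f k" "f k - f l"] by simp
  show "norm (f t - f s) \<le> b t - b s" if "s \<le> t"
    by (rule telescoping_distance[of "\<lambda>k l. norm (f k - f l)" b, OF _ triangle step that]) simp
  show "Cauchy f" if "convergent b"
    unfolding Cauchy_iff
    using telescoping_Cauchy[of "\<lambda>k l. norm (f k - f l)" b, OF _ triangle step norm_minus_commute that]
    by simp
qed

section \<open>Complex inner products\<close>

lemma scaleC_one [simp]: "1 *\<^sub>C x = (x::'h::complex_hilbert)"
  using scaleR_scaleC[of 1 x] by simp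

lemma scaleC_zero_left [simp]: "0 *\<^sub>C x = (0::'h::complex_hilbert)"
  using scaleR_scaleC[of 0 x] by simp

lemma scaleC_zero_right [simp]: "c *\<^sub>C 0 = (0::'h::complex_hilbert)"
  using scaleC_scaleC[of c 0 "0::'h"] by simp

lemma scaleC_minus_one [simp]: "(-1) *\<^sub>C x = - (x::'h::complex_hilbert)"
  using scaleR_scaleC[of "-1" x] by simp

lemma scaleC_minus_left: "(- c) *\<^sub>C x = - (c *\<^sub>C (x::'h::complex_hilbert))"
  using scaleC_scaleC[of "-1" c x] by simp

lemma scaleC_minus_right: "c *\<^sub>C (- x) = - (c *\<^sub>C (x::'h::complex_hilbert))"
  using scaleC_scaleC[of c "-1" x] by (simp add: scaleC_minus_left)

lemma scaleC_diff_right: "c *\<^sub>C (x - y) = c *\<^sub>C x - c *\<^sub>C (y::'h::complex_hilbert)"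
  using scaleC_add_right[of c x "-y"] by (simp add: scaleC_minus_right)

lemma scaleC_diff_left: "(c - d) *\<^sub>C x = c *\<^sub>C x - d *\<^sub>C (x::'h::complex_hilbert)"
  using scaleC_add_left[of c "-d" x] by (simp add: scaleC_minus_left)

lemma cinner_add_right: "cinner x (y + w) = cinner x y + cinner x (w::'h::complex_hilbert)"
  by (metis cinner_commute cinner_add_left complex_cnj_add)

lemma cinner_scaleC_right: "cinner x (c *\<^sub>C y) = cnj c * cinner x (y::'h::complex_hilbert)"
  by (metis cinner_commute cinner_scaleC_left complex_cnj_mult)

lemma cinner_self: "cinner x x = complex_of_real ((norm (x::'h::complex_hilbert))\<^sup>2)"
proof -
  have "cinner x x \<in> \<real>"
    using cinner_commute[of x x] by (simp add: Reals_cnj_iff)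
  then have "cinner x x = complex_of_real (Re (cinner x x))"
    by (simp add: of_real_Re)
  then show ?thesis
    by (simp add: inner_eq_Re_cinner[symmetric] power2_norm_eq_inner)
qed

lemma norm_scaleC: "norm (c *\<^sub>C x) = cmod c * norm (x::'h::complex_hilbert)"
proof -
  have "complex_of_real ((norm (c *\<^sub>C x))\<^sup>2) = (c * cnj c) * cinner x x"
    unfolding cinner_self[symmetric]
    by (simp add: cinner_scaleC_left cinner_scaleC_right mult.assoc)
  also have "\<dots> = complex_of_real ((cmod c * norm x)\<^sup>2)"
    by (simp only: complex_norm_square[symmetric] cinner_self power_mult_distrib of_real_mult
        of_real_power)
  finally have "complex_of_real ((norm (c *\<^sub>C x))\<^sup>2) = complex_of_real ((cmod c * norm x)\<^sup>2)" .
  then have "(norm (c *\<^sub>C x))\<^sup>2 = (cmod c * norm x)\<^sup>2"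
    by (simp only: of_real_eq_iff)
  then show ?thesis
    by (simp add: power2_eq_iff_nonneg)
qed

text \<open>Rotating \<open>x\<close> by a phase turns the complex inner product into the real one.\<close>

lemma cinner_le_norm: "cmod (cinner x y) \<le> norm x * norm (y::'h::complex_hilbert)"
proof (cases "cinner x y = 0")
  case False
  define u where "u = cnj (cinner x y) / complex_of_real (cmod (cinner x y))"
  have u: "cmod u = 1" using False by (simp add: u_def norm_divide)
  have "cinner (u *\<^sub>C x) y = complex_of_real (cmod (cinner x y))"
    using False
    by (simp add: cinner_scaleC_left u_def mult.commute[of "cnj _"] complex_norm_square[symmetric]
        power2_eq_square)
  then have "cmod (cinner x y) = inner (u *\<^sub>C x) y"
    by (simp add: inner_eq_Re_cinner)
  also have "\<dots> \<le> norm (u *\<^sub>C x) * norm y" by (rule norm_cauchy_schwarz)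
  finally show ?thesis by (simp add: norm_scaleC u)
qed simp

lemma bounded_bilinear_cinner:
  "bounded_bilinear (cinner :: 'h::complex_hilbert \<Rightarrow> 'h \<Rightarrow> complex)"
proof
  fix x y w :: 'h and r :: real
  show "cinner (x + y) w = cinner x w + cinner y w" by (rule cinner_add_left)
  show "cinner x (y + w) = cinner x y + cinner x w" by (rule cinner_add_right)
  show "cinner (r *\<^sub>R x) y = r *\<^sub>R cinner x y"
    by (simp add: scaleR_scaleC cinner_scaleC_left scaleR_conv_of_real)
  show "cinner x (r *\<^sub>R y) = r *\<^sub>R cinner x y"
    by (simp add: scaleR_scaleC cinner_scaleC_right scaleR_conv_of_real)
  show "\<exists>K. \<forall>a b. norm (cinner a (b::'h)) \<le> norm a * norm b * K"
    by (rule exI[of _ 1]) (simp add: cinner_le_norm)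
qed

interpretation cinner: bounded_bilinear "cinner :: 'h::complex_hilbert \<Rightarrow> 'h \<Rightarrow> complex"
  by (rule bounded_bilinear_cinner)

lemma bounded_linear_scaleC: "bounded_linear (\<lambda>x::'h::complex_hilbert. c *\<^sub>C x)"
  by (rule bounded_linear_intro[where K = "cmod c"])
    (simp_all add: scaleC_add_right scaleR_scaleC scaleC_scaleC norm_scaleC mult.commute)

lemmas tendsto_scaleC = bounded_linear.tendsto[OF bounded_linear_scaleC]

lemma eqI_cinner:
  assumes "\<And>w. w \<in> X \<Longrightarrow> cinner x w = cinner y w" and "x - y \<in> X"
  shows "x = (y::'h::complex_hilbert)"
proof -
  have "cinner (x - y) (x - y) = 0"
    using assms by (simp add: cinner.diff_left)
  then show ?thesis by (simp add: cinner_self)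
qed

section \<open>Bounded operators on a closed subspace\<close>

lemma csubspaceD:
  assumes "closed_csubspace X"
  shows "closed X" "0 \<in> X" "\<And>x y. x \<in> X \<Longrightarrow> y \<in> X \<Longrightarrow> x + y \<in> X"
    "\<And>c x. x \<in> X \<Longrightarrow> c *\<^sub>C x \<in> X" "\<And>x. x \<in> X \<Longrightarrow> - x \<in> X"
    "\<And>x y. x \<in> X \<Longrightarrow> y \<in> X \<Longrightarrow> x - y \<in> X"
proof -
  show 1: "closed X" "0 \<in> X" "\<And>x y. x \<in> X \<Longrightarrow> y \<in> X \<Longrightarrow> x + y \<in> X"
    "\<And>c x. x \<in> X \<Longrightarrow> c *\<^sub>C x \<in> X"
    using assms by (auto simp: closed_csubspace_def)
  show 2: "- x \<in> X" if "x \<in> X" for x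
    using 1(4)[OF that, of "-1"] by simp
  show "x - y \<in> X" if "x \<in> X" "y \<in> X" for x y
    using 1(3)[OF that(1) 2[OF that(2)]] by simp
qed

lemma csubspace_sum:
  assumes "closed_csubspace X" and "\<And>i. i \<in> F \<Longrightarrow> f i \<in> X"
  shows "sum f F \<in> X"
  using assms(2) by (induction F rule: infinite_finite_induct) (auto intro: csubspaceD[OF assms(1)])

lemma bounded_operatorD:
  assumes "bounded_operator_on X T"
  shows "\<And>x. x \<in> X \<Longrightarrow> T x \<in> X" "\<And>x y. x \<in> X \<Longrightarrow> y \<in> X \<Longrightarrow> T (x + y) = T x + T y"
    "\<And>c x. x \<in> X \<Longrightarrow> T (c *\<^sub>C x) = c *\<^sub>C T x"
  using assms by (auto simp: bounded_operator_on_def)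

lemma bounded_operator_bound:
  assumes "bounded_operator_on X T"
  obtains K where "0 < K" "\<And>x. x \<in> X \<Longrightarrow> norm (T x) \<le> K * norm x"
proof -
  obtain K where K: "\<And>x. x \<in> X \<Longrightarrow> norm (T x) \<le> K * norm x"
    using assms unfolding bounded_operator_on_def by blast
  have "norm (T x) \<le> (\<bar>K\<bar> + 1) * norm x" if "x \<in> X" for x
    by (rule order_trans[OF K[OF that]]) (simp add: mult_right_mono)
  then show thesis by (intro that[of "\<bar>K\<bar> + 1"]) auto
qed

lemma bounded_operator_linear:
  assumes "closed_csubspace X" and T: "bounded_operator_on X T"
  shows "T 0 = 0" "\<And>x. x \<in> X \<Longrightarrow> T (- x) = - T x"
    "\<And>x y. x \<in> X \<Longrightarrow> y \<in> X \<Longrightarrow> T (x - y) = T x - T y"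
proof -
  note X = csubspaceD[OF assms(1)] and T = bounded_operatorD[OF T]
  show "T 0 = 0" using T(3)[OF X(2), of 0] by simp
  show 1: "T (- x) = - T x" if "x \<in> X" for x
    using T(3)[OF that, of "-1"] by simp
  show "T (x - y) = T x - T y" if "x \<in> X" "y \<in> X" for x y
    using T(2)[OF that(1) X(5)[OF that(2)]] 1[OF that(2)] by simp
qed

lemma bounded_operator_sum:
  assumes X: "closed_csubspace X" and T: "bounded_operator_on X T"
    and "\<And>i. i \<in> F \<Longrightarrow> f i \<in> X"
  shows "T (sum f F) = (\<Sum>i\<in>F. T (f i))"
  using assms(3)
proof (induction F rule: infinite_finite_induct)
  case (insert i F)
  then have "sum f F \<in> X" by (intro csubspace_sum[OF X]) auto
  then show ?case
    using insert by (simp add: bounded_operatorD(2)[OF T])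
qed (simp_all add: bounded_operator_linear(1)[OF X T])

lemma bounded_operator_tendsto:
  assumes X: "closed_csubspace X" and T: "bounded_operator_on X T"
    and "\<And>k. f k \<in> X" and "x \<in> X" and f: "(f \<longlongrightarrow> x) F"
  shows "((\<lambda>k. T (f k)) \<longlongrightarrow> T x) F"
proof -
  obtain K where K: "0 < K" "\<And>x. x \<in> X \<Longrightarrow> norm (T x) \<le> K * norm x"
    by (rule bounded_operator_bound[OF T]) blast
  have "((\<lambda>k. K * norm (f k - x)) \<longlongrightarrow> 0) F"
    using f by (intro tendsto_mult_right_zero tendsto_norm_zero) (simp add: LIM_zero)
  then have "((\<lambda>k. T (f k) - T x) \<longlongrightarrow> 0) F"
  proof (rule Lim_null_comparison[rotated])
    show "\<forall>\<^sub>F k in F. norm (T (f k) - T x) \<le> K * norm (f k - x)"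
      using assms K(2)[of "f _ - x"]
      by (simp add: bounded_operator_linear(3)[OF X T, symmetric] csubspaceD(6)[OF X])
  qed
  then show ?thesis by (simp add: LIM_zero_iff)
qed

lemma bounded_operator_restrict:
  assumes "bounded_operator_on X T" and "V \<subseteq> X" and "\<And>x. x \<in> V \<Longrightarrow> T x \<in> V"
  shows "bounded_operator_on V T"
proof -
  obtain K where "\<And>x. x \<in> X \<Longrightarrow> norm (T x) \<le> K * norm x"
    using bounded_operator_bound[OF assms(1)] by metis
  then show ?thesis
    using assms(2,3) bounded_operatorD(2,3)[OF assms(1)]
    unfolding bounded_operator_on_def by (intro conjI ballI allI exI[of _ K]) (auto simp: subset_iff)
qed

lemma bounded_operator_combine:
  assumes X: "closed_csubspace X" and T: "bounded_operator_on X T" and S: "bounded_operator_on X S"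
  shows "bounded_operator_on X (\<lambda>x. a *\<^sub>C T x + b *\<^sub>C S x)"
proof -
  note TD = bounded_operatorD[OF T] and SD = bounded_operatorD[OF S]
  obtain K K' where K: "\<And>x. x \<in> X \<Longrightarrow> norm (T x) \<le> K * norm x"
    "\<And>x. x \<in> X \<Longrightarrow> norm (S x) \<le> K' * norm x"
    using bounded_operator_bound[OF T] bounded_operator_bound[OF S] by metis
  show ?thesis
    unfolding bounded_operator_on_def
  proof (intro conjI ballI allI exI)
    fix x c assume x: "x \<in> X"
    show "a *\<^sub>C T x + b *\<^sub>C S x \<in> X" using x by (intro csubspaceD[OF X] TD SD)
    show "a *\<^sub>C T (c *\<^sub>C x) + b *\<^sub>C S (c *\<^sub>C x) = c *\<^sub>C (a *\<^sub>C T x + b *\<^sub>C S x)"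
      using x by (simp add: TD SD scaleC_add_right scaleC_scaleC mult.commute)
    have "norm (a *\<^sub>C T x + b *\<^sub>C S x) \<le> cmod a * norm (T x) + cmod b * norm (S x)"
      by (metis norm_triangle_ineq norm_scaleC)
    also have "\<dots> \<le> cmod a * (K * norm x) + cmod b * (K' * norm x)"
      using K x by (intro add_mono mult_left_mono) auto
    finally show "norm (a *\<^sub>C T x + b *\<^sub>C S x) \<le> (cmod a * K + cmod b * K') * norm x"
      by (simp add: algebra_simps)
    fix y assume "y \<in> X"
    then show "a *\<^sub>C T (x + y) + b *\<^sub>C S (x + y) = a *\<^sub>C T x + b *\<^sub>C S x + (a *\<^sub>C T y + b *\<^sub>C S y)"
      using x by (simp add: TD SD scaleC_add_right)
  qed
qed

lemma bounded_operator_id: "closed_csubspace X \<Longrightarrow> bounded_operator_on X (\<lambda>x. x)"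
  unfolding bounded_operator_on_def by (auto intro!: exI[of _ 1])

lemma bounded_operator_compose:
  assumes T: "bounded_operator_on X T" and S: "bounded_operator_on X S"
  shows "bounded_operator_on X (\<lambda>x. T (S x))"
proof -
  obtain K K' where K: "0 < K" "\<And>x. x \<in> X \<Longrightarrow> norm (T x) \<le> K * norm x"
    "\<And>x. x \<in> X \<Longrightarrow> norm (S x) \<le> K' * norm x"
    using bounded_operator_bound[OF T] bounded_operator_bound[OF S] by metis
  have "norm (T (S x)) \<le> (K * K') * norm x" if "x \<in> X" for x
    using order_trans[OF K(2)[OF bounded_operatorD(1)[OF S that]] mult_left_mono[OF K(3)[OF that]]] K(1)
    by (simp add: mult.assoc)
  then show ?thesis
    using bounded_operatorD[OF T] bounded_operatorD[OF S] unfolding bounded_operator_on_def by auto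
qed

lemma bounded_operator_diff:
  assumes "closed_csubspace X" "bounded_operator_on X T" "bounded_operator_on X S"
  shows "bounded_operator_on X (\<lambda>x. T x - S x)"
  using bounded_operator_combine[OF assms, of 1 "-1"] by simp

lemma bounded_operator_sum_op:
  assumes X: "closed_csubspace X" and "\<And>i. i \<in> F \<Longrightarrow> bounded_operator_on X (T i)"
  shows "bounded_operator_on X (\<lambda>x. \<Sum>i\<in>F. T i x)"
  using assms(2)
proof (induction F rule: infinite_finite_induct)
  case (insert i F)
  then show ?case using bounded_operator_combine[OF X, of "T i" "\<lambda>x. \<Sum>i\<in>F. T i x" 1 1] by simp
qed (use bounded_operator_combine[OF X bounded_operator_id[OF X] bounded_operator_id[OF X], of 0 0] in simp_all)

text \<open>
  A bounded operator almost attains its norm at some unit vector \<open>x\<close>, and there \<open>T\<^sup>* T x\<close> is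
  almost \<open>\<parallel>T\<parallel>\<^sup>2 x\<close>, because \<open>\<parallel>T\<^sup>* T x - \<mu>\<^sup>2 x\<parallel>\<^sup>2 \<le> 2 \<mu>\<^sup>4 - 2 \<mu>\<^sup>2 \<parallel>T x\<parallel>\<^sup>2\<close> for \<open>\<mu> = \<parallel>T\<parallel>\<close>.
\<close>

lemma norm_almost_attained:
  assumes X: "closed_csubspace X" and T: "bounded_operator_on X T" and S: "bounded_operator_on X S"
    and adj: "\<And>x y. x \<in> X \<Longrightarrow> y \<in> X \<Longrightarrow> cinner (S x) y = cinner x (T y)"
  obtains \<mu> where "0 \<le> \<mu>" "\<And>x. x \<in> X \<Longrightarrow> norm (T x) \<le> \<mu> * norm x"
    "\<And>x. x \<in> X \<Longrightarrow> norm (S x) \<le> \<mu> * norm x"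
    "\<And>e. 0 < \<mu> \<Longrightarrow> 0 < e \<Longrightarrow>
       \<exists>x\<in>X. norm x = 1 \<and> norm (S (T x) - complex_of_real (\<mu>\<^sup>2) *\<^sub>C x) < e"
proof -
  note XD = csubspaceD[OF X]
  note TD = bounded_operatorD[OF T] and SD = bounded_operatorD[OF S]
  define B where "B = (\<lambda>x. norm (T x)) ` {x\<in>X. norm x \<le> 1}"
  define \<mu> where "\<mu> = Sup B"
  obtain K where K: "0 < K" "\<And>x. x \<in> X \<Longrightarrow> norm (T x) \<le> K * norm x"
    by (rule bounded_operator_bound[OF T]) blast
  have bdd: "bdd_above B"
    unfolding B_def
  proof (rule bdd_aboveI2)
    fix x assume "x \<in> {x\<in>X. norm x \<le> 1}"
    then show "norm (T x) \<le> K"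
      using order_trans[OF K(2)[of x] mult_left_le[of "norm x" K]] K(1) by simp
  qed
  have ne: "B \<noteq> {}" using XD(2) by (auto simp: B_def intro!: exI[of _ 0])
  have normT: "norm (T x) \<le> \<mu> * norm x" if x: "x \<in> X" for x
  proof (cases "x = 0")
    case False
    have "norm (T (complex_of_real (1 / norm x) *\<^sub>C x)) \<in> B"
      unfolding B_def using x XD(4)[OF x] False by (intro imageI) (auto simp: norm_scaleC norm_divide)
    then have "norm (T (complex_of_real (1 / norm x) *\<^sub>C x)) \<le> \<mu>"
      unfolding \<mu>_def using bdd by (rule cSup_upper)
    then show ?thesis
      using False x by (simp add: TD(3) norm_scaleC norm_divide field_simps)
  qed (simp add: bounded_operator_linear(1)[OF X T])
  have \<mu>0: "0 \<le> \<mu>"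
  proof -
    have "norm (T 0) \<in> B" using XD(2) by (auto simp: B_def)
    then have "norm (T 0) \<le> \<mu>" unfolding \<mu>_def using bdd by (rule cSup_upper)
    then show ?thesis using norm_ge_zero order_trans by blast
  qed
  have normS: "norm (S x) \<le> \<mu> * norm x" if x: "x \<in> X" for x
  proof (cases "norm (S x) = 0")
    case False
    have "(norm (S x))\<^sup>2 = cmod (cinner x (T (S x)))"
      using adj[OF x SD(1)[OF x]] by (metis cinner_self norm_of_real abs_power2)
    also have "\<dots> \<le> norm x * norm (T (S x))" by (rule cinner_le_norm)
    also have "\<dots> \<le> norm x * (\<mu> * norm (S x))"
      by (intro mult_left_mono normT SD(1) x) simp
    finally have "norm (S x) * norm (S x) \<le> (\<mu> * norm x) * norm (S x)"
      by (simp add: power2_eq_square algebra_simps)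
    then show ?thesis using False by (simp add: mult_le_cancel_right)
  qed (use \<mu>0 in simp)
  have main: "\<exists>x\<in>X. norm x = 1 \<and> norm (S (T x) - complex_of_real (\<mu>\<^sup>2) *\<^sub>C x) < e"
    if \<mu>: "0 < \<mu>" and e: "0 < e" for e
  proof -
    \<comment> \<open>If \<open>\<parallel>T x\<parallel>\<^sup>2 > \<mu>\<^sup>2 - d\<close>, the squared error is below \<open>2 \<mu>\<^sup>2 d \<le> e\<^sup>2\<close>;
      and \<open>d \<le> \<mu>\<^sup>2\<close> keeps the root below real.\<close>
    define d where "d = min (\<mu>\<^sup>2) (e\<^sup>2 / (2 * \<mu>\<^sup>2))"
    have "2 * \<mu>\<^sup>2 * d \<le> 2 * \<mu>\<^sup>2 * (e\<^sup>2 / (2 * \<mu>\<^sup>2))"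
      unfolding d_def by (intro mult_left_mono) auto
    then have d: "0 < d" "d \<le> \<mu>\<^sup>2" "2 * \<mu>\<^sup>2 * d \<le> e\<^sup>2"
      using \<mu> e by (auto simp: d_def)
    have "sqrt (\<mu>\<^sup>2 - d) < \<mu>"
      using \<mu> d by (intro real_less_lsqrt) auto
    then obtain y where y: "y \<in> X" "norm y \<le> 1" "sqrt (\<mu>\<^sup>2 - d) < norm (T y)"
      unfolding \<mu>_def using less_cSup_iff[OF ne bdd] by (auto simp: B_def)
    have y0: "y \<noteq> 0"
      using y(3) d by (auto simp: bounded_operator_linear(1)[OF X T])
    define x where "x = complex_of_real (1 / norm y) *\<^sub>C y"
    have x: "x \<in> X" "norm x = 1"
      using y y0 XD(4) by (auto simp: x_def norm_scaleC norm_divide)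
    have "norm (T y) = norm y * norm (T x)"
      using y(1) y0 by (simp add: x_def TD(3) norm_scaleC norm_divide)
    then have "norm (T y) \<le> norm (T x)"
      using mult_right_mono[OF y(2), of "norm (T x)"] by simp
    then have "sqrt (\<mu>\<^sup>2 - d) < norm (T x)" using y(3) by linarith
    then have Tx: "\<mu>\<^sup>2 - d < (norm (T x))\<^sup>2"
      using d power_strict_mono[of "sqrt (\<mu>\<^sup>2 - d)" "norm (T x)" 2] by simp
    have "norm (S (T x)) \<le> \<mu> * \<mu>"
      using order_trans[OF normS[OF TD(1)[OF x(1)]] mult_left_mono[OF normT[OF x(1)] \<mu>0]] x(2)
      by simp
    then have STx: "(norm (S (T x)))\<^sup>2 \<le> \<mu>\<^sup>2 * \<mu>\<^sup>2"
      using power_mono[of "norm (S (T x))" "\<mu> * \<mu>" 2] by (simp add: power_mult_distrib)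
    have "inner (S (T x)) x = (norm (T x))\<^sup>2"
      using adj[OF TD(1)[OF x(1)] x(1)] by (simp add: inner_eq_Re_cinner cinner_self)
    then have "(norm (S (T x) - \<mu>\<^sup>2 *\<^sub>R x))\<^sup>2 = (norm (S (T x)))\<^sup>2 - 2 * \<mu>\<^sup>2 * (norm (T x))\<^sup>2 + \<mu>\<^sup>2 * \<mu>\<^sup>2"
      using dot_norm_neg[of "S (T x)" "\<mu>\<^sup>2 *\<^sub>R x"] x(2)
      by (simp add: power_mult_distrib power2_eq_square)
    also have "\<dots> \<le> 2 * \<mu>\<^sup>2 * (\<mu>\<^sup>2 - (norm (T x))\<^sup>2)"
      using STx by (simp add: algebra_simps)
    also have "\<dots> < 2 * \<mu>\<^sup>2 * d"
      using Tx \<mu> by (intro mult_strict_left_mono) auto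
    also have "\<dots> \<le> e\<^sup>2" by (rule d(3))
    finally have "norm (S (T x) - \<mu>\<^sup>2 *\<^sub>R x) < e"
      using e by (simp add: power_less_imp_less_base)
    then show ?thesis using x by (auto simp: scaleR_scaleC)
  qed
  show thesis using \<mu>0 normT normS main by (rule that)
qed

section \<open>Continuity of representations\<close>

context unital_cstar_algebra
begin

lemma anorm_zero [simp]: "anorm A \<zero> = 0"
  using anorm_eq_zero[of \<zero>] by simp

lemma ascale_minus_one: "x \<in> carrier A \<Longrightarrow> ascale A (-1) x = \<ominus> x"
proof -
  assume x: "x \<in> carrier A"
  have z: "ascale A 0 x = \<zero>"
    using anorm_ascale[OF x, of 0] anorm_eq_zero[OF ascale_closed[OF x], of 0] by simp
  have "x \<oplus> ascale A (-1) x = \<zero>"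
    using ascale_add_left[OF x, of 1 "-1"] z by (simp add: ascale_one x)
  then show ?thesis using x ascale_closed[OF x, of "-1"]
    by (metis add.inv_unique' a_comm a_inv_def)
qed

lemma anorm_uminus: "x \<in> carrier A \<Longrightarrow> anorm A (\<ominus> x) = anorm A x"
  using anorm_ascale[of x "-1"] by (simp add: ascale_minus_one)

lemma anorm_minus_commute:
  assumes "x \<in> carrier A" "y \<in> carrier A"
  shows "anorm A (x \<ominus> y) = anorm A (y \<ominus> x)"
proof -
  have "y \<ominus> x = \<ominus> (x \<ominus> y)" using assms by algebra
  then show ?thesis using assms by (simp add: anorm_uminus)
qed

lemma anorm_triangle_minus:
  assumes "x \<in> carrier A" "y \<in> carrier A" "w \<in> carrier A"
  shows "anorm A (x \<ominus> w) \<le> anorm A (x \<ominus> y) + anorm A (y \<ominus> w)"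
proof -
  have "x \<ominus> w = (x \<ominus> y) \<oplus> (y \<ominus> w)" using assms by algebra
  then show ?thesis using assms anorm_triangle[of "x \<ominus> y" "y \<ominus> w"] by simp
qed

lemma astar_uminus: "x \<in> carrier A \<Longrightarrow> astar A (\<ominus> x) = \<ominus> astar A x"
  using astar_ascale[of x "-1"] by (simp add: ascale_minus_one astar_closed)

lemma astar_minus:
  "x \<in> carrier A \<Longrightarrow> y \<in> carrier A \<Longrightarrow> astar A (x \<ominus> y) = astar A x \<ominus> astar A y"
  by (simp add: a_minus_def astar_add astar_uminus)

lemma anorm_astar:
  assumes "x \<in> carrier A"
  shows "anorm A (astar A x) = anorm A x"
proof -
  have le: "anorm A y \<le> anorm A (astar A y)" if y: "y \<in> carrier A" for y
  proof (cases "anorm A y = 0")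
    case False
    have "anorm A y * anorm A y \<le> anorm A (astar A y) * anorm A y"
      using cstar_identity[OF y] anorm_mult[OF astar_closed[OF y] y] by (simp add: power2_eq_square)
    then show ?thesis using False anorm_ge_zero[OF y] by (simp add: mult_le_cancel_right)
  qed (simp add: anorm_ge_zero astar_closed y)
  show ?thesis
    using le[OF assms] le[OF astar_closed[OF assms]] by (simp add: astar_astar assms)
qed

text \<open>
  The Neumann series, obtained as the limit of the iteration \<open>g \<mapsto> 1 + g c\<close>, which contracts
  distances by the factor \<open>\<parallel>c\<parallel>\<close>.
\<close>

lemma left_inverse_one_minus:
  assumes c: "c \<in> carrier A" and lt: "anorm A c < 1"
  obtains g where "g \<in> carrier A" "g \<otimes> (\<one> \<ominus> c) = \<one>"
proof -
  define s where "s k = ((\<lambda>g. \<one> \<oplus> g \<otimes> c) ^^ k) \<zero>" for k :: nat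
  have s0: "s 0 = \<zero>" and sSuc: "s (Suc k) = \<one> \<oplus> s k \<otimes> c" for k
    by (simp_all add: s_def)
  have s: "s k \<in> carrier A" for k
    by (induction k) (auto simp: s0 sSuc c)
  define r where "r = anorm A c"
  have r: "0 \<le> r" "r < 1" using lt anorm_ge_zero[OF c] by (auto simp: r_def)
  define b where "b = anorm A (s 1 \<ominus> s 0)"
  have contract: "anorm A ((\<one> \<oplus> x \<otimes> c) \<ominus> (\<one> \<oplus> y \<otimes> c)) \<le> anorm A (x \<ominus> y) * r"
    if "x \<in> carrier A" "y \<in> carrier A" for x y
  proof -
    have "(\<one> \<oplus> x \<otimes> c) \<ominus> (\<one> \<oplus> y \<otimes> c) = (x \<ominus> y) \<otimes> c"
      using that c by algebra
    then show ?thesis using anorm_mult[of "x \<ominus> y" c] that c by (simp add: r_def)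
  qed
  have step: "anorm A (s (Suc k) \<ominus> s k) \<le> b * r ^ k" for k
  proof (induction k)
    case (Suc k)
    have "anorm A (s (Suc (Suc k)) \<ominus> s (Suc k)) \<le> anorm A (s (Suc k) \<ominus> s k) * r"
      using contract[OF s s, of "Suc k" k] by (simp only: sSuc)
    also have "\<dots> \<le> b * r ^ k * r" using Suc r by (intro mult_right_mono) auto
    finally show ?case by (simp add: mult_ac)
  qed (simp add: b_def)
  define b' where "b' k = - (b * r ^ k / (1 - r))" for k
  have "b' \<longlonglongrightarrow> - (b * 0 / (1 - r))"
    unfolding b'_def using r by (intro tendsto_intros LIMSEQ_power_zero) auto
  then have b': "convergent b'" by (rule convergentI)
  have step': "anorm A (s (Suc k) \<ominus> s k) \<le> b' (Suc k) - b' k" for k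
  proof -
    have "b' (Suc k) - b' k = b * r ^ k * (1 - r) / (1 - r)"
      by (simp add: b'_def algebra_simps diff_divide_distrib)
    then show ?thesis using step[of k] r by simp
  qed
  have self: "anorm A (s k \<ominus> s k) \<le> 0" for k
  proof -
    have "s k \<ominus> s k = \<zero>" using s by algebra
    then show ?thesis by simp
  qed
  have "\<exists>x\<in>carrier A. (\<lambda>k. anorm A (s k \<ominus> x)) \<longlonglongrightarrow> 0"
    by (rule complete) (use s telescoping_Cauchy[of "\<lambda>k l. anorm A (s k \<ominus> s l)" b', OF self anorm_triangle_minus[OF s s s] step'
        anorm_minus_commute[OF s s] b'] in blast)+
  then obtain g where g: "g \<in> carrier A" and lim: "(\<lambda>k. anorm A (s k \<ominus> g)) \<longlonglongrightarrow> 0" by blast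
  have "anorm A (g \<ominus> (\<one> \<oplus> g \<otimes> c)) \<le> 0"
  proof (rule LIMSEQ_le_const)
    show "(\<lambda>k. anorm A (s (Suc k) \<ominus> g) + anorm A (s k \<ominus> g) * r) \<longlonglongrightarrow> 0"
      using tendsto_add[OF LIMSEQ_Suc[OF lim] tendsto_mult_right[OF lim, of r]]
      by (simp add: mult.commute)
    have "anorm A (g \<ominus> (\<one> \<oplus> g \<otimes> c)) \<le> anorm A (s (Suc k) \<ominus> g) + anorm A (s k \<ominus> g) * r" for k
      using anorm_triangle_minus[of g "s (Suc k)" "\<one> \<oplus> g \<otimes> c"] contract[OF s g, of k] g c s
        anorm_minus_commute[OF g s, of "Suc k"] by (simp add: sSuc)
    then show "\<exists>N. \<forall>k\<ge>N. anorm A (g \<ominus> (\<one> \<oplus> g \<otimes> c)) \<le> anorm A (s (Suc k) \<ominus> g) + anorm A (s k \<ominus> g) * r"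
      by blast
  qed
  then have "g \<ominus> (\<one> \<oplus> g \<otimes> c) = \<zero>"
    using g c anorm_ge_zero[of "g \<ominus> (\<one> \<oplus> g \<otimes> c)"] anorm_eq_zero[of "g \<ominus> (\<one> \<oplus> g \<otimes> c)"] by simp
  then have "g \<otimes> (\<one> \<ominus> c) = \<one>"
  proof -
    assume 0: "g \<ominus> (\<one> \<oplus> g \<otimes> c) = \<zero>"
    have "g \<otimes> (\<one> \<ominus> c) = g \<ominus> g \<otimes> c"
      using g c by (simp add: a_minus_def r_distr r_minus)
    also have "\<dots> = (g \<ominus> (\<one> \<oplus> g \<otimes> c)) \<oplus> \<one>"
      using g c by algebra
    finally have "g \<otimes> (\<one> \<ominus> c) = (g \<ominus> (\<one> \<oplus> g \<otimes> c)) \<oplus> \<one>" .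
    then show ?thesis using 0 by simp
  qed
  then show thesis using g by (rule that[rotated])
qed

end

lemma representationD:
  assumes "representation A X \<pi>"
  shows "closed_csubspace X" "\<And>a. a \<in> carrier A \<Longrightarrow> bounded_operator_on X (\<pi> a)"
    "\<And>a b x. a \<in> carrier A \<Longrightarrow> b \<in> carrier A \<Longrightarrow> x \<in> X \<Longrightarrow> \<pi> (a \<oplus>\<^bsub>A\<^esub> b) x = \<pi> a x + \<pi> b x"
    "\<And>a b x. a \<in> carrier A \<Longrightarrow> b \<in> carrier A \<Longrightarrow> x \<in> X \<Longrightarrow> \<pi> (a \<otimes>\<^bsub>A\<^esub> b) x = \<pi> a (\<pi> b x)"
    "\<And>c a x. a \<in> carrier A \<Longrightarrow> x \<in> X \<Longrightarrow> \<pi> (ascale A c a) x = c *\<^sub>C \<pi> a x"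
    "\<And>x. x \<in> X \<Longrightarrow> \<pi> \<one>\<^bsub>A\<^esub> x = x"
    "\<And>a x y. a \<in> carrier A \<Longrightarrow> x \<in> X \<Longrightarrow> y \<in> X \<Longrightarrow> cinner (\<pi> (astar A a) x) y = cinner x (\<pi> a y)"
    "\<And>a x. a \<in> carrier A \<Longrightarrow> x \<in> X \<Longrightarrow> \<pi> a x \<in> X"
  using assms unfolding representation_def bounded_operator_on_def by blast+

context unital_cstar_algebra
begin

lemma representation_zero:
  assumes "representation A X \<pi>" and "x \<in> X"
  shows "\<pi> \<zero> x = 0"
  using representationD(3)[OF assms(1), of \<zero> \<zero> x] assms(2) by simp

lemma representation_minus:
  assumes \<pi>: "representation A X \<pi>" and x: "x \<in> X" and a: "a \<in> carrier A" and b: "b \<in> carrier A"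
  shows "\<pi> (a \<ominus> b) x = \<pi> a x - \<pi> b x"
proof -
  have "\<pi> (\<ominus> b) x = - \<pi> b x"
    using representationD(5)[OF \<pi> b x, of "-1"] by (simp add: ascale_minus_one b)
  then show ?thesis
    using representationD(3)[OF \<pi> a _ x, of "\<ominus> b"] b by (simp add: a_minus_def)
qed

lemma representation_finsum:
  assumes \<pi>: "representation A X \<pi>" and x: "x \<in> X" and "finite F"
    and "\<And>j. j \<in> F \<Longrightarrow> f j \<in> carrier A"
  shows "\<pi> (\<Oplus>j\<in>F. f j) x = (\<Sum>j\<in>F. \<pi> (f j) x)"
  using assms(3,4)
proof (induction F)
  case (insert j F)
  then show ?case
    using representationD(3)[OF \<pi> _ _ x] by (simp add: Pi_I)
qed (simp add: representation_zero[OF \<pi> x])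

text \<open>
  Let \<open>\<mu> = \<parallel>\<pi>(a)\<parallel>\<close>. If \<open>\<parallel>a\<parallel> < \<mu>\<close>, then \<open>1 - a\<^sup>* a / \<mu>\<^sup>2\<close> has a left inverse in \<open>A\<close>, so its
  image under \<open>\<pi>\<close> is bounded below. But that image almost kills the unit vectors at which
  \<open>\<pi>(a)\<close> almost attains its norm.
\<close>

lemma representation_contractive:
  assumes \<pi>: "representation A X \<pi>" and a: "a \<in> carrier A" and x: "x \<in> X"
  shows "norm (\<pi> a x) \<le> anorm A a * norm x"
proof -
  note R = representationD[OF \<pi>]
  have a': "astar A a \<in> carrier A" using a by (rule astar_closed)
  obtain \<mu> where \<mu>: "0 \<le> \<mu>" "\<And>x. x \<in> X \<Longrightarrow> norm (\<pi> a x) \<le> \<mu> * norm x"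
    and near: "\<And>e. 0 < \<mu> \<Longrightarrow> 0 < e \<Longrightarrow>
       \<exists>x\<in>X. norm x = 1 \<and> norm (\<pi> (astar A a) (\<pi> a x) - complex_of_real (\<mu>\<^sup>2) *\<^sub>C x) < e"
    using norm_almost_attained[OF R(1) R(2)[OF a] R(2)[OF a'] R(7)[OF a]] by metis
  have "\<mu> \<le> anorm A a"
  proof (rule ccontr)
    assume "\<not> \<mu> \<le> anorm A a"
    then have lt: "anorm A a < \<mu>" and pos: "0 < \<mu>"
      using anorm_ge_zero[OF a] by auto
    define c where "c = ascale A (complex_of_real (1 / \<mu>\<^sup>2)) (astar A a \<otimes> a)"
    have c: "c \<in> carrier A" unfolding c_def using a a' by (intro ascale_closed m_closed)
    have "anorm A c = (anorm A a / \<mu>)\<^sup>2"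
      unfolding c_def using a a' pos
      by (simp add: anorm_ascale cstar_identity norm_divide power_divide norm_power)
    also have "\<dots> < 1" using lt pos anorm_ge_zero[OF a] by (simp add: power_less_one_iff)
    finally obtain g where g: "g \<in> carrier A" "g \<otimes> (\<one> \<ominus> c) = \<one>"
      using left_inverse_one_minus[OF c] by blast
    obtain K where K: "0 < K" "\<And>x. x \<in> X \<Longrightarrow> norm (\<pi> g x) \<le> K * norm x"
      by (rule bounded_operator_bound[OF R(2)[OF g(1)]]) blast
    have "0 < \<mu>\<^sup>2 / K" using pos K by simp
    then obtain y where y: "y \<in> X" "norm y = 1"
      "norm (\<pi> (astar A a) (\<pi> a y) - complex_of_real (\<mu>\<^sup>2) *\<^sub>C y) < \<mu>\<^sup>2 / K"
      using near[OF pos] by blast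
    have "\<pi> (\<one> \<ominus> c) y = y - complex_of_real (1 / \<mu>\<^sup>2) *\<^sub>C \<pi> (astar A a) (\<pi> a y)"
      using y(1) c a a' by (simp add: representation_minus[OF \<pi>] R(6)) (simp add: c_def R(4,5))
    also have "\<dots> = - complex_of_real (1 / \<mu>\<^sup>2) *\<^sub>C
        (\<pi> (astar A a) (\<pi> a y) - complex_of_real (\<mu>\<^sup>2) *\<^sub>C y)"
      using pos by (simp add: scaleC_diff_right scaleC_scaleC scaleC_minus_left)
    finally have "norm (\<pi> (\<one> \<ominus> c) y) =
        1 / \<mu>\<^sup>2 * norm (\<pi> (astar A a) (\<pi> a y) - complex_of_real (\<mu>\<^sup>2) *\<^sub>C y)"
      by (simp add: norm_scaleC norm_divide norm_power)
    also have "\<dots> < 1 / \<mu>\<^sup>2 * (\<mu>\<^sup>2 / K)" using y(3) pos by (intro mult_strict_left_mono) auto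
    finally have small: "norm (\<pi> (\<one> \<ominus> c) y) < 1 / K" using pos by simp
    have "y = \<pi> g (\<pi> (\<one> \<ominus> c) y)"
      using R(4)[OF g(1) _ y(1), of "\<one> \<ominus> c"] c g(2) R(6)[OF y(1)] by simp
    then have "1 \<le> K * norm (\<pi> (\<one> \<ominus> c) y)"
      using K(2)[of "\<pi> (\<one> \<ominus> c) y"] R(8)[of "\<one> \<ominus> c" y] c y by simp
    then show False using small K(1) by (simp add: field_simps)
  qed
  then show ?thesis
    using \<mu>(2)[OF x] mult_right_mono[of \<mu> "anorm A a" "norm x"] by simp
qed

lemma representation_tendsto:
  assumes \<pi>: "representation A X \<pi>" and s: "\<And>k. s k \<in> carrier A" and a: "a \<in> carrier A"
    and lim: "(\<lambda>k. anorm A (s k \<ominus> a)) \<longlonglongrightarrow> 0" and x: "x \<in> X"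
  shows "(\<lambda>k. \<pi> (s k) x) \<longlonglongrightarrow> \<pi> a x"
proof -
  have "(\<lambda>k. \<pi> (s k) x - \<pi> a x) \<longlonglongrightarrow> 0"
  proof (rule Lim_null_comparison)
    show "(\<lambda>k. anorm A (s k \<ominus> a) * norm x) \<longlonglongrightarrow> 0"
      using tendsto_mult_right[OF lim, of "norm x"] by (simp add: mult.commute)
    show "\<forall>\<^sub>F k in sequentially. norm (\<pi> (s k) x - \<pi> a x) \<le> anorm A (s k \<ominus> a) * norm x"
      using representation_contractive[OF \<pi> _ x, of "s _ \<ominus> a"] s a
      by (simp add: representation_minus[OF \<pi> x])
  qed
  then show ?thesis by (simp add: LIM_zero_iff)
qed

end

section \<open>From the generators to the whole algebra\<close>

text \<open>
  A closed linear relation between two representations that is compatible with the generators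
  and their adjoints is compatible with all elements of the algebra, since the compatible
  elements form a C*-subalgebra. The diagonal of \<open>X \<times> X\<close> gives invariant subspaces, the graph
  of a unitary gives intertwiners.
\<close>

lemma relation_invariant:
  assumes univ: "universal_ball_algebra q n A z"
    and \<pi>: "representation A X \<pi>" and \<rho>: "representation A Y \<rho>"
    and G: "closed G" "G \<subseteq> X \<times> Y"
    and add: "\<And>x y x' y'. (x, y) \<in> G \<Longrightarrow> (x', y') \<in> G \<Longrightarrow> (x + x', y + y') \<in> G"
    and scale: "\<And>c x y. (x, y) \<in> G \<Longrightarrow> (c *\<^sub>C x, c *\<^sub>C y) \<in> G"
    and gen: "\<And>i x y. i \<in> {1..n} \<Longrightarrow> (x, y) \<in> G \<Longrightarrow> (\<pi> (z i) x, \<rho> (z i) y) \<in> G"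
    and gen_star: "\<And>i x y. i \<in> {1..n} \<Longrightarrow> (x, y) \<in> G \<Longrightarrow>
      (\<pi> (astar A (z i)) x, \<rho> (astar A (z i)) y) \<in> G"
    and "a \<in> carrier A" and "(x, y) \<in> G"
  shows "(\<pi> a x, \<rho> a y) \<in> G"
proof -
  interpret unital_cstar_algebra A
    using univ by (simp add: universal_ball_algebra_def)
  have z: "z i \<in> carrier A" if "i \<in> {1..n}" for i
    using univ that by (auto simp: universal_ball_algebra_def ball_relations_def)
  note R = representationD[OF \<pi>] and R' = representationD[OF \<rho>]
  define S where "S = {a \<in> carrier A. \<forall>x y. (x, y) \<in> G \<longrightarrow> (\<pi> a x, \<rho> a y) \<in> G \<and>
    (\<pi> (astar A a) x, \<rho> (astar A a) y) \<in> G}"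
  have GX: "x \<in> X" "y \<in> Y" if "(x, y) \<in> G" for x y using G(2) that by auto
  have star_one: "astar A \<one>\<^bsub>A\<^esub> = \<one>\<^bsub>A\<^esub>"
    by (metis astar_astar astar_closed astar_mult l_one one_closed r_one)
  have "cstar_subalgebra A S"
    unfolding cstar_subalgebra_def
  proof (intro conjI ballI allI impI)
    show "S \<subseteq> carrier A" by (auto simp: S_def)
    show "\<one>\<^bsub>A\<^esub> \<in> S"
      by (auto simp: S_def star_one R(6) R'(6) GX)
  next
    fix a b assume "a \<in> S" "b \<in> S"
    then show "a \<oplus>\<^bsub>A\<^esub> b \<in> S" "a \<otimes>\<^bsub>A\<^esub> b \<in> S"
      by (auto simp: S_def R(3,4) R'(3,4) GX astar_add astar_mult astar_closed intro!: add)
  next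
    fix c a assume "a \<in> S"
    then show "ascale A c a \<in> S"
      by (auto simp: S_def R(5) R'(5) GX ascale_closed astar_ascale astar_closed intro!: scale)
  next
    fix a assume "a \<in> S"
    then show "astar A a \<in> S"
      by (auto simp: S_def astar_closed astar_astar)
  next
    fix s a
    assume *: "(\<forall>k. s k \<in> S) \<and> a \<in> carrier A \<and> (\<lambda>k::nat. anorm A (s k \<ominus>\<^bsub>A\<^esub> a)) \<longlonglongrightarrow> 0"
    then have s: "s k \<in> carrier A" for k by (auto simp: S_def)
    have a: "a \<in> carrier A" and lim: "(\<lambda>k. anorm A (s k \<ominus>\<^bsub>A\<^esub> a)) \<longlonglongrightarrow> 0" using * by auto
    have lim': "(\<lambda>k. anorm A (astar A (s k) \<ominus>\<^bsub>A\<^esub> astar A a)) \<longlonglongrightarrow> 0"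
    proof -
      have "anorm A (astar A (s k) \<ominus>\<^bsub>A\<^esub> astar A a) = anorm A (s k \<ominus>\<^bsub>A\<^esub> a)" for k
        using s[of k] a by (simp add: astar_minus[symmetric] anorm_astar)
      then show ?thesis using lim by simp
    qed
    have "(\<pi> a x, \<rho> a y) \<in> G \<and> (\<pi> (astar A a) x, \<rho> (astar A a) y) \<in> G" if xy: "(x, y) \<in> G" for x y
    proof
      show "(\<pi> a x, \<rho> a y) \<in> G"
      proof (rule closed_sequentially[OF G(1)])
        show "(\<pi> (s k) x, \<rho> (s k) y) \<in> G" for k using * xy by (auto simp: S_def)
        show "(\<lambda>k. (\<pi> (s k) x, \<rho> (s k) y)) \<longlonglongrightarrow> (\<pi> a x, \<rho> a y)"
          by (intro tendsto_Pair representation_tendsto[OF \<pi> s a lim]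
              representation_tendsto[OF \<rho> s a lim] GX[OF xy])
      qed
      show "(\<pi> (astar A a) x, \<rho> (astar A a) y) \<in> G"
      proof (rule closed_sequentially[OF G(1)])
        show "(\<pi> (astar A (s k)) x, \<rho> (astar A (s k)) y) \<in> G" for k
          using * xy by (auto simp: S_def)
        show "(\<lambda>k. (\<pi> (astar A (s k)) x, \<rho> (astar A (s k)) y))
            \<longlonglongrightarrow> (\<pi> (astar A a) x, \<rho> (astar A a) y)"
          by (intro tendsto_Pair representation_tendsto[OF \<pi> astar_closed[OF s] astar_closed[OF a] lim']
              representation_tendsto[OF \<rho> astar_closed[OF s] astar_closed[OF a] lim'] GX[OF xy])
      qed
    qed
    then show "a \<in> S" using a by (auto simp: S_def)
  qed
  moreover have "\<forall>i\<in>{1..n}. z i \<in> S"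
    using gen gen_star z by (auto simp: S_def)
  ultimately have "S = carrier A"
    using univ unfolding universal_ball_algebra_def by blast
  then show ?thesis using assms(10,11) by (auto simp: S_def)
qed

lemma subspace_invariant:
  assumes univ: "universal_ball_algebra q n A z" and \<pi>: "representation A X \<pi>"
    and M: "closed_csubspace M" "M \<subseteq> X"
    and gen: "\<And>i x. i \<in> {1..n} \<Longrightarrow> x \<in> M \<Longrightarrow> \<pi> (z i) x \<in> M"
    and gen_star: "\<And>i x. i \<in> {1..n} \<Longrightarrow> x \<in> M \<Longrightarrow> \<pi> (astar A (z i)) x \<in> M"
    and "a \<in> carrier A" and "x \<in> M"
  shows "\<pi> a x \<in> M"
proof -
  define G where "G = (M \<times> M) \<inter> {p. fst p = snd p}"
  have "closed G"
    unfolding G_def by (intro closed_Int closed_Times csubspaceD(1)[OF M(1)] closed_Collect_eq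
        continuous_intros)
  then have "(\<pi> a x, \<pi> a x) \<in> G"
    by (rule relation_invariant[OF univ \<pi> \<pi>])
      (use assms csubspaceD[OF M(1)] in \<open>auto simp: G_def\<close>)
  then show ?thesis by (simp add: G_def)
qed

lemma irreducible_invariant:
  assumes univ: "universal_ball_algebra q n A z" and \<pi>: "irreducible_representation A X \<pi>"
    and M: "closed_csubspace M" "M \<subseteq> X"
    and gen: "\<And>i x. i \<in> {1..n} \<Longrightarrow> x \<in> M \<Longrightarrow> \<pi> (z i) x \<in> M"
    and gen_star: "\<And>i x. i \<in> {1..n} \<Longrightarrow> x \<in> M \<Longrightarrow> \<pi> (astar A (z i)) x \<in> M"
    and "x \<in> M" "x \<noteq> 0"
  shows "M = X"
proof -
  have "representation A X \<pi>" using \<pi> by (simp add: irreducible_representation_def)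
  from subspace_invariant[OF univ this M gen gen_star]
  have "\<forall>a\<in>carrier A. \<forall>x\<in>M. \<pi> a x \<in> M" by blast
  then have "M = {0} \<or> M = X"
    using \<pi> M by (simp add: irreducible_representation_def)
  then show ?thesis using assms(7,8) by blast
qed

text \<open>
  Partners of a convergent sequence form a Cauchy sequence, and a limit of the pairs stays in
  the relation.
\<close>

lemma isometric_relation_domain:
  fixes G :: "('h::complex_hilbert \<times> 'k::complex_hilbert) set"
  assumes G: "closed G"
    and diff: "\<And>x y x' y'. (x, y) \<in> G \<Longrightarrow> (x', y') \<in> G \<Longrightarrow> norm (x - x') = norm (y - y')"
  shows "closed (fst ` G)"
proof -
  have "x \<in> fst ` G" if f: "\<And>k. f k \<in> fst ` G" and lim: "f \<longlonglongrightarrow> x" for f :: "nat \<Rightarrow> 'h" and x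
  proof -
    have "\<forall>k. \<exists>y. (f k, y) \<in> G" using f by (metis imageE prod.collapse)
    then obtain g where g: "\<And>k. (f k, g k) \<in> G" by metis
    have "Cauchy g"
      using LIMSEQ_imp_Cauchy[OF lim] unfolding Cauchy_iff diff[OF g g] .
    then obtain y where "g \<longlonglongrightarrow> y" by (auto simp: Cauchy_convergent_iff convergent_def)
    then have "(\<lambda>k. (f k, g k)) \<longlonglongrightarrow> (x, y)" using lim by (intro tendsto_Pair)
    then have "(x, y) \<in> G" using closed_sequentially[OF G, of "\<lambda>k. (f k, g k)"] g by blast
    then show ?thesis by force
  qed
  then show ?thesis by (auto simp: closed_sequential_limits)
qed

text \<open>
  The closure of an isometric relation that is compatible with the generators is the graph of
  an intertwining unitary: its domain and its range are closed and invariant, hence everything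
  by irreducibility, and isometry makes partners unique.
\<close>

lemma unitarily_equivalentI:
  fixes X :: "'h::complex_hilbert set" and Y :: "'k::complex_hilbert set"
  assumes univ: "universal_ball_algebra q n A z"
    and \<pi>: "irreducible_representation A X \<pi>" and \<rho>: "irreducible_representation A Y \<rho>"
    and G: "G \<subseteq> X \<times> Y"
    and add: "\<And>x y x' y'. (x, y) \<in> G \<Longrightarrow> (x', y') \<in> G \<Longrightarrow> (x + x', y + y') \<in> G"
    and scale: "\<And>c x y. (x, y) \<in> G \<Longrightarrow> (c *\<^sub>C x, c *\<^sub>C y) \<in> G"
    and gen: "\<And>i x y. i \<in> {1..n} \<Longrightarrow> (x, y) \<in> G \<Longrightarrow> (\<pi> (z i) x, \<rho> (z i) y) \<in> G"
    and gen_star: "\<And>i x y. i \<in> {1..n} \<Longrightarrow> (x, y) \<in> G \<Longrightarrow>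
      (\<pi> (astar A (z i)) x, \<rho> (astar A (z i)) y) \<in> G"
    and inner: "\<And>x y x' y'. (x, y) \<in> G \<Longrightarrow> (x', y') \<in> G \<Longrightarrow> cinner x x' = cinner y y'"
    and \<Omega>: "(\<Omega>, \<Omega>') \<in> G" "\<Omega> \<noteq> 0"
  shows "unitarily_equivalent A X \<pi> Y \<rho>"
proof -
  have rep: "representation A X \<pi>" "representation A Y \<rho>"
    using \<pi> \<rho> by (auto simp: irreducible_representation_def)
  note R = representationD[OF rep(1)] and R' = representationD[OF rep(2)]
  have zA: "z i \<in> carrier A" "astar A (z i) \<in> carrier A" if "i \<in> {1..n}" for i
    using univ that
    by (auto simp: universal_ball_algebra_def ball_relations_def unital_cstar_algebra.astar_closed)
  note X = csubspaceD[OF R(1)] and Y = csubspaceD[OF R'(1)]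
  define C where "C = closure G"
  have C: "closed C" "C \<subseteq> X \<times> Y" "(\<Omega>, \<Omega>') \<in> C"
    using closure_minimal[OF G closed_Times[OF X(1) Y(1)]] closure_subset[of G] \<Omega>
    by (auto simp: C_def)
  have approx: "\<exists>f g. (\<forall>k. (f k, g k) \<in> G) \<and> f \<longlonglongrightarrow> x \<and> g \<longlonglongrightarrow> y" if "(x, y) \<in> C" for x y
  proof -
    obtain p where p: "\<forall>k. p k \<in> G" "p \<longlonglongrightarrow> (x, y)"
      using \<open>(x, y) \<in> C\<close> unfolding C_def closure_sequential by blast
    then show ?thesis
      using tendsto_fst[OF p(2)] tendsto_snd[OF p(2)]
      by (intro exI[of _ "\<lambda>k. fst (p k)"] exI[of _ "\<lambda>k. snd (p k)"]) auto
  qed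
  have limit: "(x, y) \<in> C" if "\<And>k::nat. (f k, g k) \<in> G" "f \<longlonglongrightarrow> x" "g \<longlonglongrightarrow> y" for f g x y
    unfolding C_def closure_sequential
    using that by (intro exI[of _ "\<lambda>k. (f k, g k)"]) (auto intro: tendsto_Pair)
  have C_op: "(\<pi> a x, \<rho> a y) \<in> C"
    if inv: "\<And>x y. (x, y) \<in> G \<Longrightarrow> (\<pi> a x, \<rho> a y) \<in> G" and a: "a \<in> carrier A" and xy: "(x, y) \<in> C"
    for a x y
  proof -
    obtain f g where fg: "\<And>k::nat. (f k, g k) \<in> G" "f \<longlonglongrightarrow> x" "g \<longlonglongrightarrow> y" using approx[OF xy] by blast
    have "(\<lambda>k. \<pi> a (f k)) \<longlonglongrightarrow> \<pi> a x" "(\<lambda>k. \<rho> a (g k)) \<longlonglongrightarrow> \<rho> a y"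
      by (rule bounded_operator_tendsto[OF R(1) R(2)[OF a]]
          bounded_operator_tendsto[OF R'(1) R'(2)[OF a]]; use fg G C(2) xy in blast)+
    then show ?thesis by (rule limit[OF inv[OF fg(1)]])
  qed
  have C_add: "(x + x', y + y') \<in> C" if xy: "(x, y) \<in> C" and xy': "(x', y') \<in> C" for x y x' y'
  proof -
    obtain f g f' g' where "\<And>k::nat. (f k, g k) \<in> G" "f \<longlonglongrightarrow> x" "g \<longlonglongrightarrow> y"
      "\<And>k::nat. (f' k, g' k) \<in> G" "f' \<longlonglongrightarrow> x'" "g' \<longlonglongrightarrow> y'"
      using approx[OF xy] approx[OF xy'] by blast
    then show ?thesis
      by (intro limit[of "\<lambda>k. f k + f' k" "\<lambda>k. g k + g' k"] add tendsto_add)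
  qed
  have C_scale: "(c *\<^sub>C x, c *\<^sub>C y) \<in> C" if xy: "(x, y) \<in> C" for c x y
  proof -
    obtain f g where "\<And>k::nat. (f k, g k) \<in> G" "f \<longlonglongrightarrow> x" "g \<longlonglongrightarrow> y" using approx[OF xy] by blast
    then show ?thesis
      by (intro limit[of "\<lambda>k. c *\<^sub>C f k" "\<lambda>k. c *\<^sub>C g k"] scale tendsto_scaleC)
  qed
  have C_inner: "cinner x x' = cinner y y'" if xy: "(x, y) \<in> C" and xy': "(x', y') \<in> C" for x y x' y'
  proof -
    obtain f g f' g' where *: "\<And>k::nat. (f k, g k) \<in> G" "f \<longlonglongrightarrow> x" "g \<longlonglongrightarrow> y"
      "\<And>k::nat. (f' k, g' k) \<in> G" "f' \<longlonglongrightarrow> x'" "g' \<longlonglongrightarrow> y'"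
      using approx[OF xy] approx[OF xy'] by blast
    have "(\<lambda>k. cinner (f k) (f' k)) \<longlonglongrightarrow> cinner x x'" "(\<lambda>k. cinner (g k) (g' k)) \<longlonglongrightarrow> cinner y y'"
      by (intro cinner.tendsto *)+
    then show ?thesis
      using inner[OF *(1) *(4)] by (auto intro: LIMSEQ_unique)
  qed
  have C_diff: "(x - x', y - y') \<in> C" if "(x, y) \<in> C" "(x', y') \<in> C" for x y x' y'
    using C_add[OF that(1) C_scale[OF that(2), of "-1"]] by simp
  have C_norm: "norm x = norm y" if "(x, y) \<in> C" for x y
  proof -
    have "complex_of_real ((norm x)\<^sup>2) = complex_of_real ((norm y)\<^sup>2)"
      using C_inner[OF that that] by (simp only: cinner_self)
    then have "(norm x)\<^sup>2 = (norm y)\<^sup>2" by (simp only: of_real_eq_iff)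
    then show ?thesis by simp
  qed
  have C_dist: "norm (x - x') = norm (y - y')" if "(x, y) \<in> C" "(x', y') \<in> C" for x y x' y'
    using C_norm[OF C_diff[OF that]] .
  have C_inv: "(\<pi> a x, \<rho> a y) \<in> C" if "a \<in> carrier A" "(x, y) \<in> C" for a x y
    by (rule relation_invariant[OF univ rep C(1,2) C_add C_scale
          C_op[OF gen zA(1)] C_op[OF gen_star zA(2)] that])
  have dom: "fst ` C = X"
  proof (rule irreducible_invariant[OF univ \<pi>])
    have "closed (fst ` C)"
      by (rule isometric_relation_domain[OF C(1) C_dist])
    then show "closed_csubspace (fst ` C)"
      unfolding closed_csubspace_def
      using imageI[OF C_add, where f = fst] imageI[OF C_scale, where f = fst]
        imageI[OF C_scale[OF C(3), of 0], of fst]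
      by (auto elim!: imageE)
    show "fst ` C \<subseteq> X" using C(2) by auto
    show "\<Omega> \<in> fst ` C" using C(3) by force
    show "\<pi> (z i) x \<in> fst ` C" if "i \<in> {1..n}" "x \<in> fst ` C" for i x
      using imageI[OF C_inv[OF zA(1)[OF that(1)]], where f = fst] that(2) by auto
    show "\<pi> (astar A (z i)) x \<in> fst ` C" if "i \<in> {1..n}" "x \<in> fst ` C" for i x
      using imageI[OF C_inv[OF zA(2)[OF that(1)]], where f = fst] that(2) by auto
  qed (rule \<Omega>(2))
  have ran: "snd ` C = Y"
  proof (rule irreducible_invariant[OF univ \<rho>])
    have "closed (fst ` (prod.swap ` C))"
    proof (rule isometric_relation_domain)
      have "prod.swap ` C = prod.swap -` C" by force
      moreover have "closed (prod.swap -` C)"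
        using C(1) by (intro continuous_closed_vimage) (auto intro!: continuous_intros)
      ultimately show "closed (prod.swap ` C)" by simp
    qed (use C(2) C_dist in auto)
    moreover have "fst ` (prod.swap ` C) = snd ` C" by force
    ultimately have "closed (snd ` C)" by simp
    then show "closed_csubspace (snd ` C)"
      unfolding closed_csubspace_def
      using imageI[OF C_add, where f = snd] imageI[OF C_scale, where f = snd]
        imageI[OF C_scale[OF C(3), of 0], of snd]
      by (auto elim!: imageE)
    show "snd ` C \<subseteq> Y" using C(2) by auto
    show "\<Omega>' \<in> snd ` C" using C(3) by force
    show "\<rho> (z i) x \<in> snd ` C" if "i \<in> {1..n}" "x \<in> snd ` C" for i x
      using imageI[OF C_inv[OF zA(1)[OF that(1)]], where f = snd] that(2) by auto
    show "\<rho> (astar A (z i)) x \<in> snd ` C" if "i \<in> {1..n}" "x \<in> snd ` C" for i x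
      using imageI[OF C_inv[OF zA(2)[OF that(1)]], where f = snd] that(2) by auto
    show "\<Omega>' \<noteq> 0" using C_norm[OF C(3)] \<Omega>(2) by auto
  qed
  have "\<forall>x\<in>X. \<exists>y. (x, y) \<in> C" using dom by (metis imageE prod.collapse)
  then obtain U where U: "\<And>x. x \<in> X \<Longrightarrow> (x, U x) \<in> C" by metis
  have U_eq: "U x = y" if "(x, y) \<in> C" for x y
  proof -
    have "x \<in> X" using C(2) that by auto
    then show ?thesis using C_dist[OF U[OF \<open>x \<in> X\<close>] that] by simp
  qed
  have "bij_betw U X Y"
  proof (rule bij_betw_imageI)
    show "inj_on U X"
    proof (rule inj_onI)
      fix x x' assume "x \<in> X" "x' \<in> X" "U x = U x'"
      then show "x = x'" using C_dist[OF U U, of x x'] by simp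
    qed
    show "U ` X = Y"
    proof
      show "U ` X \<subseteq> Y" using U C(2) by auto
      show "Y \<subseteq> U ` X"
      proof
        fix y assume "y \<in> Y"
        then obtain x where xy: "(x, y) \<in> C" using ran by auto
        then show "y \<in> U ` X" using U_eq[OF xy] C(2) by (intro image_eqI[of _ _ x]) auto
      qed
    qed
  qed
  then show ?thesis
    unfolding unitarily_equivalent_def
    using U_eq[OF C_add[OF U U]] U_eq[OF C_scale[OF U]] C_inner[OF U U] U_eq[OF C_inv[OF _ U]]
    by (intro exI[of _ U]) simp
qed

section \<open>Corners of the algebra of bounded operators\<close>

instance complex_hilbert \<subseteq> banach ..

definition adjoint_pair :: "('h::complex_hilbert \<Rightarrow> 'h) \<Rightarrow> ('h \<Rightarrow> 'h) \<Rightarrow> bool" where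
  "adjoint_pair T S \<longleftrightarrow> bounded_operator_on UNIV T \<and> bounded_operator_on UNIV S \<and>
     (\<forall>x y. cinner (S x) y = cinner x (T y))"

text \<open>
  The bounded operators on the range of a projection \<open>P\<close>, encoded as operators on the whole
  type that \<open>P\<close> fixes from both sides. In this way equality of operators is equality of
  functions, the norm is the operator norm of the whole space, and the unit is \<open>P\<close> itself.
  The definition asks for an adjoint, which is what the involution returns.
\<close>

definition operator_corner :: "('h::complex_hilbert \<Rightarrow> 'h) \<Rightarrow> ('h \<Rightarrow> 'h) cstar" where
  "operator_corner P =
     \<lparr>carrier = {T. (\<exists>S. adjoint_pair T S) \<and> (\<forall>x. P (T x) = T x \<and> T (P x) = T x)},
      mult = (\<lambda>T S x. T (S x)), one = P, zero = (\<lambda>x. 0), add = (\<lambda>T S x. T x + S x),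
      ascale = (\<lambda>c T x. c *\<^sub>C T x), astar = (\<lambda>T. THE S. adjoint_pair T S), anorm = onorm\<rparr>"

lemma corner_simps [simp]:
  "T \<in> carrier (operator_corner P) \<longleftrightarrow>
     (\<exists>S. adjoint_pair T S) \<and> (\<forall>x. P (T x) = T x \<and> T (P x) = T x)"
  "T \<otimes>\<^bsub>operator_corner P\<^esub> S = (\<lambda>x. T (S x))"
  "\<one>\<^bsub>operator_corner P\<^esub> = P"
  "\<zero>\<^bsub>operator_corner P\<^esub> = (\<lambda>x. 0)"
  "T \<oplus>\<^bsub>operator_corner P\<^esub> S = (\<lambda>x. T x + S x)"
  "ascale (operator_corner P) c T = (\<lambda>x. c *\<^sub>C T x)"
  "anorm (operator_corner P) T = onorm T"
  by (simp_all add: operator_corner_def)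

lemma bounded_operator_imp_bounded_linear:
  assumes "bounded_operator_on UNIV T"
  shows "bounded_linear T"
proof -
  obtain K where "\<And>x. norm (T x) \<le> K * norm x"
    using bounded_operator_bound[OF assms] by (metis UNIV_I)
  then show ?thesis
    using bounded_operatorD[OF assms]
    by (intro bounded_linear_intro[where K = K]) (auto simp: scaleR_scaleC mult.commute)
qed

lemma bounded_operator_on_UNIVI:
  assumes "bounded_linear T" and "\<And>c x. T (c *\<^sub>C x) = c *\<^sub>C T x"
  shows "bounded_operator_on UNIV T"
  unfolding bounded_operator_on_def
  using assms(2) onorm[OF assms(1)] linear_add[OF bounded_linear.linear[OF assms(1)]] by auto

lemma adjoint_pairI:
  assumes "bounded_linear T" "bounded_linear S" and adj: "\<And>x y. cinner (S x) y = cinner x (T y)"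
  shows "adjoint_pair T S"
  unfolding adjoint_pair_def
proof (intro conjI allI bounded_operator_on_UNIVI assms)
  show "T (c *\<^sub>C x) = c *\<^sub>C T x" for c x
  proof (rule eqI_cinner[of UNIV])
    fix w
    have "cinner w (T (c *\<^sub>C x)) = cinner w (c *\<^sub>C T x)"
      by (simp add: adj[symmetric] cinner_scaleC_right)
    then show "cinner (T (c *\<^sub>C x)) w = cinner (c *\<^sub>C T x) w"
      by (metis cinner_commute)
  qed simp
  show "S (c *\<^sub>C x) = c *\<^sub>C S x" for c x
    by (rule eqI_cinner[of UNIV]) (simp_all add: adj cinner_scaleC_left)
qed

lemma adjoint_pairD:
  assumes "adjoint_pair T S"
  shows "bounded_linear T" "bounded_linear S" "\<And>x y. cinner (S x) y = cinner x (T y)"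
    "\<And>c x. T (c *\<^sub>C x) = c *\<^sub>C T x" "bounded_operator_on UNIV T"
  using assms bounded_operatorD(3)[of UNIV]
  by (auto simp: adjoint_pair_def bounded_operator_imp_bounded_linear)

lemma adjoint_pair_sym:
  assumes "adjoint_pair T S"
  shows "adjoint_pair S T"
proof (rule adjoint_pairI)
  fix x y
  show "cinner (T x) y = cinner x (S y)"
    using adjoint_pairD(3)[OF assms, of y x] cinner_commute[of "T x" y] cinner_commute[of x "S y"]
    by simp
qed (use adjoint_pairD(1,2)[OF assms] in auto)

lemma adjoint_pair_unique:
  assumes "adjoint_pair T S" and "adjoint_pair T S'"
  shows "S = S'"
proof
  fix x
  show "S x = S' x"
    by (rule eqI_cinner[of UNIV]) (simp_all add: adjoint_pairD(3)[OF assms(1)] adjoint_pairD(3)[OF assms(2)])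
qed

lemma corner_astar: "adjoint_pair T S \<Longrightarrow> astar (operator_corner P) T = S"
  by (auto simp: operator_corner_def intro: adjoint_pair_unique)

lemma adjoint_pair_add:
  assumes "adjoint_pair T S" and "adjoint_pair T' S'"
  shows "adjoint_pair (\<lambda>x. T x + T' x) (\<lambda>x. S x + S' x)"
  by (rule adjoint_pairI)
    (auto intro!: bounded_linear_add adjoint_pairD(1,2)[OF assms(1)] adjoint_pairD(1,2)[OF assms(2)]
      simp: adjoint_pairD(3)[OF assms(1)] adjoint_pairD(3)[OF assms(2)] cinner_add_left cinner_add_right)

lemma adjoint_pair_scale:
  assumes "adjoint_pair T S"
  shows "adjoint_pair (\<lambda>x. c *\<^sub>C T x) (\<lambda>x. cnj c *\<^sub>C S x)"
  by (rule adjoint_pairI)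
    (auto intro!: bounded_linear_compose[OF bounded_linear_scaleC] adjoint_pairD(1,2)[OF assms]
      simp: adjoint_pairD(3)[OF assms] cinner_scaleC_left cinner_scaleC_right)

lemma adjoint_pair_compose:
  assumes "adjoint_pair T S" and "adjoint_pair T' S'"
  shows "adjoint_pair (\<lambda>x. T (T' x)) (\<lambda>x. S' (S x))"
proof (rule adjoint_pairI)
  show "bounded_linear (\<lambda>x. T (T' x))" "bounded_linear (\<lambda>x. S' (S x))"
    using bounded_linear_compose adjoint_pairD(1,2)[OF assms(1)] adjoint_pairD(1,2)[OF assms(2)]
    by blast+
qed (simp add: adjoint_pairD(3)[OF assms(1)] adjoint_pairD(3)[OF assms(2)])

lemma adjoint_pair_zero: "adjoint_pair (\<lambda>x. 0) (\<lambda>x. 0)"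
  by (rule adjoint_pairI) (auto simp: cinner.zero_left cinner.zero_right)

lemma adjoint_pair_onorm_le:
  assumes "adjoint_pair T S"
  shows "onorm S \<le> onorm T"
proof (rule onorm_bound)
  note T = adjoint_pairD[OF assms]
  show "0 \<le> onorm T" by (rule onorm_pos_le[OF T(1)])
  fix x
  have "norm (S x) * norm (S x) = cmod (cinner x (T (S x)))"
    unfolding T(3)[symmetric] cinner_self by (simp add: power2_eq_square norm_mult)
  also have "\<dots> \<le> norm x * (onorm T * norm (S x))"
    using order_trans[OF cinner_le_norm mult_left_mono[OF onorm[OF T(1)]]] by simp
  finally have "norm (S x) * norm (S x) \<le> (onorm T * norm x) * norm (S x)" by (simp add: mult_ac)
  then show "norm (S x) \<le> onorm T * norm x"
    using onorm_pos_le[OF T(1)] by (cases "S x = 0") (auto simp: mult_le_cancel_right)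
qed

lemma adjoint_pair_onorm: "adjoint_pair T S \<Longrightarrow> onorm S = onorm T"
  by (intro antisym adjoint_pair_onorm_le adjoint_pair_sym[of T S])

lemma adjoint_pair_cstar_identity:
  assumes "adjoint_pair T S"
  shows "onorm (\<lambda>x. S (T x)) = (onorm T)\<^sup>2"
proof (rule antisym)
  note T = adjoint_pairD[OF assms]
  have ST: "bounded_linear (\<lambda>x. S (T x))" by (rule bounded_linear_compose[OF T(2,1)])
  show "onorm (\<lambda>x. S (T x)) \<le> (onorm T)\<^sup>2"
    using onorm_compose[OF T(2,1)] adjoint_pair_onorm[OF assms] by (simp add: o_def power2_eq_square)
  have "onorm T \<le> sqrt (onorm (\<lambda>x. S (T x)))"
  proof (rule onorm_bound)
    fix x
    have "(norm (T x))\<^sup>2 = cmod (cinner (S (T x)) x)"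
      unfolding T(3) cinner_self by (simp add: norm_power)
    also have "\<dots> \<le> onorm (\<lambda>x. S (T x)) * norm x * norm x"
      using order_trans[OF cinner_le_norm mult_right_mono[OF onorm[OF ST]]] by simp
    finally show "norm (T x) \<le> sqrt (onorm (\<lambda>x. S (T x))) * norm x"
      using onorm_pos_le[OF ST] real_le_rsqrt[of "norm (T x)" "onorm (\<lambda>x. S (T x)) * norm x * norm x"]
      by (simp add: real_sqrt_mult mult.assoc)
  qed (simp add: onorm_pos_le[OF ST])
  then show "(onorm T)\<^sup>2 \<le> onorm (\<lambda>x. S (T x))"
    using onorm_pos_le[OF ST] onorm_pos_le[OF T(1)] power_mono[of "onorm T" "sqrt (onorm (\<lambda>x. S (T x)))" 2]
    by simp
qed

lemma onorm_scaleC: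
  assumes "bounded_linear T"
  shows "onorm (\<lambda>x. c *\<^sub>C T x) = cmod c * onorm (T :: 'h::complex_hilbert \<Rightarrow> 'h)"
proof -
  have "onorm (\<lambda>x. c *\<^sub>C T x) = onorm (\<lambda>x. cmod c *\<^sub>R T x)"
    by (simp add: onorm_def norm_scaleC)
  then show ?thesis using onorm_scaleR[OF assms, of "cmod c"] by simp
qed

text \<open>
  Completeness: an operator and its adjoint have the same norm, so the adjoints of a norm
  Cauchy sequence form a norm Cauchy sequence as well, and the two limits are adjoint.
\<close>

lemma adjoint_pair_limit:
  assumes pair: "\<And>k. adjoint_pair (s k) (s' k)"
    and Cauchy: "\<forall>e>0. \<exists>N. \<forall>k\<ge>N. \<forall>l\<ge>N. onorm (\<lambda>x. s k x - s l x) < e"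
  obtains T S where "adjoint_pair T S" "(\<lambda>k. onorm (\<lambda>x. s k x - T x)) \<longlonglongrightarrow> 0"
    "\<And>x. (\<lambda>k. s k x) \<longlonglongrightarrow> T x"
proof -
  have lim: "\<exists>T. bounded_linear T \<and> (\<lambda>k. onorm (\<lambda>x. t k x - T x)) \<longlonglongrightarrow> 0 \<and> (\<forall>x. (\<lambda>k. t k x) \<longlonglongrightarrow> T x)"
    if bl: "\<And>k. bounded_linear (t k)"
      and C: "\<forall>e>0. \<exists>N. \<forall>k\<ge>N. \<forall>l\<ge>N. onorm (\<lambda>x. t k x - t l x) < e"
    for t :: "nat \<Rightarrow> 'a \<Rightarrow> 'a"
  proof -
    have app: "blinfun_apply (Blinfun (t k)) = t k" for k
      by (rule bounded_linear_Blinfun_apply[OF bl])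
    have dist: "norm (Blinfun (t k) - F) = onorm (\<lambda>x. t k x - blinfun_apply F x)" for k F
      by (simp add: norm_blinfun.rep_eq minus_blinfun.rep_eq app)
    have "Cauchy (\<lambda>k. Blinfun (t k))"
      using C by (auto simp: Cauchy_iff dist app)
    then obtain L where L: "(\<lambda>k. Blinfun (t k)) \<longlonglongrightarrow> L"
      by (auto simp: Cauchy_convergent_iff convergent_def)
    have "(\<lambda>k. blinfun_apply (Blinfun (t k)) x) \<longlonglongrightarrow> blinfun_apply L x" for x
      by (intro tendsto_intros L)
    then have "(\<lambda>k. t k x) \<longlonglongrightarrow> blinfun_apply L x" for x by (simp add: app)
    moreover have "(\<lambda>k. onorm (\<lambda>x. t k x - blinfun_apply L x)) \<longlonglongrightarrow> 0"
      using tendsto_norm_zero[OF LIM_zero[OF L]] by (simp add: dist)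
    ultimately show ?thesis
      by (intro exI[of _ "blinfun_apply L"]) (auto intro: blinfun.bounded_linear_right)
  qed
  have "onorm (\<lambda>x. s' k x - s' l x) = onorm (\<lambda>x. s k x - s l x)" for k l
    using adjoint_pair_onorm[OF adjoint_pair_add[OF pair[of k] adjoint_pair_scale[OF pair[of l], of "-1"]]]
    by simp
  then have "\<forall>e>0. \<exists>N. \<forall>k\<ge>N. \<forall>l\<ge>N. onorm (\<lambda>x. s' k x - s' l x) < e"
    using Cauchy by simp
  then obtain S where S: "bounded_linear S" "\<And>x. (\<lambda>k. s' k x) \<longlonglongrightarrow> S x"
    using lim[of s'] adjoint_pairD(2)[OF pair] by blast
  obtain T where T: "bounded_linear T" "(\<lambda>k. onorm (\<lambda>x. s k x - T x)) \<longlonglongrightarrow> 0"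
    "\<And>x. (\<lambda>k. s k x) \<longlonglongrightarrow> T x"
    using lim[of s] adjoint_pairD(1)[OF pair] Cauchy by blast
  have "adjoint_pair T S"
  proof (rule adjoint_pairI[OF T(1) S(1)])
    fix x y
    have "(\<lambda>k. cinner (s' k x) y) \<longlonglongrightarrow> cinner (S x) y" "(\<lambda>k. cinner x (s k y)) \<longlonglongrightarrow> cinner x (T y)"
      by (intro cinner.tendsto tendsto_const S T)+
    then show "cinner (S x) y = cinner x (T y)"
      by (auto simp: adjoint_pairD(3)[OF pair] intro: LIMSEQ_unique)
  qed
  then show thesis using T by (intro that)
qed

locale hilbert_projection =
  fixes P :: "'h::complex_hilbert \<Rightarrow> 'h"
  assumes self_adjoint: "adjoint_pair P P" and idem: "P (P x) = P x"
begin

abbreviation "B \<equiv> operator_corner P"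

lemma ring_corner: "ring B"
proof (rule ringI)
  note lin = linear_simps[OF adjoint_pairD(1)]
  show "abelian_group B"
  proof (rule abelian_groupI)
    fix T assume "T \<in> carrier B"
    then obtain S where S: "adjoint_pair T S" and T: "\<And>x. P (T x) = T x \<and> T (P x) = T x" by auto
    show "\<exists>T'\<in>carrier B. T' \<oplus>\<^bsub>B\<^esub> T = \<zero>\<^bsub>B\<^esub>"
      using adjoint_pair_scale[OF S, of "-1"] T lin[OF self_adjoint]
      by (intro bexI[of _ "\<lambda>x. - T x"]) auto
  qed (use adjoint_pair_zero linear_simps[OF adjoint_pairD(1)[OF self_adjoint]]
      in \<open>auto intro: adjoint_pair_add simp: ac_simps\<close>)
  show "Group.monoid B"
    by (rule Group.monoidI) (use self_adjoint idem in \<open>auto intro: adjoint_pair_compose\<close>)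
  fix T S U assume "T \<in> carrier B" "S \<in> carrier B" "U \<in> carrier B"
  then show "(T \<oplus>\<^bsub>B\<^esub> S) \<otimes>\<^bsub>B\<^esub> U = T \<otimes>\<^bsub>B\<^esub> U \<oplus>\<^bsub>B\<^esub> S \<otimes>\<^bsub>B\<^esub> U"
    "U \<otimes>\<^bsub>B\<^esub> (T \<oplus>\<^bsub>B\<^esub> S) = U \<otimes>\<^bsub>B\<^esub> T \<oplus>\<^bsub>B\<^esub> U \<otimes>\<^bsub>B\<^esub> S"
    by auto (auto simp: fun_eq_iff lin(1))
qed

sublocale corner: ring B by (rule ring_corner)

lemma corner_minus:
  assumes "T \<in> carrier B" "S \<in> carrier B"
  shows "T \<ominus>\<^bsub>B\<^esub> S = (\<lambda>x. T x - S x)"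
proof -
  obtain S' where S': "adjoint_pair S S'" using assms(2) by auto
  have "\<ominus>\<^bsub>B\<^esub> S = (\<lambda>x. - S x)"
    using adjoint_pair_scale[OF S', of "-1"] assms linear_simps[OF adjoint_pairD(1)[OF self_adjoint]]
    by (intro corner.minus_equality) auto
  then show ?thesis by (simp add: a_minus_def)
qed

lemma corner_finsum:
  assumes "finite F" and "\<And>j. j \<in> F \<Longrightarrow> T j \<in> carrier B"
  shows "(\<Oplus>\<^bsub>B\<^esub>j\<in>F. T j) = (\<lambda>x. \<Sum>j\<in>F. T j x)"
  using assms
proof (induction F)
  case (insert j F)
  then have "(\<Oplus>\<^bsub>B\<^esub>j\<in>insert j F. T j) = T j \<oplus>\<^bsub>B\<^esub> (\<Oplus>\<^bsub>B\<^esub>j\<in>F. T j)"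
    by (intro corner.finsum_insert) (auto simp: Pi_def)
  then show ?case using insert by auto
qed simp

lemma adjoint_in_corner:
  assumes "T \<in> carrier B" and "adjoint_pair T S"
  shows "S \<in> carrier B"
proof -
  note P = adjoint_pairD(3)[OF self_adjoint] and T = adjoint_pairD(3)[OF assms(2)]
  have "P (S x) = S x" "S (P x) = S x" for x
    by (rule eqI_cinner[of UNIV]; use assms(1) P T in auto)+
  then show ?thesis using adjoint_pair_sym[OF assms(2)] by auto
qed

lemma unital_cstar_algebra_corner: "unital_cstar_algebra B"
proof (intro unital_cstar_algebra.intro ring_corner unital_cstar_algebra_axioms.intro)
  note Plin = linear_simps[OF adjoint_pairD(1)[OF self_adjoint]]
  note Pscale = adjoint_pairD(4)[OF self_adjoint]
  fix T S assume T: "T \<in> carrier B"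
  then obtain T' where T': "adjoint_pair T T'" by auto
  note T'_in = adjoint_in_corner[OF T T'] and T1 = adjoint_pairD[OF T']
  show "ascale B c T \<in> carrier B" for c
    using T T1(4) adjoint_pair_scale[OF T'] Pscale by auto
  show "ascale B (c + d) T = ascale B c T \<oplus>\<^bsub>B\<^esub> ascale B d T" for c d
    by (simp add: scaleC_add_left)
  show "ascale B c (ascale B d T) = ascale B (c * d) T" for c d by (simp add: scaleC_scaleC)
  show "ascale B 1 T = T" by simp
  show "astar B T \<in> carrier B" "astar B (astar B T) = T"
    using T'_in corner_astar[OF T', of P] corner_astar[OF adjoint_pair_sym[OF T'], of P] by auto
  show "astar B (ascale B c T) = ascale B (cnj c) (astar B T)" for c
    by (simp add: corner_astar[OF T'] corner_astar[OF adjoint_pair_scale[OF T']])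
  show "0 \<le> anorm B T" by (simp add: onorm_pos_le T1)
  show "anorm B T = 0 \<longleftrightarrow> T = \<zero>\<^bsub>B\<^esub>" by (simp add: onorm_eq_0 T1 fun_eq_iff)
  show "anorm B (ascale B c T) = cmod c * anorm B T" for c by (simp add: onorm_scaleC T1)
  show "anorm B (astar B T \<otimes>\<^bsub>B\<^esub> T) = (anorm B T)\<^sup>2"
    by (simp add: corner_astar[OF T'] adjoint_pair_cstar_identity[OF T'])
  assume S: "S \<in> carrier B"
  then obtain S' where S': "adjoint_pair S S'" by auto
  note S1 = adjoint_pairD[OF S']
  show "ascale B c (T \<oplus>\<^bsub>B\<^esub> S) = ascale B c T \<oplus>\<^bsub>B\<^esub> ascale B c S" for c
    by (simp add: scaleC_add_right)
  show "ascale B c T \<otimes>\<^bsub>B\<^esub> S = ascale B c (T \<otimes>\<^bsub>B\<^esub> S)" for c by simp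
  show "T \<otimes>\<^bsub>B\<^esub> ascale B c S = ascale B c (T \<otimes>\<^bsub>B\<^esub> S)" for c by (simp add: T1(4))
  show "astar B (T \<oplus>\<^bsub>B\<^esub> S) = astar B T \<oplus>\<^bsub>B\<^esub> astar B S"
    by (simp add: corner_astar[OF T'] corner_astar[OF S'] corner_astar[OF adjoint_pair_add[OF T' S']])
  show "astar B (T \<otimes>\<^bsub>B\<^esub> S) = astar B S \<otimes>\<^bsub>B\<^esub> astar B T"
    by (simp add: corner_astar[OF T'] corner_astar[OF S'] corner_astar[OF adjoint_pair_compose[OF T' S']])
  show "anorm B (T \<oplus>\<^bsub>B\<^esub> S) \<le> anorm B T + anorm B S"
    using onorm_triangle[OF T1(1) S1(1)] by simp
  show "anorm B (T \<otimes>\<^bsub>B\<^esub> S) \<le> anorm B T * anorm B S"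
    using onorm_compose[OF T1(1) S1(1)] by (simp add: o_def)
next
  fix s :: "nat \<Rightarrow> 'h \<Rightarrow> 'h"
  assume s: "\<forall>k. s k \<in> carrier B"
    and Cauchy: "\<forall>e>0. \<exists>N. \<forall>k\<ge>N. \<forall>l\<ge>N. anorm B (s k \<ominus>\<^bsub>B\<^esub> s l) < e"
  have "\<forall>k. \<exists>S. adjoint_pair (s k) S" using s by auto
  then obtain s' where s': "\<And>k. adjoint_pair (s k) (s' k)" by metis
  have minus: "s k \<ominus>\<^bsub>B\<^esub> s l = (\<lambda>x. s k x - s l x)" for k l
    using corner_minus s by blast
  have "\<forall>e>0. \<exists>N. \<forall>k\<ge>N. \<forall>l\<ge>N. onorm (\<lambda>x. s k x - s l x) < e"
    using Cauchy by (simp only: minus corner_simps)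
  from adjoint_pair_limit[OF s' this]
  obtain T S where T: "adjoint_pair T S" "(\<lambda>k. onorm (\<lambda>x. s k x - T x)) \<longlonglongrightarrow> 0"
    "\<And>x. (\<lambda>k. s k x) \<longlonglongrightarrow> T x" by blast
  have "P (T x) = T x \<and> T (P x) = T x" for x
  proof
    have "(\<lambda>k. P (s k x)) \<longlonglongrightarrow> P (T x)"
      by (rule bounded_linear.tendsto[OF adjoint_pairD(1)[OF self_adjoint] T(3)])
    moreover have "(\<lambda>k. P (s k x)) = (\<lambda>k. s k x)" using s by auto
    ultimately show "P (T x) = T x" using T(3)[of x] by (auto intro: LIMSEQ_unique)
    have "(\<lambda>k. s k (P x)) = (\<lambda>k. s k x)" using s by auto
    then show "T (P x) = T x" using T(3)[of x] T(3)[of "P x"] by (auto intro: LIMSEQ_unique)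
  qed
  then have T_in: "T \<in> carrier B" using T(1) by auto
  then have "s k \<ominus>\<^bsub>B\<^esub> T = (\<lambda>x. s k x - T x)" for k
    using corner_minus s by blast
  then show "\<exists>T\<in>carrier B. (\<lambda>k. anorm B (s k \<ominus>\<^bsub>B\<^esub> T)) \<longlonglongrightarrow> 0"
    using T_in T(2) by (intro bexI[of _ T]) (simp_all only: corner_simps(7))
qed

lemma representation_corner:
  assumes \<phi>: "star_hom A B \<phi>"
  shows "representation A {x. P x = x} \<phi>"
proof -
  note P = adjoint_pairD[OF self_adjoint]
  have closed: "closed {x. P x = x}"
    using linear_continuous_on[OF P(1), of UNIV]
    by (intro closed_Collect_eq) (auto intro: continuous_intros)
  have in_B: "\<phi> a \<in> carrier B" if "a \<in> carrier A" for a using \<phi> that by (simp add: star_hom_def)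
  have adj: "adjoint_pair (\<phi> a) (\<phi> (astar A a))" if "a \<in> carrier A" for a
  proof -
    have "\<phi> (astar A a) = astar B (\<phi> a)" using \<phi> that by (simp add: star_hom_def)
    then show ?thesis using in_B[OF that] by (auto simp: corner_astar)
  qed
  have bop: "bounded_operator_on {x. P x = x} (\<phi> a)" if "a \<in> carrier A" for a
    using adjoint_pairD(5)[OF adj[OF that]] in_B[OF that]
    unfolding bounded_operator_on_def by auto
  show ?thesis
    unfolding representation_def closed_csubspace_def
    using closed linear_simps[OF P(1)] P(4) bop \<phi> adjoint_pairD(3)[OF adj]
    by (auto simp: star_hom_def)
qed

end

section \<open>Weighted composition operators on square-summable functions\<close>

lemma ell2_eqI: "(\<And>k. ell2_apply f k = ell2_apply g k) \<Longrightarrow> f = g"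
  by (metis ell2_apply_inject ext)

lemma ell2_apply_simps [simp]:
  "ell2_apply 0 k = 0" "ell2_apply (f + g) k = ell2_apply f k + ell2_apply g k"
  "ell2_apply (f - g) k = ell2_apply f k - ell2_apply g k"
  "ell2_apply (- f) k = - ell2_apply f k"
  "ell2_apply (c *\<^sub>C f) k = c * ell2_apply f k"
  "ell2_apply (r *\<^sub>R f) k = complex_of_real r * ell2_apply f k"
  "ell2_apply (ket l) k = (if k = l then 1 else 0)"
  by (simp_all add: zero_ell2.rep_eq plus_ell2.rep_eq ell2_apply_diff uminus_ell2.rep_eq
      scaleC_ell2_def ell2_scale.rep_eq scaleR_ell2.rep_eq ket.rep_eq)

lemma ell2_apply_sum [simp]: "ell2_apply (sum f F) k = (\<Sum>i\<in>F. ell2_apply (f i) k)"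
  by (induction F rule: infinite_finite_induct) simp_all

lemma cinner_ell2: "cinner f g = (\<Sum>\<^sub>\<infinity>k. ell2_apply f k * cnj (ell2_apply g k))"
  by (simp add: cinner_ell2_def ell2_inner.rep_eq)

text \<open>
  The value is the intended one only if the weighted function is square-summable; the
  condition \<open>dual_weights\<close> below guarantees this.
\<close>

definition weighted_comp :: "('k \<Rightarrow> complex) \<Rightarrow> ('k \<Rightarrow> 'k) \<Rightarrow> 'k ell2 \<Rightarrow> 'k ell2" where
  "weighted_comp c g f = Abs_ell2 (\<lambda>k. c k * ell2_apply f (g k))"

text \<open>
  \<open>g\<close> and \<open>g'\<close> are mutually inverse bijections between the supports of the weights \<open>c\<close> and
  \<open>c'\<close>, and the weights correspond to each other up to conjugation: the two weighted
  composition operators are adjoint contractions.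
\<close>

definition dual_weights ::
  "('k \<Rightarrow> complex) \<Rightarrow> ('k \<Rightarrow> 'k) \<Rightarrow> ('k \<Rightarrow> complex) \<Rightarrow> ('k \<Rightarrow> 'k) \<Rightarrow> bool" where
  "dual_weights c g c' g' \<longleftrightarrow>
     (\<forall>k. cmod (c k) \<le> 1 \<and> cmod (c' k) \<le> 1) \<and>
     (\<forall>k. c k \<noteq> 0 \<longrightarrow> g' (g k) = k \<and> c' (g k) = cnj (c k)) \<and>
     (\<forall>k. c' k \<noteq> 0 \<longrightarrow> g (g' k) = k \<and> c (g' k) = cnj (c' k))"

lemma weighted_sum_le:
  assumes "dual_weights c g c' g'" and "finite F"
  shows "(\<Sum>k\<in>F. (cmod (c k * ell2_apply f (g k)))\<^sup>2) \<le> (norm f)\<^sup>2"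
proof -
  define F' where "F' = {k\<in>F. c k \<noteq> 0}"
  have inj: "inj_on g F'"
    by (rule inj_on_inverseI[where g = g']) (use assms(1) in \<open>auto simp: F'_def dual_weights_def\<close>)
  have "(\<Sum>k\<in>F. (cmod (c k * ell2_apply f (g k)))\<^sup>2) = (\<Sum>k\<in>F'. (cmod (c k * ell2_apply f (g k)))\<^sup>2)"
    using assms(2) by (intro sum.mono_neutral_right) (auto simp: F'_def)
  also have "\<dots> \<le> (\<Sum>k\<in>F'. (cmod (ell2_apply f (g k)))\<^sup>2)"
    using assms(1) by (intro sum_mono power_mono) (auto simp: norm_mult dual_weights_def intro: mult_left_le_one_le)
  also have "\<dots> = (\<Sum>k\<in>g ` F'. (cmod (ell2_apply f k))\<^sup>2)"
    by (simp add: sum.reindex[OF inj])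
  also have "\<dots> \<le> (norm f)\<^sup>2"
    using assms(2) by (intro ell2_norm_finite_le) (auto simp: F'_def)
  finally show ?thesis .
qed

lemma weighted_comp_apply:
  assumes "dual_weights c g c' g'"
  shows "ell2_apply (weighted_comp c g f) k = c k * ell2_apply f (g k)"
proof -
  have "(\<lambda>k. (cmod (c k * ell2_apply f (g k)))\<^sup>2) summable_on UNIV"
    by (rule nonneg_bdd_above_summable_on)
      (use weighted_sum_le[OF assms] in \<open>auto intro!: bdd_aboveI2[of _ _ "(norm f)\<^sup>2"]\<close>)
  then show ?thesis by (simp add: weighted_comp_def Abs_ell2_inverse)
qed

lemma dual_weights_sym: "dual_weights c g c' g' \<Longrightarrow> dual_weights c' g' c g"
  by (auto simp: dual_weights_def)

lemma weighted_comp_bounded_linear: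
  assumes "dual_weights c g c' g'"
  shows "bounded_linear (weighted_comp c g)"
proof (rule bounded_linear_intro[where K = 1])
  note [simp] = weighted_comp_apply[OF assms]
  fix x y :: "'a ell2" and r :: real
  show "weighted_comp c g (x + y) = weighted_comp c g x + weighted_comp c g y"
    by (rule ell2_eqI) (simp add: distrib_left)
  show "weighted_comp c g (r *\<^sub>R x) = r *\<^sub>R weighted_comp c g x"
    by (rule ell2_eqI) (simp add: mult_ac)
  have "norm (weighted_comp c g x) \<le> norm x"
    by (rule ell2_norm_leI) (use weighted_sum_le[OF assms] in auto)
  then show "norm (weighted_comp c g x) \<le> norm x * 1" by simp
qed

lemma weighted_comp_adjoint:
  assumes "dual_weights c g c' g'"
  shows "adjoint_pair (weighted_comp c g) (weighted_comp c' g')"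
proof (rule adjoint_pairI)
  note sym = dual_weights_sym[OF assms]
  show "bounded_linear (weighted_comp c g)" "bounded_linear (weighted_comp c' g')"
    by (rule weighted_comp_bounded_linear[OF assms] weighted_comp_bounded_linear[OF sym])+
  fix x y :: "'a ell2"
  have bij: "bij_betw g {k. c k \<noteq> 0} {k. c' k \<noteq> 0}"
    by (rule bij_betw_byWitness[where f' = g']) (use assms in \<open>auto simp: dual_weights_def\<close>)
  have "cinner (weighted_comp c' g' x) y
      = (\<Sum>\<^sub>\<infinity>l\<in>{l. c' l \<noteq> 0}. c' l * ell2_apply x (g' l) * cnj (ell2_apply y l))"
    unfolding cinner_ell2 weighted_comp_apply[OF sym] by (rule infsum_cong_neutral) auto
  also have "\<dots> = (\<Sum>\<^sub>\<infinity>k\<in>{k. c k \<noteq> 0}. c' (g k) * ell2_apply x (g' (g k)) * cnj (ell2_apply y (g k)))"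
    by (rule infsum_reindex_bij_betw[OF bij, symmetric])
  also have "\<dots> = (\<Sum>\<^sub>\<infinity>k\<in>{k. c k \<noteq> 0}. ell2_apply x k * cnj (c k * ell2_apply y (g k)))"
    using assms by (intro infsum_cong) (auto simp: dual_weights_def)
  also have "\<dots> = cinner x (weighted_comp c g y)"
    unfolding cinner_ell2 weighted_comp_apply[OF assms] by (rule infsum_cong_neutral) auto
  finally show "cinner (weighted_comp c' g' x) y = cinner x (weighted_comp c g y)" .
qed

text \<open>Truncating a square-summable function to a large finite set changes it arbitrarily little.\<close>

lemma ell2_in_closed_span:
  assumes M: "closed_csubspace M" and ket: "\<And>k. ell2_apply f k \<noteq> 0 \<Longrightarrow> ket k \<in> M"
  shows "f \<in> M"
proof -
  have "\<exists>g\<in>M. dist g f < e" if e: "0 < e" for e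
  proof -
    have "((\<lambda>k. (cmod (ell2_apply f k))\<^sup>2) has_sum (norm f)\<^sup>2) UNIV"
      using has_sum_infsum[OF ell2_summable[of f]]
      by (simp add: power2_norm_eq_inner inner_ell2_def ell2_inner_self)
    then have "\<forall>\<^sub>F F in finite_subsets_at_top UNIV.
        (norm f)\<^sup>2 - (e / 2)\<^sup>2 < (\<Sum>k\<in>F. (cmod (ell2_apply f k))\<^sup>2)"
      unfolding has_sum_def using e by (intro order_tendstoD(1)) auto
    then obtain F where F: "finite F" "(norm f)\<^sup>2 - (e / 2)\<^sup>2 < (\<Sum>k\<in>F. (cmod (ell2_apply f k))\<^sup>2)"
      by (auto simp: eventually_finite_subsets_at_top)
    define g where "g = (\<Sum>k\<in>F. ell2_apply f k *\<^sub>C ket k)"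
    have g: "ell2_apply g k = (if k \<in> F then ell2_apply f k else 0)" for k
      using F(1) by (simp add: g_def if_distrib[of "\<lambda>x. _ * x"] sum.delta' cong: if_cong)
    have "norm (f - g) \<le> e / 2"
    proof (rule ell2_norm_leI)
      fix F' :: "'a set" assume F': "finite F'"
      have "(\<Sum>k\<in>F'. (cmod (ell2_apply (f - g) k))\<^sup>2) = (\<Sum>k\<in>F' - F. (cmod (ell2_apply f k))\<^sup>2)"
        by (rule sum.mono_neutral_cong_right) (auto simp: F' g)
      moreover have "(\<Sum>k\<in>F' - F. (cmod (ell2_apply f k))\<^sup>2) + (\<Sum>k\<in>F. (cmod (ell2_apply f k))\<^sup>2)
          \<le> (norm f)\<^sup>2"
        using ell2_norm_finite_le[of "(F' - F) \<union> F" f] F(1) F'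
        by (subst sum.union_disjoint[symmetric]) auto
      ultimately show "(\<Sum>k\<in>F'. (cmod (ell2_apply (f - g) k))\<^sup>2) \<le> (e / 2)\<^sup>2"
        using F(2) by simp
    qed (use e in simp)
    moreover have "g \<in> M"
      unfolding g_def
    proof (rule csubspace_sum[OF M])
      fix k
      show "ell2_apply f k *\<^sub>C ket k \<in> M"
        using csubspaceD(4)[OF M ket, of k] csubspaceD(2)[OF M] by (cases "ell2_apply f k = 0") auto
    qed
    ultimately show ?thesis
      using e by (intro bexI[of _ g]) (auto simp: dist_norm norm_minus_commute)
  qed
  then have "f \<in> closure M" by (simp add: closure_approachable)
  then show ?thesis using csubspaceD(1)[OF M] by simp
qed

section \<open>The model representations\<close>

lemma sum_list_drop_update:
  fixes k :: "nat list"
  assumes "r \<le> s" "s < length k"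
  shows "sum_list (drop r (k[s := x])) + k ! s = sum_list (drop r k) + x"
proof -
  have "sum_list (drop r (k[s := x])) = sum_list ((drop r k)[s - r := x])"
    using assms by (simp add: drop_update_swap)
  also have "\<dots> + drop r k ! (s - r) = sum_list (drop r k) + x"
  proof -
    have "s - r < length (drop r k)" using assms by simp
    from elem_le_sum_list[OF this] this show ?thesis
      by (simp add: sum_list_update)
  qed
  finally show ?thesis using assms by simp
qed

lemma sum_list_drop_nth:
  fixes k :: "nat list"
  assumes "r < length k"
  shows "sum_list (drop r k) = k ! r + sum_list (drop (Suc r) k)"
  using assms by (simp add: Cons_nth_drop_Suc[symmetric])

definition up :: "nat \<Rightarrow> nat list \<Rightarrow> nat list" where
  "up r k = k[r := Suc (k ! r)]"

definition dn :: "nat \<Rightarrow> nat list \<Rightarrow> nat list" where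
  "dn r k = k[r := k ! r - 1]"

lemma length_up_dn [simp]: "length (up r k) = length k" "length (dn r k) = length k"
  by (simp_all add: up_def dn_def)

lemma up_dn: "r < length k \<Longrightarrow> 0 < k ! r \<Longrightarrow> up r (dn r k) = k"
  and dn_up: "r < length k \<Longrightarrow> dn r (up r k) = k"
  by (simp_all add: up_def dn_def)

lemma nth_up: "r < length k \<Longrightarrow> up r k ! s = (if s = r then Suc (k ! r) else k ! s)"
  and nth_dn: "r < length k \<Longrightarrow> dn r k ! s = (if s = r then k ! r - 1 else k ! s)"
  by (auto simp: up_def dn_def nth_list_update)

lemma dn_commute: "r \<noteq> s \<Longrightarrow> dn r (dn s k) = dn s (dn r k)"
  and up_dn_commute: "r \<noteq> s \<Longrightarrow> up r (dn s k) = dn s (up r k)"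
  by (simp_all add: up_def dn_def list_update_swap)

lemma drop_up_dn: "r < s \<Longrightarrow> drop s (up r k) = drop s k" "r < s \<Longrightarrow> drop s (dn r k) = drop s k"
  by (simp_all add: up_def dn_def)

lemma sum_drop_up: "r \<le> s \<Longrightarrow> s < length k \<Longrightarrow> sum_list (drop r (up s k)) = Suc (sum_list (drop r k))"
  using sum_list_drop_update[of r s k "Suc (k ! s)"] by (simp add: up_def)

lemma sum_drop_dn:
  "r \<le> s \<Longrightarrow> s < length k \<Longrightarrow> 0 < k ! s \<Longrightarrow> sum_list (drop r k) = Suc (sum_list (drop r (dn s k)))"
  using sum_drop_up[of r s "dn s k"] by (simp add: up_dn)

lemma hilbert_H_ket: "ket k \<in> \<H> m \<longleftrightarrow> length k = m"
  by (auto simp: hilbert_H_def)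

text \<open>
  All listed representations are members of one family: \<open>N = 0\<close> gives \<open>\<sigma>\<close>, and \<open>N = n - j + 1\<close>
  gives \<open>\<rho>\<^sub>j\<close>. The generator \<open>z\<^sub>i\<close> acts as zero for \<open>i < N\<close>, diagonally for \<open>i = N\<close>, and as
  a weighted shift in the list position \<open>i - N - 1\<close> for \<open>i > N\<close>.
\<close>

locale ball_model =
  fixes q :: real and n N :: nat and \<theta> :: complex
  assumes q: "0 < q" "q < 1" and N: "N \<le> n" and \<theta>: "cmod \<theta> = 1"
begin

abbreviation "m \<equiv> n - N"

definition wt :: "nat \<Rightarrow> nat list \<Rightarrow> real" where
  "wt r k = sqrt (1 - q ^ Suc (k ! r)) * sqrt q ^ sum_list (drop (Suc r) k)"

text \<open>
  In coordinates, \<open>z\<^sub>i f\<close> is the function that takes \<open>k\<close> to \<open>coef i k\<close> times the value of \<open>f\<close> at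
  \<open>src i k\<close>: as the shift raises a position of the basis vectors, it looks up the coordinate
  with that position lowered. The adjoint looks up the coordinate with the position raised.
\<close>

definition coef :: "nat \<Rightarrow> nat list \<Rightarrow> complex" where
  "coef i k =
     (if length k \<noteq> m \<or> i < N \<or> n < i then 0
      else if i = N then \<theta> * complex_of_real (sqrt q ^ sum_list k)
      else if k ! (i - Suc N) = 0 then 0
      else complex_of_real (wt (i - Suc N) (dn (i - Suc N) k)))"

definition src :: "nat \<Rightarrow> nat list \<Rightarrow> nat list" where
  "src i k = (if i \<le> N then k else dn (i - Suc N) k)"

definition coef_star :: "nat \<Rightarrow> nat list \<Rightarrow> complex" where
  "coef_star i k =
     (if length k \<noteq> m \<or> i < N \<or> n < i then 0
      else if i = N then cnj \<theta> * complex_of_real (sqrt q ^ sum_list k)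
      else complex_of_real (wt (i - Suc N) k))"

definition src_star :: "nat \<Rightarrow> nat list \<Rightarrow> nat list" where
  "src_star i k = (if i \<le> N then k else up (i - Suc N) k)"

definition Z :: "nat \<Rightarrow> nat list ell2 \<Rightarrow> nat list ell2" where
  "Z i = weighted_comp (coef i) (src i)"

definition Zs :: "nat \<Rightarrow> nat list ell2 \<Rightarrow> nat list ell2" where
  "Zs i = weighted_comp (coef_star i) (src_star i)"

definition Proj :: "nat list ell2 \<Rightarrow> nat list ell2" where
  "Proj = weighted_comp (\<lambda>k. of_bool (length k = m)) id"

lemma sqrt_q: "0 < sqrt q" "sqrt q < 1" "sqrt q * sqrt q = q"
  using q by auto

lemma one_minus_power: "0 < 1 - q ^ Suc a"
  using q power_Suc_less_one[of q a] by simp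

lemma wt_pos: "0 < wt r k"
  using one_minus_power[of "k ! r"] sqrt_q(1) by (simp add: wt_def)

lemma wt_le_one: "wt r k \<le> 1"
proof -
  have "sqrt (1 - q ^ Suc (k ! r)) \<le> 1" using q by simp
  moreover have "sqrt q ^ sum_list (drop (Suc r) k) \<le> 1"
    using sqrt_q by (intro power_le_one) auto
  ultimately show ?thesis
    unfolding wt_def using one_minus_power[of "k ! r"] sqrt_q(1) by (intro mult_le_one) auto
qed

lemma wt_square: "wt r k * wt r k = (1 - q ^ Suc (k ! r)) * q ^ sum_list (drop (Suc r) k)"
proof -
  have "wt r k * wt r k = (sqrt (1 - q ^ Suc (k ! r)) * sqrt (1 - q ^ Suc (k ! r)))
      * (sqrt q * sqrt q) ^ sum_list (drop (Suc r) k)"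
    by (simp only: wt_def power_mult_distrib mult_ac)
  then show ?thesis
    unfolding sqrt_q(3) using one_minus_power[of "k ! r"] by (simp del: power_Suc)
qed

lemma dual: "dual_weights (coef i) (src i) (coef_star i) (src_star i)"
proof -
  have p: "cmod (\<theta> * complex_of_real (sqrt q ^ s)) \<le> 1" "cmod (cnj \<theta> * complex_of_real (sqrt q ^ s)) \<le> 1" for s
    using sqrt_q \<theta> by (simp_all add: norm_mult norm_power power_le_one)
  have w: "cmod (complex_of_real (wt r k)) \<le> 1" for r k
    using wt_pos[of r k] wt_le_one[of r k] by simp
  consider "i < N \<or> n < i" | "i = N" | "N < i" "i \<le> n" by linarith
  then show ?thesis
  proof cases
    case 1
    then show ?thesis by (auto simp: dual_weights_def coef_def coef_star_def)
  next
    case 2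
    then show ?thesis
      using p by (auto simp: dual_weights_def coef_def coef_star_def src_def src_star_def)
  next
    case 3
    then have "i - Suc N < m" by linarith
    then show ?thesis
      using 3 w wt_pos
      by (auto simp: dual_weights_def coef_def coef_star_def src_def src_star_def up_dn dn_up nth_up)
  qed
qed

lemmas Z_apply = weighted_comp_apply[OF dual, folded Z_def]
lemmas Zs_apply = weighted_comp_apply[OF dual_weights_sym[OF dual], folded Zs_def]

lemma Z_adjoint: "adjoint_pair (Z i) (Zs i)"
  unfolding Z_def Zs_def by (rule weighted_comp_adjoint[OF dual])

lemma Proj_dual: "dual_weights (\<lambda>k::nat list. of_bool (length k = m)) id (\<lambda>k. of_bool (length k = m)) id"
  by (simp add: dual_weights_def)

lemmas Proj_apply = weighted_comp_apply[OF Proj_dual, folded Proj_def]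

sublocale hilbert_projection Proj
proof
  show "adjoint_pair Proj Proj"
    unfolding Proj_def by (rule weighted_comp_adjoint[OF Proj_dual])
  show "Proj (Proj x) = Proj x" for x by (rule ell2_eqI) (simp add: Proj_apply)
qed

lemma Proj_fixed: "{x. Proj x = x} = \<H> m"
proof -
  have "Proj x = x \<longleftrightarrow> (\<forall>k. length k \<noteq> m \<longrightarrow> ell2_apply x k = 0)" for x
  proof
    assume "Proj x = x"
    then have "ell2_apply x k = of_bool (length k = m) * ell2_apply x k" for k
      by (metis Proj_apply id_apply)
    then show "\<forall>k. length k \<noteq> m \<longrightarrow> ell2_apply x k = 0" by (metis mult_zero_left of_bool_eq(1))
  next
    assume "\<forall>k. length k \<noteq> m \<longrightarrow> ell2_apply x k = 0"
    then show "Proj x = x" by (intro ell2_eqI) (auto simp: Proj_apply)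
  qed
  then show ?thesis by (simp add: hilbert_H_def)
qed

lemma Z_in_corner: "Z i \<in> carrier B"
proof -
  have len: "length (src i k) = length k" for k by (simp add: src_def)
  have "Proj (Z i x) = Z i x" "Z i (Proj x) = Z i x" for x
    by (rule ell2_eqI; simp add: Proj_apply Z_apply len; simp add: coef_def)+
  then show ?thesis using Z_adjoint by auto
qed

lemma Zs_in_corner: "Zs i \<in> carrier B"
  by (rule adjoint_in_corner[OF Z_in_corner Z_adjoint])

text \<open>The eigenvalues of \<open>1 - \<Sum>\<^sub>j\<^sub>>\<^sub>i z\<^sub>j z\<^sub>j\<^sup>*\<close>.\<close>

definition defect :: "nat \<Rightarrow> nat list \<Rightarrow> real" where
  "defect i k = (if i < N then 0 else q ^ sum_list (drop (i - N) k))"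

text \<open>
  In each of the three ranges of \<open>i\<close>, the operator \<open>z\<^sub>i z\<^sub>i\<^sup>*\<close> is a difference of consecutive
  defects, so that the sum in the relations telescopes. For \<open>i > N\<close> the reason is that the
  defect at \<open>i - 1\<close> is \<open>q\<close> to the power \<open>k\<^bsub>i-N\<^esub>\<close> times the defect at \<open>i\<close>.
\<close>

lemma Z_Zs_apply:
  assumes "length k = m" "0 < i" "i \<le> n"
  shows "ell2_apply (Z i (Zs i f)) k = complex_of_real (defect i k - defect (i - 1) k) * ell2_apply f k"
proof -
  consider "i < N" | "i = N" | "N < i" "i \<le> n" using assms by linarith
  then show ?thesis
  proof cases
    case 1
    then show ?thesis by (simp add: Z_apply coef_def defect_def)
  next
    case 2
    have "\<theta> * cnj \<theta> = 1" using \<theta> by (simp add: complex_norm_square[symmetric])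
    moreover have "complex_of_real (sqrt q) ^ s * complex_of_real (sqrt q) ^ s = complex_of_real q ^ s" for s
      using sqrt_q(3) by (metis of_real_mult power_mult_distrib)
    ultimately show ?thesis
      using 2 assms
      by (simp add: Z_apply Zs_apply coef_def coef_star_def src_def src_star_def defect_def mult_ac)
  next
    case 3
    define r where "r = i - Suc N"
    have r: "r < length k" "i - N = Suc r" "i - Suc 0 - N = r" using 3 assms by (auto simp: r_def)
    have D: "defect i k - defect (i - 1) k = (1 - q ^ (k ! r)) * q ^ sum_list (drop (Suc r) k)"
      using 3 sum_list_drop_nth[OF r(1)] r by (auto simp: defect_def power_add algebra_simps)
    show ?thesis
    proof (cases "k ! r = 0")
      case True
      then show ?thesis using 3 r assms D by (simp add: Z_apply coef_def)
    next
      case False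
      have "wt r (dn r k) * wt r (dn r k) = defect i k - defect (i - 1) k"
        using r False unfolding D wt_square by (simp add: nth_dn drop_up_dn del: power_Suc)
      then have "complex_of_real (wt r (dn r k)) * complex_of_real (wt r (dn r k))
          = complex_of_real (defect i k - defect (i - 1) k)"
        by (metis of_real_mult)
      then show ?thesis
        using 3 r False assms
        by (simp add: Z_apply Zs_apply coef_def coef_star_def src_def src_star_def up_dn
            mult.assoc[symmetric])
    qed
  qed
qed

lemma Zs_Z_apply:
  assumes "length k = m" "0 < i" "i \<le> n"
  shows "ell2_apply (Zs i (Z i f)) k = complex_of_real (defect i k - q * defect (i - 1) k) * ell2_apply f k"
proof -
  consider "i < N" | "i = N" | "N < i" "i \<le> n" using assms by linarith
  then show ?thesis
  proof cases
    case 1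
    then show ?thesis by (simp add: Zs_apply coef_star_def defect_def)
  next
    case 2
    then show ?thesis
      using Z_Zs_apply[OF assms, of f] assms
      by (simp add: Z_apply Zs_apply coef_def coef_star_def src_def src_star_def defect_def mult_ac)
  next
    case 3
    define r where "r = i - Suc N"
    have r: "r < length k" "i - N = Suc r" "i - Suc 0 - N = r" using 3 assms by (auto simp: r_def)
    have D: "defect i k - q * defect (i - 1) k = wt r k * wt r k"
      unfolding wt_square
      using 3 sum_list_drop_nth[OF r(1)] r by (auto simp: defect_def power_add algebra_simps)
    show ?thesis
      using 3 r assms unfolding D
      by (simp add: Z_apply Zs_apply coef_def coef_star_def src_def src_star_def dn_up nth_up)
  qed
qed

lemma sum_Z_Zs_apply:
  assumes "length k = m" "i \<le> n"
  shows "(\<Sum>j\<in>{i+1..n}. ell2_apply (Z j (Zs j f)) k) = complex_of_real (1 - defect i k) * ell2_apply f k"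
proof -
  have "(\<Sum>j\<in>{i+1..n}. ell2_apply (Z j (Zs j f)) k)
      = (\<Sum>j\<in>{Suc i..n}. complex_of_real (defect j k) - complex_of_real (defect (j - 1) k)) * ell2_apply f k"
    using assms by (simp add: Z_Zs_apply sum_distrib_right)
  also have "(\<Sum>j\<in>{Suc i..n}. complex_of_real (defect j k) - complex_of_real (defect (j - 1) k))
      = complex_of_real (defect n k) - complex_of_real (defect i k)"
    using assms(2) by (rule sum_telescope'')
  also have "defect n k = 1" using assms N by (simp add: defect_def)
  finally show ?thesis by simp
qed

text \<open>
  The weight of a position depends on the sum of the later ones: moving a later position by
  one changes it by the factor \<open>\<surd>q\<close> of the commutation relations, while moving an earlier
  position leaves it unchanged.
\<close>

lemma wt_dn_above:
  assumes "r < s" "s < length k" "0 < k ! s"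
  shows "wt r k = sqrt q * wt r (dn s k)"
  using assms sum_drop_dn[of "Suc r" s k] by (simp add: wt_def nth_dn)

lemma wt_up_above:
  assumes "r < s" "s < length k"
  shows "wt r (up s k) = sqrt q * wt r k"
  using assms sum_drop_up[of "Suc r" s k] by (simp add: wt_def nth_up)

lemma wt_below:
  assumes "r < s" "s < length k"
  shows "wt s (dn r k) = wt s k" "wt s (up r k) = wt s k"
  using assms by (simp_all add: wt_def drop_up_dn nth_dn nth_up)

lemma Z_Z:
  assumes "i < j" "j \<le> n"
  shows "Z i (Z j f) = complex_of_real (sqrt q) *\<^sub>C Z j (Z i f)"
proof (rule ell2_eqI)
  fix k :: "nat list"
  consider "length k \<noteq> m \<or> i < N" | "length k = m" "i = N" | "length k = m" "N < i" by linarith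
  then show "ell2_apply (Z i (Z j f)) k = ell2_apply (complex_of_real (sqrt q) *\<^sub>C Z j (Z i f)) k"
  proof cases
    case 1
    then show ?thesis by (auto simp: Z_apply coef_def src_def)
  next
    case 2
    define s where "s = j - Suc N"
    have s: "s < length k" "\<not> j \<le> N" using assms 2 by (auto simp: s_def)
    show ?thesis
    proof (cases "k ! s = 0")
      case False
      then have "sum_list k = Suc (sum_list (dn s k))"
        using sum_drop_dn[of 0 s k] s by simp
      then show ?thesis
        using 2 s assms by (simp add: Z_apply coef_def src_def s_def[symmetric])
    qed (use 2 s assms in \<open>simp add: Z_apply coef_def src_def s_def[symmetric]\<close>)
  next
    case 3
    define r s where "r = i - Suc N" and "s = j - Suc N"
    have rs: "r < s" "s < length k" "\<not> j \<le> N" "\<not> i \<le> N" using assms 3 by (auto simp: r_def s_def)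
    show ?thesis
    proof (cases "k ! s = 0 \<or> k ! r = 0")
      case False
      then show ?thesis
        using 3 rs assms wt_dn_above[of r s "dn r k"] wt_below(1)[of r s "dn s k"]
        by (simp add: Z_apply coef_def src_def r_def[symmetric] s_def[symmetric] nth_dn dn_commute[of r s])
    qed (use 3 rs assms in
        \<open>auto simp: Z_apply coef_def src_def r_def[symmetric] s_def[symmetric] nth_dn\<close>)
  qed
qed

lemma Zs_Z:
  assumes "i < j" "j \<le> n"
  shows "Zs j (Z i f) = complex_of_real (sqrt q) *\<^sub>C Z i (Zs j f)"
proof (rule ell2_eqI)
  fix k :: "nat list"
  consider "length k \<noteq> m \<or> i < N" | "length k = m" "i = N" | "length k = m" "N < i" by linarith
  then show "ell2_apply (Zs j (Z i f)) k = ell2_apply (complex_of_real (sqrt q) *\<^sub>C Z i (Zs j f)) k"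
  proof cases
    case 1
    then show ?thesis by (auto simp: Z_apply Zs_apply coef_def coef_star_def src_def src_star_def)
  next
    case 2
    define s where "s = j - Suc N"
    have s: "s < length k" "\<not> j \<le> N" using assms 2 by (auto simp: s_def)
    have "sum_list (up s k) = Suc (sum_list k)"
      using sum_drop_up[of 0 s k] s by simp
    then show ?thesis
      using 2 s assms
      by (simp add: Z_apply Zs_apply coef_def coef_star_def src_def src_star_def s_def[symmetric])
  next
    case 3
    define r s where "r = i - Suc N" and "s = j - Suc N"
    have rs: "r < s" "s < length k" "\<not> j \<le> N" "\<not> i \<le> N" using assms 3 by (auto simp: r_def s_def)
    show ?thesis
      using 3 rs assms wt_up_above[of r s "dn r k"]
      by (simp add: Z_apply Zs_apply coef_def coef_star_def src_def src_star_def
          r_def[symmetric] s_def[symmetric] nth_up wt_below up_dn_commute[of s r, symmetric])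
  qed
qed

lemma ball_relations_model: "ball_relations q n B Z"
proof -
  have star: "astar B (Z i) = Zs i" for i by (rule corner_astar[OF Z_adjoint])
  have half: "q powr (1/2) = sqrt q" "q powr (-1/2) = 1 / sqrt q"
    using q by (simp_all add: powr_half_sqrt powr_minus_divide)
  have half_inverse: "complex_of_real (q powr (-1/2)) * complex_of_real (sqrt q) = 1"
    unfolding half using sqrt_q(1) by (simp flip: of_real_mult)
  interpret unital_cstar_algebra B by (rule unital_cstar_algebra_corner)
  have ZZ: "Z j \<otimes>\<^bsub>B\<^esub> Zs j \<in> carrier B" "Zs j \<otimes>\<^bsub>B\<^esub> Z j \<in> carrier B" for j
    by (intro corner.m_closed Z_in_corner Zs_in_corner)+
  have sum: "(\<Oplus>\<^bsub>B\<^esub>j\<in>{i+1..n}. Z j \<otimes>\<^bsub>B\<^esub> Zs j) = (\<lambda>f. \<Sum>j\<in>{i+1..n}. Z j (Zs j f))" for i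
    using corner_finsum[of "{i+1..n}" "\<lambda>j. Z j \<otimes>\<^bsub>B\<^esub> Zs j"] ZZ by simp
  have sum_in: "(\<Oplus>\<^bsub>B\<^esub>j\<in>{i+1..n}. Z j \<otimes>\<^bsub>B\<^esub> Zs j) \<in> carrier B" for i
    by (intro corner.finsum_closed) (use ZZ in blast)
  have outside: "ell2_apply (Z i f) k = 0" "ell2_apply (Zs i f) k = 0" if "length k \<noteq> m" for i f k
    using that by (simp_all add: Z_apply Zs_apply coef_def coef_star_def)
  show ?thesis
    unfolding ball_relations_def star
  proof (intro conjI ballI impI)
    fix i show "Z i \<in> carrier B" by (rule Z_in_corner)
  next
    fix i j assume ij: "i \<in> {1..n}" "j \<in> {1..n}" "i < j"
    then have j: "j \<le> n" by simp
    show "Z i \<otimes>\<^bsub>B\<^esub> Z j = ascale B (complex_of_real (q powr (1/2))) (Z j \<otimes>\<^bsub>B\<^esub> Z i)"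
      using Z_Z ij by (simp add: half)
    show "Z i \<otimes>\<^bsub>B\<^esub> Zs j = ascale B (complex_of_real (q powr (-1/2))) (Zs j \<otimes>\<^bsub>B\<^esub> Z i)"
      using half_inverse by (simp only: corner_simps Zs_Z[OF ij(3) j] scaleC_scaleC scaleC_one)
  next
    fix i assume i: "i \<in> {1..n}"
    have "ell2_apply (Zs i (Z i f) - complex_of_real q *\<^sub>C Z i (Zs i f)) k
      = ell2_apply (complex_of_real (1 - q) *\<^sub>C (Proj f - (\<Sum>j\<in>{i+1..n}. Z j (Zs j f)))) k" for f k
    proof (cases "length k = m")
      case True
      have i': "0 < i" "i \<le> n" using i by auto
      show ?thesis
        unfolding ell2_apply_simps ell2_apply_sum sum_Z_Zs_apply[OF True i'(2)] Zs_Z_apply[OF True i']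
          Z_Zs_apply[OF True i'] Proj_apply
        using True by (simp add: algebra_simps)
    qed (simp add: outside Proj_apply)
    then have "(\<lambda>f. Zs i (Z i f) - complex_of_real q *\<^sub>C Z i (Zs i f))
      = (\<lambda>f. complex_of_real (1 - q) *\<^sub>C (Proj f - (\<Sum>j\<in>{i+1..n}. Z j (Zs j f))))"
      by (intro ext ell2_eqI)
    moreover have "(Zs i \<otimes>\<^bsub>B\<^esub> Z i) \<ominus>\<^bsub>B\<^esub> ascale B (complex_of_real q) (Z i \<otimes>\<^bsub>B\<^esub> Zs i)
        = (\<lambda>f. Zs i (Z i f) - complex_of_real q *\<^sub>C Z i (Zs i f))"
      using corner_minus[OF ZZ(2) ascale_closed[OF ZZ(1)], of i "complex_of_real q" i]
      by (simp only: corner_simps)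
    moreover have "\<one>\<^bsub>B\<^esub> \<ominus>\<^bsub>B\<^esub> (\<Oplus>\<^bsub>B\<^esub>j\<in>{i+1..n}. Z j \<otimes>\<^bsub>B\<^esub> Zs j)
        = (\<lambda>f. Proj f - (\<Sum>j\<in>{i+1..n}. Z j (Zs j f)))"
      using corner_minus[OF corner.one_closed sum_in, of i] unfolding sum by (simp only: corner_simps)
    ultimately show "(Zs i \<otimes>\<^bsub>B\<^esub> Z i) \<ominus>\<^bsub>B\<^esub> ascale B (complex_of_real q) (Z i \<otimes>\<^bsub>B\<^esub> Zs i)
        = ascale B (complex_of_real (1 - q)) (\<one>\<^bsub>B\<^esub> \<ominus>\<^bsub>B\<^esub> (\<Oplus>\<^bsub>B\<^esub>j\<in>{i+1..n}. Z j \<otimes>\<^bsub>B\<^esub> Zs j))"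
      by (simp only: corner_simps)
  qed
qed

lemma Z_ket:
  assumes "length k = m" "N < i" "i \<le> n"
  shows "Z i (ket k) = complex_of_real (wt (i - Suc N) k) *\<^sub>C ket (up (i - Suc N) k)"
proof (rule ell2_eqI)
  fix l
  define r where "r = i - Suc N"
  have r: "r < m" "\<not> i \<le> N" using assms by (auto simp: r_def)
  have eq: "(l ! r \<noteq> 0 \<and> dn r l = k) \<longleftrightarrow> l = up r k" if "length l = m"
    using that r(1) assms(1) dn_up[of r k] up_dn[of r l] nth_up[of r k r] by auto
  show "ell2_apply (Z i (ket k)) l
      = ell2_apply (complex_of_real (wt (i - Suc N) k) *\<^sub>C ket (up (i - Suc N) k)) l"
    using assms r eq by (auto simp: Z_apply coef_def src_def r_def[symmetric])
qed

lemma Z_ket_diag: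
  assumes "length k = m"
  shows "Z N (ket k) = (\<theta> * complex_of_real (sqrt q ^ sum_list k)) *\<^sub>C ket k"
  using assms N by (intro ell2_eqI) (auto simp: Z_apply coef_def src_def)

lemma Z_zero: "i < N \<Longrightarrow> Z i f = 0"
  by (rule ell2_eqI) (simp add: Z_apply coef_def)

lemma Zs_vacuum:
  assumes "N < i"
  shows "Zs i (ket (replicate m 0)) = 0"
proof (rule ell2_eqI)
  fix k
  have "up (i - Suc N) k \<noteq> replicate m 0" if "length k = m" "i \<le> n"
  proof -
    have "i - Suc N < length k" using assms that by auto
    then have "up (i - Suc N) k ! (i - Suc N) = Suc (k ! (i - Suc N))" "i - Suc N < m"
      using that by (simp_all add: nth_up)
    then show ?thesis by (metis nat.simps(3) nth_replicate)
  qed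
  then show "ell2_apply (Zs i (ket (replicate m 0))) k = ell2_apply 0 k"
    using assms by (auto simp: Zs_apply coef_star_def src_star_def)
qed

text \<open>
  A vector with a nonzero coordinate at some \<open>k\<close> is moved by the adjoint shifts to one with a
  nonzero coordinate at \<open>0\<close>. The powers of \<open>1 - \<Sum>\<^sub>j z\<^sub>j z\<^sub>j\<^sup>*\<close>, which multiply the \<open>k\<close>-th
  coordinate by \<open>q\<^bsup>t |k|\<^esup>\<close>, then converge to the projection to the vacuum, and the shifts of
  the vacuum give all basis vectors.
\<close>

lemma invariant_subspace_model:
  assumes M: "closed_csubspace M" "M \<subseteq> \<H> m"
    and inv: "\<And>i x. i \<in> {1..n} \<Longrightarrow> x \<in> M \<Longrightarrow> Z i x \<in> M"
      "\<And>i x. i \<in> {1..n} \<Longrightarrow> x \<in> M \<Longrightarrow> Zs i x \<in> M"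
    and x: "x \<in> M" "x \<noteq> 0"
  shows "M = \<H> m"
proof -
  note MD = csubspaceD[OF M(1)]
  define o0 where "o0 = replicate m (0::nat)"
  have zero_list: "k = o0" if "length k = m" "\<And>r. r < m \<Longrightarrow> k ! r = 0" for k
    using that by (auto simp: o0_def list_eq_iff_nth_eq)
  have to_vacuum: "\<exists>y\<in>M. ell2_apply y o0 \<noteq> 0"
    if "length k = m" "y \<in> M" "ell2_apply y k \<noteq> 0" for k y
    using that
  proof (induction "sum_list k" arbitrary: k y rule: less_induct)
    case less
    show ?case
    proof (cases "k = o0")
      case False
      then obtain r where r: "r < m" "k ! r \<noteq> 0" using zero_list less.prems(1) by blast
      define i where "i = Suc (N + r)"
      have i: "i \<in> {1..n}" "i - Suc N = r" "\<not> i \<le> N" using r by (auto simp: i_def)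
      have "ell2_apply (Zs i y) (dn r k) \<noteq> 0"
        using i r less.prems wt_pos[of r "dn r k"]
        by (simp add: Zs_apply coef_star_def src_star_def up_dn)
      moreover have "sum_list (dn r k) < sum_list k"
        using sum_drop_dn[of 0 r k] r less.prems by simp
      ultimately show ?thesis
        using less.hyps[of "dn r k" "Zs i y"] inv(2)[OF i(1) less.prems(2)] less.prems by simp
    qed (use less.prems in auto)
  qed
  obtain k where "ell2_apply x k \<noteq> 0"
    using x(2) ell2_eqI[of x 0] by auto
  moreover have "length k = m" if "ell2_apply x k \<noteq> 0" for k
    using that x(1) M(2) by (auto simp: hilbert_H_def)
  ultimately obtain y where y: "y \<in> M" "ell2_apply y o0 \<noteq> 0"
    using to_vacuum x(1) by blast
  define D where "D f = f - (\<Sum>j\<in>{N+1..n}. Z j (Zs j f))" for f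
  have D_in: "D f \<in> M" if "f \<in> M" for f
    unfolding D_def using that by (intro MD(6) csubspace_sum[OF M(1)] inv) auto
  have Dt_in: "(D ^^ t) y \<in> M" for t
    by (induction t) (use y D_in in auto)
  have Dt: "ell2_apply ((D ^^ t) y) k = complex_of_real (q ^ (t * sum_list k)) * ell2_apply y k"
    if "length k = m" for t k
  proof (induction t)
    case (Suc t)
    have "ell2_apply (D f) k = complex_of_real (q ^ sum_list k) * ell2_apply f k" for f
      using sum_Z_Zs_apply[OF that, of N f] N by (simp add: D_def defect_def algebra_simps)
    then show ?case using Suc by (simp add: power_add)
  qed simp
  have "(\<lambda>t. (D ^^ t) y) \<longlonglongrightarrow> ell2_apply y o0 *\<^sub>C ket o0"
  proof (rule LIM_zero_cancel, rule Lim_null_comparison)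
    have "(\<lambda>t. q ^ t * norm y) \<longlonglongrightarrow> 0 * norm y"
      using q by (intro tendsto_intros LIMSEQ_power_zero) auto
    then show "(\<lambda>t. q ^ t * norm y) \<longlonglongrightarrow> 0" by simp
    have "norm ((D ^^ t) y - ell2_apply y o0 *\<^sub>C ket o0) \<le> q ^ t * norm y" for t
    proof (rule ell2_norm_leI)
      fix F :: "nat list set" assume F: "finite F"
      have coord: "cmod (ell2_apply ((D ^^ t) y - ell2_apply y o0 *\<^sub>C ket o0) k) \<le> q ^ t * cmod (ell2_apply y k)" for k
      proof (cases "length k = m")
        case True
        show ?thesis
        proof (cases "k = o0")
          case True
          then show ?thesis using Dt[of k t] q \<open>length k = m\<close> by (simp add: o0_def sum_list_replicate)
        next
          case False
          then obtain r where "r < m" "k ! r \<noteq> 0" using zero_list[OF True] by blast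
          then have "sum_list k \<noteq> 0" using elem_le_sum_list[of r k] True by auto
          then have "1 \<le> sum_list k" by linarith
          then have "t * 1 \<le> t * sum_list k" by (rule mult_le_mono2)
          then have "t \<le> t * sum_list k" by simp
          then have "q ^ (t * sum_list k) \<le> q ^ t" using q by (intro power_decreasing) auto
          then have "q ^ (t * sum_list k) * cmod (ell2_apply y k) \<le> q ^ t * cmod (ell2_apply y k)"
            by (rule mult_right_mono) simp
          then show ?thesis
            using Dt[OF True, of t] False q by (simp add: norm_mult norm_power)
        qed
      next
        case False
        have "ell2_apply ((D ^^ t) y) k = 0"
          using Dt_in[of t] M(2) False by (auto simp: hilbert_H_def)
        moreover have "k \<noteq> o0" using False by (auto simp: o0_def)
        ultimately show ?thesis using q by simp
      qed
      have "(\<Sum>k\<in>F. (cmod (ell2_apply ((D ^^ t) y - ell2_apply y o0 *\<^sub>C ket o0) k))\<^sup>2)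
          \<le> (\<Sum>k\<in>F. (q ^ t * cmod (ell2_apply y k))\<^sup>2)"
        by (intro sum_mono power_mono coord) simp
      also have "\<dots> = (q ^ t)\<^sup>2 * (\<Sum>k\<in>F. (cmod (ell2_apply y k))\<^sup>2)"
        by (simp add: power_mult_distrib sum_distrib_left)
      also have "\<dots> \<le> (q ^ t)\<^sup>2 * (norm y)\<^sup>2"
        by (intro mult_left_mono ell2_norm_finite_le F) simp
      finally show "(\<Sum>k\<in>F. (cmod (ell2_apply ((D ^^ t) y - ell2_apply y o0 *\<^sub>C ket o0) k))\<^sup>2)
          \<le> (q ^ t * norm y)\<^sup>2"
        by (simp add: power_mult_distrib)
    qed (use q in simp)
    then show "\<forall>\<^sub>F t in sequentially. norm ((D ^^ t) y - ell2_apply y o0 *\<^sub>C ket o0) \<le> q ^ t * norm y"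
      by simp
  qed
  then have "ell2_apply y o0 *\<^sub>C ket o0 \<in> M"
    by (rule closed_sequentially[OF MD(1) Dt_in])
  from MD(4)[OF this, of "1 / ell2_apply y o0"] have vac: "ket o0 \<in> M"
    using y(2) by (simp add: scaleC_scaleC)
  have kets: "ket k \<in> M" if "length k = m" for k
    using that
  proof (induction "sum_list k" arbitrary: k rule: less_induct)
    case less
    show ?case
    proof (cases "k = o0")
      case False
      then obtain r where r: "r < m" "k ! r \<noteq> 0" using zero_list less.prems(1) by blast
      define i where "i = Suc (N + r)"
      have i: "i \<in> {1..n}" "i - Suc N = r" "N < i" "i \<le> n" using r by (auto simp: i_def)
      have "sum_list (dn r k) < sum_list k"
        using sum_drop_dn[of 0 r k] r less.prems by simp
      then have "ket (dn r k) \<in> M" using less by simp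
      then have "Z i (ket (dn r k)) \<in> M" by (rule inv(1)[OF i(1)])
      moreover have "Z i (ket (dn r k)) = complex_of_real (wt r (dn r k)) *\<^sub>C ket k"
        using Z_ket[of "dn r k" i] i r less.prems by (simp add: up_dn)
      ultimately have "complex_of_real (wt r (dn r k)) *\<^sub>C ket k \<in> M" by simp
      from MD(4)[OF this, of "1 / complex_of_real (wt r (dn r k))"] show ?thesis
        using wt_pos[of r "dn r k"] by (simp add: scaleC_scaleC)
    qed (use vac in simp)
  qed
  have "\<H> m \<subseteq> M"
  proof
    fix f assume "f \<in> \<H> m"
    then have supp: "length k = m" if "ell2_apply f k \<noteq> 0" for k
      using that by (auto simp: hilbert_H_def)
    show "f \<in> M" by (rule ell2_in_closed_span[OF M(1) kets[OF supp]])
  qed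
  then show ?thesis using M(2) by blast
qed

end

section \<open>Tuples of operators satisfying the relations of the quantum ball\<close>

locale ball_operators =
  fixes q :: real and n :: nat and X :: "'h::complex_hilbert set" and Z Zs :: "nat \<Rightarrow> 'h \<Rightarrow> 'h"
  assumes q: "0 < q" "q < 1" and X: "closed_csubspace X"
    and Z: "\<And>i. i \<in> {1..n} \<Longrightarrow> bounded_operator_on X (Z i)"
    and Zs: "\<And>i. i \<in> {1..n} \<Longrightarrow> bounded_operator_on X (Zs i)"
    and adj: "\<And>i x y. i \<in> {1..n} \<Longrightarrow> x \<in> X \<Longrightarrow> y \<in> X \<Longrightarrow> cinner (Zs i x) y = cinner x (Z i y)"
    and Z_Z: "\<And>i j x. i \<in> {1..n} \<Longrightarrow> j \<in> {1..n} \<Longrightarrow> i < j \<Longrightarrow> x \<in> X \<Longrightarrow>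
      Z i (Z j x) = complex_of_real (sqrt q) *\<^sub>C Z j (Z i x)"
    and Zs_Z_less: "\<And>i j x. i \<in> {1..n} \<Longrightarrow> j \<in> {1..n} \<Longrightarrow> i < j \<Longrightarrow> x \<in> X \<Longrightarrow>
      Zs j (Z i x) = complex_of_real (sqrt q) *\<^sub>C Z i (Zs j x)"
    and Zs_Z_same: "\<And>i x. i \<in> {1..n} \<Longrightarrow> x \<in> X \<Longrightarrow>
      Zs i (Z i x) - complex_of_real q *\<^sub>C Z i (Zs i x)
        = complex_of_real (1 - q) *\<^sub>C (x - (\<Sum>j\<in>{i+1..n}. Z j (Zs j x)))"
begin

lemmas X_simps = csubspaceD(2-6)[OF X]

lemma Z_in: "i \<in> {1..n} \<Longrightarrow> x \<in> X \<Longrightarrow> Z i x \<in> X"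
  and Zs_in: "i \<in> {1..n} \<Longrightarrow> x \<in> X \<Longrightarrow> Zs i x \<in> X"
  by (rule bounded_operatorD(1)[OF Z] bounded_operatorD(1)[OF Zs]; assumption)+

lemma Z_diff: "i \<in> {1..n} \<Longrightarrow> x \<in> X \<Longrightarrow> y \<in> X \<Longrightarrow> Z i (x - y) = Z i x - Z i y"
  and Zs_diff: "i \<in> {1..n} \<Longrightarrow> x \<in> X \<Longrightarrow> y \<in> X \<Longrightarrow> Zs i (x - y) = Zs i x - Zs i y"
  and Z_zero: "i \<in> {1..n} \<Longrightarrow> Z i 0 = 0" and Zs_zero: "i \<in> {1..n} \<Longrightarrow> Zs i 0 = 0"
  by (simp_all add: bounded_operator_linear[OF X Z] bounded_operator_linear[OF X Zs])

lemma Z_add: "i \<in> {1..n} \<Longrightarrow> x \<in> X \<Longrightarrow> y \<in> X \<Longrightarrow> Z i (x + y) = Z i x + Z i y"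
  and Zs_add: "i \<in> {1..n} \<Longrightarrow> x \<in> X \<Longrightarrow> y \<in> X \<Longrightarrow> Zs i (x + y) = Zs i x + Zs i y"
  and Z_scale: "i \<in> {1..n} \<Longrightarrow> x \<in> X \<Longrightarrow> Z i (c *\<^sub>C x) = c *\<^sub>C Z i x"
  and Zs_scale: "i \<in> {1..n} \<Longrightarrow> x \<in> X \<Longrightarrow> Zs i (c *\<^sub>C x) = c *\<^sub>C Zs i x"
  by (simp_all add: bounded_operatorD[OF Z] bounded_operatorD[OF Zs])

lemma adj': "i \<in> {1..n} \<Longrightarrow> x \<in> X \<Longrightarrow> y \<in> X \<Longrightarrow> cinner (Z i x) y = cinner x (Zs i y)"
  using adj[of i y x] cinner_commute[of "Z i x" y] cinner_commute[of x "Zs i y"] by simp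

lemma Zs_Zs:
  assumes "i \<in> {1..n}" "j \<in> {1..n}" "i < j" "x \<in> X"
  shows "Zs j (Zs i x) = complex_of_real (sqrt q) *\<^sub>C Zs i (Zs j x)"
  by (rule eqI_cinner[of X])
    (use assms in \<open>simp_all add: adj Z_in Zs_in X_simps Z_Z cinner_scaleC_left cinner_scaleC_right\<close>)

lemma Zs_Z:
  assumes "i \<in> {1..n}" "j \<in> {1..n}" "i \<noteq> j" "x \<in> X"
  shows "Zs i (Z j x) = complex_of_real (sqrt q) *\<^sub>C Z j (Zs i x)"
proof (cases "j < i")
  case False
  then have "i < j" using assms by simp
  then show ?thesis
    by (intro eqI_cinner[of X])
      (use assms in \<open>simp_all add: adj adj' Z_in Zs_in X_simps Zs_Z_less cinner_scaleC_left
        cinner_scaleC_right\<close>)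
qed (use Zs_Z_less assms in simp)

definition D :: "nat \<Rightarrow> 'h \<Rightarrow> 'h" where
  "D i x = x - (\<Sum>j\<in>{i+1..n}. Z j (Zs j x))"

lemma D_n: "D n x = x"
  by (simp add: D_def)

lemma D_pred: "i \<in> {1..n} \<Longrightarrow> D (i - 1) x = D i x - Z i (Zs i x)"
  by (simp add: D_def sum.atLeast_Suc_atMost[of i n])

lemma D_in: "x \<in> X \<Longrightarrow> D i x \<in> X"
  unfolding D_def by (intro X_simps csubspace_sum[OF X] Z_in Zs_in) auto

lemma Zs_Z_D:
  assumes "i \<in> {1..n}" "x \<in> X"
  shows "Zs i (Z i x) = complex_of_real q *\<^sub>C Z i (Zs i x) + complex_of_real (1 - q) *\<^sub>C D i x"
  using Zs_Z_same[OF assms] unfolding D_def by (simp add: algebra_simps)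

lemma D_adj:
  assumes "x \<in> X" "y \<in> X"
  shows "cinner (D i x) y = cinner x (D i y)"
proof -
  have "cinner (\<Sum>j\<in>{i+1..n}. Z j (Zs j x)) y = cinner x (\<Sum>j\<in>{i+1..n}. Z j (Zs j y))"
    unfolding cinner.sum_left cinner.sum_right
    by (intro sum.cong) (use assms in \<open>auto simp: adj' adj Z_in Zs_in\<close>)
  then show ?thesis by (simp add: D_def cinner.diff_left cinner.diff_right)
qed

lemma D_bounded: "bounded_operator_on X (D i)"
  unfolding D_def[abs_def]
  by (rule bounded_operator_diff[OF X bounded_operator_id[OF X]
        bounded_operator_sum_op[OF X bounded_operator_compose[OF Z Zs]]]) auto

lemma common_bound:
  "\<exists>L>0. \<forall>j\<in>{1..n}. \<forall>x\<in>X. norm (Z j x) \<le> L * norm x \<and> norm (Zs j x) \<le> L * norm x"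
proof -
  have "\<exists>K. \<forall>x\<in>X. norm (Z j x) \<le> K * norm x" "\<exists>K. \<forall>x\<in>X. norm (Zs j x) \<le> K * norm x"
    if j: "j \<in> {1..n}" for j
    using bounded_operator_bound[OF Z[OF j]] bounded_operator_bound[OF Zs[OF j]] by metis+
  then obtain K K' where K: "\<And>j x. j \<in> {1..n} \<Longrightarrow> x \<in> X \<Longrightarrow> norm (Z j x) \<le> K j * norm x"
    "\<And>j x. j \<in> {1..n} \<Longrightarrow> x \<in> X \<Longrightarrow> norm (Zs j x) \<le> K' j * norm x"
    by metis
  define L where "L = (\<Sum>j\<in>{1..n}. \<bar>K j\<bar> + \<bar>K' j\<bar>) + 1"
  have L: "0 < L" unfolding L_def by (intro add_nonneg_pos sum_nonneg) auto
  have "K j \<le> L" "K' j \<le> L" if "j \<in> {1..n}" for j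
    using member_le_sum[OF that, of "\<lambda>j. \<bar>K j\<bar> + \<bar>K' j\<bar>"] by (auto simp: L_def)
  then have "norm (Z j x) \<le> L * norm x" "norm (Zs j x) \<le> L * norm x"
    if "j \<in> {1..n}" "x \<in> X" for j x
    using K[OF that] that(1) by (meson mult_right_mono norm_ge_zero order_trans)+
  then show ?thesis using L by blast
qed

lemma D_diff: "x \<in> X \<Longrightarrow> y \<in> X \<Longrightarrow> D i (x - y) = D i x - D i y"
  and D_scale: "x \<in> X \<Longrightarrow> D i (c *\<^sub>C x) = c *\<^sub>C D i x"
  by (simp_all add: bounded_operator_linear[OF X D_bounded] bounded_operatorD[OF D_bounded])

lemma D_Z_le:
  assumes "j \<in> {1..n}" "j \<le> i" "x \<in> X"
  shows "D i (Z j x) = Z j (D i x)"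
proof -
  have "Z l (Zs l (Z j x)) = Z j (Z l (Zs l x))" if "l \<in> {i+1..n}" for l
  proof -
    have l: "l \<in> {1..n}" "j < l" using that assms by auto
    then show ?thesis
      using assms by (simp add: Zs_Z Z_scale Z_in Zs_in Z_Z[OF assms(1) l(1) l(2)])
  qed
  then have "(\<Sum>l\<in>{i+1..n}. Z l (Zs l (Z j x))) = Z j (\<Sum>l\<in>{i+1..n}. Z l (Zs l x))"
    by (subst bounded_operator_sum[OF X Z]) (use assms in \<open>auto simp: Z_in Zs_in\<close>)
  then show ?thesis
    unfolding D_def using assms
    by (subst Z_diff) (auto intro!: csubspace_sum[OF X] simp: Z_in Zs_in)
qed

text \<open>
  For \<open>i = j - 1\<close> this combines \<open>D\<^sub>j\<^sub>-\<^sub>1 = D\<^sub>j - z\<^sub>j z\<^sub>j\<^sup>*\<close> with the relation for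
  \<open>z\<^sub>j\<^sup>* z\<^sub>j\<close>; the further terms of \<open>D\<^sub>i\<close> scale in the same way.
\<close>

lemma D_Z_less:
  assumes "j \<in> {1..n}" "i < j" "x \<in> X"
  shows "D i (Z j x) = complex_of_real q *\<^sub>C Z j (D i x)"
proof -
  have "i \<le> j - 1" using assms by simp
  then show ?thesis
  proof (induction i rule: inc_induct)
    case base
    have "D (j - 1) (Z j x) = D j (Z j x) - Z j (Zs j (Z j x))"
      by (rule D_pred[OF assms(1)])
    also have "\<dots> = Z j (D j x) - Z j (complex_of_real q *\<^sub>C Z j (Zs j x)
        + complex_of_real (1 - q) *\<^sub>C D j x)"
      using assms by (simp add: D_Z_le Zs_Z_D)
    also have "\<dots> = Z j (D j x) - (complex_of_real q *\<^sub>C Z j (Z j (Zs j x))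
        + complex_of_real (1 - q) *\<^sub>C Z j (D j x))"
      using assms by (subst Z_add) (simp_all add: Z_scale Z_in Zs_in D_in X_simps)
    also have "\<dots> = complex_of_real q *\<^sub>C (Z j (D j x) - Z j (Z j (Zs j x)))"
      by (simp add: scaleC_diff_right scaleC_diff_left)
    also have "\<dots> = complex_of_real q *\<^sub>C Z j (D (j - 1) x)"
      unfolding D_pred[OF assms(1)] using assms by (simp add: Z_diff D_in Z_in Zs_in)
    finally show ?case .
  next
    case (step i)
    then have i: "Suc i \<in> {1..n}" "Suc i < j" using assms by auto
    have "Z (Suc i) (Zs (Suc i) (Z j x))
        = complex_of_real (sqrt q) *\<^sub>C (complex_of_real (sqrt q) *\<^sub>C Z j (Z (Suc i) (Zs (Suc i) x)))"
      using i assms by (simp add: Zs_Z Z_scale Z_in Zs_in Z_Z[OF i(1) assms(1) i(2)])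
    also have "\<dots> = complex_of_real q *\<^sub>C Z j (Z (Suc i) (Zs (Suc i) x))"
      using q by (simp add: scaleC_scaleC flip: of_real_mult)
    finally show ?case
      using step.IH D_pred[OF i(1)] i assms
      by (simp add: Z_diff D_in Z_in Zs_in scaleC_diff_right)
  qed
qed

lemma Zs_D_less:
  assumes "j \<in> {1..n}" "i < j" "x \<in> X"
  shows "Zs j (D i x) = complex_of_real q *\<^sub>C D i (Zs j x)"
  by (rule eqI_cinner[of X])
    (use assms in \<open>simp_all add: adj D_adj D_Z_less D_in Z_in Zs_in X_simps cinner_scaleC_left
      cinner_scaleC_right\<close>)

text \<open>The inner product of the sum with \<open>x\<close> is \<open>\<Sum>\<^sub>j \<parallel>z\<^sub>j\<^sup>* x\<parallel>\<^sup>2\<close>.\<close>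

lemma Zs_eq_zero:
  assumes "F \<subseteq> {1..n}" "x \<in> X" "(\<Sum>j\<in>F. Z j (Zs j x)) = 0" "j \<in> F"
  shows "Zs j x = 0"
proof -
  have fin: "finite F" using assms(1) finite_subset by blast
  have "(\<Sum>j\<in>F. (norm (Zs j x))\<^sup>2) = Re (cinner (\<Sum>j\<in>F. Z j (Zs j x)) x)"
    unfolding cinner.sum_left Re_sum
    using assms(1,2) by (intro sum.cong) (auto simp: adj' Zs_in cinner_self subset_iff)
  then have "(\<Sum>j\<in>F. (norm (Zs j x))\<^sup>2) = 0" using assms(3) by (simp add: cinner.zero_left)
  then show ?thesis using fin assms(4) by (simp add: sum_nonneg_eq_0_iff)
qed

text \<open>
  Let \<open>\<mu>\<close> be the norm of \<open>D = D\<^sub>N\<close> and let \<open>D\<^sup>2 x \<approx> \<mu>\<^sup>2 x\<close> for a unit vector \<open>x\<close>. As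
  \<open>z\<^sub>j\<^sup>* D = q D z\<^sub>j\<^sup>*\<close>, the vector \<open>z\<^sub>j\<^sup>* x\<close> would be an approximate eigenvector of \<open>D\<^sup>2\<close>
  to the too large value \<open>\<mu>\<^sup>2 / q\<^sup>2\<close>; so \<open>z\<^sub>j\<^sup>* x \<approx> 0\<close>, hence \<open>D x \<approx> x\<close> and \<open>\<mu> = 1\<close>.
\<close>

lemma approximate_vacuum:
  assumes "N \<le> n" and nz: "x0 \<in> X" "D N x0 \<noteq> 0"
  obtains "\<And>x. x \<in> X \<Longrightarrow> norm (D N x) \<le> norm x"
    "\<And>e. 0 < e \<Longrightarrow> \<exists>x\<in>X. norm x = 1 \<and> (\<forall>j\<in>{N+1..n}. norm (Zs j x) \<le> e)"
proof -
  obtain \<mu> where \<mu>: "0 \<le> \<mu>" "\<And>x. x \<in> X \<Longrightarrow> norm (D N x) \<le> \<mu> * norm x"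
    and near: "\<And>e. 0 < \<mu> \<Longrightarrow> 0 < e \<Longrightarrow>
      \<exists>x\<in>X. norm x = 1 \<and> norm (D N (D N x) - complex_of_real (\<mu>\<^sup>2) *\<^sub>C x) < e"
    using norm_almost_attained[OF X D_bounded D_bounded D_adj] by metis
  have "\<mu> \<noteq> 0" using \<mu>(2)[OF nz(1)] nz(2) by auto
  then have pos: "0 < \<mu>" using \<mu>(1) by simp
  obtain L where L: "0 < L" "\<And>j x. j \<in> {1..n} \<Longrightarrow> x \<in> X \<Longrightarrow> norm (Z j x) \<le> L * norm x"
    "\<And>j x. j \<in> {1..n} \<Longrightarrow> x \<in> X \<Longrightarrow> norm (Zs j x) \<le> L * norm x"
    using common_bound by meson
  \<comment> \<open>the gap between the approximate eigenvalue \<open>\<mu>\<^sup>2\<close> and the norm bound \<open>q\<^sup>2 \<mu>\<^sup>2\<close> of \<open>q\<^sup>2 D\<^sup>2\<close>\<close>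
  define w where "w = \<mu>\<^sup>2 * (1 - q\<^sup>2)"
  have w: "0 < w" using pos q by (simp add: w_def power_less_one_iff)
  have small: "\<exists>x\<in>X. norm x = 1 \<and> (\<forall>j\<in>{N+1..n}. norm (Zs j x) \<le> e)
      \<and> norm (D N (D N x) - complex_of_real (\<mu>\<^sup>2) *\<^sub>C x) < e" if e: "0 < e" for e
  proof -
    \<comment> \<open>Applying \<open>z\<^sub>j\<^sup>*\<close> to the error of size \<open>d\<close> costs at most \<open>L d\<close>, which \<open>e w\<close> has to absorb.\<close>
    define d where "d = min e (e * w / L)"
    have d: "0 < d" "d \<le> e" "L * d \<le> e * w"
      using e w L(1) by (auto simp: d_def min_def field_simps)
    obtain x where x: "x \<in> X" "norm x = 1" "norm (D N (D N x) - complex_of_real (\<mu>\<^sup>2) *\<^sub>C x) < d"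
      using near[OF pos d(1)] by blast
    have "norm (Zs j x) \<le> e" if j: "j \<in> {N+1..n}" for j
    proof -
      have j': "j \<in> {1..n}" "N < j" using j by auto
      define y where "y = D N (D N x) - complex_of_real (\<mu>\<^sup>2) *\<^sub>C x"
      have y: "y \<in> X" using x by (simp add: y_def X_simps D_in)
      have "Zs j y = complex_of_real (q\<^sup>2) *\<^sub>C D N (D N (Zs j x)) - complex_of_real (\<mu>\<^sup>2) *\<^sub>C Zs j x"
        using j' x by (simp add: y_def Zs_diff Zs_D_less Zs_scale D_in X_simps D_scale Zs_in
            scaleC_scaleC power2_eq_square)
      then have "complex_of_real (\<mu>\<^sup>2) *\<^sub>C Zs j x = complex_of_real (q\<^sup>2) *\<^sub>C D N (D N (Zs j x)) - Zs j y"
        by simp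
      then have "norm (complex_of_real (\<mu>\<^sup>2) *\<^sub>C Zs j x)
          \<le> norm (complex_of_real (q\<^sup>2) *\<^sub>C D N (D N (Zs j x))) + norm (Zs j y)"
        by (metis norm_triangle_ineq4)
      then have "\<mu>\<^sup>2 * norm (Zs j x) \<le> q\<^sup>2 * norm (D N (D N (Zs j x))) + norm (Zs j y)"
        by (simp add: norm_scaleC norm_power)
      moreover have "norm (D N (D N (Zs j x))) \<le> \<mu> * (\<mu> * norm (Zs j x))"
        using \<mu>(2)[OF D_in[OF Zs_in[OF j'(1) x(1)]]] \<mu>(2)[OF Zs_in[OF j'(1) x(1)]] \<mu>(1)
        by (meson mult_left_mono order_trans)
      then have "q\<^sup>2 * norm (D N (D N (Zs j x))) \<le> q\<^sup>2 * (\<mu> * (\<mu> * norm (Zs j x)))"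
        by (rule mult_left_mono) simp
      moreover have "norm (Zs j y) \<le> L * d"
        using order_trans[OF L(3)[OF j'(1) y] mult_left_mono[of "norm y" d L]] x(3) L(1)
        by (simp add: y_def)
      ultimately have "w * norm (Zs j x) \<le> L * d"
        by (simp add: w_def algebra_simps power2_eq_square)
      also have "\<dots> \<le> w * e" using d(3) by (simp add: mult.commute)
      finally show ?thesis using w by simp
    qed
    then show ?thesis using x d(2) by (intro bexI[of _ x]) auto
  qed
  have "\<bar>\<mu>\<^sup>2 - 1\<bar> \<le> 0 + e" if e: "0 < e" for e :: real
  proof -
    \<comment> \<open>With \<open>u = x - D x\<close>, the vector \<open>(\<mu>\<^sup>2 - 1) x\<close> is, up to the sign, the sum of \<open>u\<close>,
      \<open>D u\<close> and the error of \<open>D\<^sup>2 x \<approx> \<mu>\<^sup>2 x\<close>; \<open>C d\<close> bounds the sum of the three norms.\<close>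
    define C where "C = 1 + (\<mu> + 1) * (real n * L)"
    have C: "0 < C" using L(1) pos by (simp add: C_def add_pos_nonneg)
    define d where "d = e / C"
    have d: "0 < d" "C * d = e" using e C by (auto simp: d_def)
    obtain x where x: "x \<in> X" "norm x = 1" "\<forall>j\<in>{N+1..n}. norm (Zs j x) \<le> d"
      "norm (D N (D N x) - complex_of_real (\<mu>\<^sup>2) *\<^sub>C x) < d"
      using small[OF d(1)] by blast
    define u where "u = x - D N x"
    have u: "u \<in> X" using x by (simp add: u_def X_simps D_in)
    have "norm (Z j (Zs j x)) \<le> L * d" if j: "j \<in> {N+1..n}" for j
    proof -
      have j': "j \<in> {1..n}" using j by auto
      show ?thesis
        using order_trans[OF L(2)[OF j' Zs_in[OF j' x(1)]] mult_left_mono[of "norm (Zs j x)" d L]]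
          x(3) j L(1) by simp
    qed
    then have "norm u \<le> (\<Sum>j\<in>{N+1..n}. L * d)"
      unfolding u_def D_def by (simp only: diff_diff_eq2 add_diff_cancel_left') (rule sum_norm_le)
    also have "\<dots> \<le> real n * (L * d)"
      using L(1) d by (simp add: mult_right_mono)
    finally have u_le: "norm u \<le> real n * L * d" by simp
    have "D N u = D N x - D N (D N x)" using x by (simp add: u_def D_diff D_in)
    then have "complex_of_real (\<mu>\<^sup>2 - 1) *\<^sub>C x
        = - (D N (D N x) - complex_of_real (\<mu>\<^sup>2) *\<^sub>C x) - u - D N u"
      by (simp add: u_def scaleC_diff_left)
    moreover have "norm (- (D N (D N x) - complex_of_real (\<mu>\<^sup>2) *\<^sub>C x) - u - D N u)
        \<le> norm (D N (D N x) - complex_of_real (\<mu>\<^sup>2) *\<^sub>C x) + norm u + norm (D N u)"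
      using norm_triangle_ineq4[of "- (D N (D N x) - complex_of_real (\<mu>\<^sup>2) *\<^sub>C x) - u" "D N u"]
        norm_triangle_ineq4[of "- (D N (D N x) - complex_of_real (\<mu>\<^sup>2) *\<^sub>C x)" u]
      unfolding norm_minus_cancel by linarith
    moreover have "norm (complex_of_real (\<mu>\<^sup>2 - 1) *\<^sub>C x) = \<bar>\<mu>\<^sup>2 - 1\<bar>"
      using x(2) by (simp only: norm_scaleC norm_of_real mult_1_right)
    ultimately have "\<bar>\<mu>\<^sup>2 - 1\<bar> \<le> norm (D N (D N x) - complex_of_real (\<mu>\<^sup>2) *\<^sub>C x) + norm u + norm (D N u)"
      by simp
    also have "\<dots> \<le> d + norm u + \<mu> * norm u"
      using x(4) \<mu>(2)[OF u] by simp
    also have "\<dots> = d + (\<mu> + 1) * norm u" by (simp add: algebra_simps)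
    also have "\<dots> \<le> d + (\<mu> + 1) * (real n * L * d)"
      using u_le pos by (intro add_left_mono mult_left_mono) auto
    also have "\<dots> = C * d" by (simp add: C_def algebra_simps)
    finally show ?thesis using d by simp
  qed
  then have "\<bar>\<mu>\<^sup>2 - 1\<bar> \<le> 0" by (rule field_le_epsilon)
  then have "\<mu> = 1" using pos by (simp add: power2_eq_1_iff)
  then have contr: "norm (D N x) \<le> norm x" if "x \<in> X" for x using \<mu>(2)[OF that] by simp
  have "\<exists>x\<in>X. norm x = 1 \<and> (\<forall>j\<in>{N+1..n}. norm (Zs j x) \<le> e)" if "0 < e" for e
    using small[OF that] by auto
  from that[OF contr this] show thesis by simp
qed

text \<open>
  The vacuum arises as \<open>lim D\<^sup>t x\<close>: since \<open>D\<^sup>t (1 - D) = q\<^sup>t \<Sum>\<^sub>j z\<^sub>j D\<^sup>t z\<^sub>j\<^sup>*\<close>, the powers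
  converge at a geometric rate, and an approximate vacuum \<open>x\<close> stays close to its limit.
\<close>

lemma vacuum_exists:
  assumes "N \<le> n" and nz: "x0 \<in> X" "D N x0 \<noteq> 0"
  obtains \<Omega> where "\<Omega> \<in> X" "\<Omega> \<noteq> 0" "\<And>j. j \<in> {N+1..n} \<Longrightarrow> Zs j \<Omega> = 0"
proof -
  have contr: "\<And>x. x \<in> X \<Longrightarrow> norm (D N x) \<le> norm x"
    and small: "\<And>e. 0 < e \<Longrightarrow> \<exists>x\<in>X. norm x = 1 \<and> (\<forall>j\<in>{N+1..n}. norm (Zs j x) \<le> e)"
    using approximate_vacuum[OF assms] by blast+
  obtain L where L: "0 < L" "\<And>j x. j \<in> {1..n} \<Longrightarrow> x \<in> X \<Longrightarrow> norm (Z j x) \<le> L * norm x"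
    "\<And>j x. j \<in> {1..n} \<Longrightarrow> x \<in> X \<Longrightarrow> norm (Zs j x) \<le> L * norm x"
    using common_bound by meson
  \<comment> \<open>With this \<open>e\<close> the increments of \<open>D\<^sup>t x\<close> sum up to at most \<open>1/2\<close>, so the limit is not 0.\<close>
  define M where "M = real n * L + 1"
  define e where "e = (1 - q) / (2 * M)"
  have M: "0 < M" using L(1) by (simp add: M_def add_nonneg_pos)
  have e: "0 < e" using q M by (simp add: e_def)
  obtain x where x: "x \<in> X" "norm x = 1" "\<And>j. j \<in> {N+1..n} \<Longrightarrow> norm (Zs j x) \<le> e"
    using small[OF e] by blast
  have pow_in: "(D N ^^ t) y \<in> X" if "y \<in> X" for t y
    by (induction t) (use that D_in in auto)
  have pow_contr: "norm ((D N ^^ t) y) \<le> norm y" if "y \<in> X" for t y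
    by (induction t) (use contr[OF pow_in[OF that]] in \<open>auto intro: order_trans\<close>)
  have pow_Zs: "(D N ^^ t) (Z j y) = complex_of_real (q ^ t) *\<^sub>C Z j ((D N ^^ t) y)"
    if "j \<in> {N+1..n}" "y \<in> X" for t j y
  proof (induction t)
    case (Suc t)
    have j: "j \<in> {1..n}" "N < j" using that by auto
    show ?case
      using Suc j that by (simp add: D_scale Z_in pow_in D_Z_less scaleC_scaleC mult.commute)
  qed simp
  have pow_diff: "(D N ^^ t) (y - y') = (D N ^^ t) y - (D N ^^ t) y'" if "y \<in> X" "y' \<in> X" for t y y'
    by (induction t) (use that pow_in in \<open>auto simp: D_diff\<close>)
  have pow_sum: "(D N ^^ t) (\<Sum>j\<in>F. f j) = (\<Sum>j\<in>F. (D N ^^ t) (f j))"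
    if "\<And>j. j \<in> F \<Longrightarrow> f j \<in> X" for t F and f :: "nat \<Rightarrow> 'h"
    by (induction t) (use that pow_in in \<open>auto simp: bounded_operator_sum[OF X D_bounded]\<close>)
  have S_in: "(\<Sum>j\<in>{N+1..n}. Z j (Zs j x)) \<in> X"
    using x(1) by (intro csubspace_sum[OF X] Z_in Zs_in) auto
  have step: "norm ((D N ^^ Suc t) x - (D N ^^ t) x) \<le> - (q ^ Suc t / 2) - - (q ^ t / 2)" for t
  proof -
    have "(D N ^^ Suc t) x - (D N ^^ t) x = (D N ^^ t) (D N x - x)"
      using x(1) by (simp add: pow_diff D_in funpow_swap1)
    also have "D N x - x = - (\<Sum>j\<in>{N+1..n}. Z j (Zs j x))" by (simp add: D_def)
    also have "(D N ^^ t) (- (\<Sum>j\<in>{N+1..n}. Z j (Zs j x)))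
        = - (D N ^^ t) (\<Sum>j\<in>{N+1..n}. Z j (Zs j x))"
      using pow_diff[of 0 "\<Sum>j\<in>{N+1..n}. Z j (Zs j x)" t] pow_diff[of 0 0 t] S_in X_simps(1)
      by simp
    also have "(D N ^^ t) (\<Sum>j\<in>{N+1..n}. Z j (Zs j x))
        = (\<Sum>j\<in>{N+1..n}. complex_of_real (q ^ t) *\<^sub>C Z j ((D N ^^ t) (Zs j x)))"
      using x(1) by (subst pow_sum) (auto simp: Z_in Zs_in pow_Zs)
    finally have "norm ((D N ^^ Suc t) x - (D N ^^ t) x)
        \<le> (\<Sum>j\<in>{N+1..n}. norm (complex_of_real (q ^ t) *\<^sub>C Z j ((D N ^^ t) (Zs j x))))"
      by (simp only: norm_minus_cancel) (rule norm_sum)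
    also have "\<dots> \<le> (\<Sum>j\<in>{N+1..n}. q ^ t * (L * e))"
    proof (rule sum_mono)
      fix j assume j: "j \<in> {N+1..n}"
      then have j': "j \<in> {1..n}" by auto
      have "norm (Z j ((D N ^^ t) (Zs j x))) \<le> L * norm ((D N ^^ t) (Zs j x))"
        by (intro L(2) j' pow_in Zs_in x(1))
      also have "\<dots> \<le> L * e"
        using pow_contr[OF Zs_in[OF j' x(1)], of t] x(3)[OF j] L(1)
        by (intro mult_left_mono) auto
      finally have "q ^ t * norm (Z j ((D N ^^ t) (Zs j x))) \<le> q ^ t * (L * e)"
        using q by (intro mult_left_mono) auto
      then show "norm (complex_of_real (q ^ t) *\<^sub>C Z j ((D N ^^ t) (Zs j x))) \<le> q ^ t * (L * e)"
        using q by (simp add: norm_scaleC norm_power)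
    qed
    also have "\<dots> \<le> real n * (q ^ t * (L * e))"
      using q L(1) e by (simp add: mult_right_mono)
    also have "\<dots> \<le> q ^ t * (M * e)"
      using q e by (simp add: M_def algebra_simps)
    also have "M * e = (1 - q) / 2" using M by (simp add: e_def)
    also have "q ^ t * ((1 - q) / 2) = - (q ^ Suc t / 2) - - (q ^ t / 2)"
      by (simp add: field_simps)
    finally show ?thesis .
  qed
  have "(\<lambda>t. - (q ^ t / 2)) \<longlonglongrightarrow> - (0 / 2)"
    using q by (intro tendsto_intros LIMSEQ_power_zero) auto
  then have "Cauchy (\<lambda>t. (D N ^^ t) x)"
    by (intro norm_telescoping(2)[of "\<lambda>t. (D N ^^ t) x" "\<lambda>t. - (q ^ t / 2)", OF step] convergentI)
  then obtain \<Omega> where \<Omega>: "(\<lambda>t. (D N ^^ t) x) \<longlonglongrightarrow> \<Omega>"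
    by (auto simp: Cauchy_convergent_iff convergent_def)
  have \<Omega>_in: "\<Omega> \<in> X"
    by (rule closed_sequentially[OF csubspaceD(1)[OF X] pow_in[OF x(1)] \<Omega>])
  have "(\<lambda>t. D N ((D N ^^ t) x)) \<longlonglongrightarrow> D N \<Omega>"
    by (rule bounded_operator_tendsto[OF X D_bounded pow_in[OF x(1)] \<Omega>_in \<Omega>])
  moreover have "(\<lambda>t. D N ((D N ^^ t) x)) \<longlonglongrightarrow> \<Omega>" using LIMSEQ_Suc[OF \<Omega>] by simp
  ultimately have fixed: "D N \<Omega> = \<Omega>" by (rule LIMSEQ_unique)
  have "norm (\<Omega> - x) \<le> 1 / 2"
  proof (rule LIMSEQ_le_const2)
    show "(\<lambda>t. norm ((D N ^^ t) x - x)) \<longlonglongrightarrow> norm (\<Omega> - x)" by (intro tendsto_intros \<Omega>)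
    have "norm ((D N ^^ t) x - x) \<le> 1 / 2 - q ^ t / 2" for t
      using norm_telescoping(1)[of "\<lambda>t. (D N ^^ t) x" "\<lambda>t. - (q ^ t / 2)", OF step, of 0 t]
      by simp
    moreover have "0 \<le> q ^ t / 2" for t using q by simp
    ultimately have "norm ((D N ^^ t) x - x) \<le> 1 / 2" for t by (smt (verit))
    then show "\<exists>M. \<forall>t\<ge>M. norm ((D N ^^ t) x - x) \<le> 1 / 2" by blast
  qed
  then have "\<Omega> \<noteq> 0" using x(2) by auto
  moreover have "(\<Sum>j\<in>{N+1..n}. Z j (Zs j \<Omega>)) = 0" using fixed by (simp add: D_def)
  then have "Zs j \<Omega> = 0" if "j \<in> {N+1..n}" for j
    by (rule Zs_eq_zero[rotated 2]) (use that \<Omega>_in in auto)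
  ultimately show thesis using \<Omega>_in by (intro that)
qed

end

section \<open>The absolute value of a self-adjoint operator\<close>

text \<open>
  With \<open>T = 1 - K\<^sup>2\<close> the iteration \<open>Y\<^sub>t\<^sub>+\<^sub>1 = (T + Y\<^sub>t\<^sup>2) / 2\<close> converges to \<open>1 - \<bar>K\<bar>\<close>. It is
  dominated by the same iteration \<open>y\<^sub>t\<^sub>+\<^sub>1 = (1 + y\<^sub>t\<^sup>2) / 2\<close> for the number 1, which increases
  and stays below 1: the increments of \<open>Y\<close> are bounded in norm by those of \<open>y\<close>.
\<close>

primrec sqrt_bound :: "nat \<Rightarrow> real" where
  "sqrt_bound 0 = 0"
| "sqrt_bound (Suc t) = (1 + (sqrt_bound t)\<^sup>2) / 2"

lemma sqrt_bound_range: "0 \<le> sqrt_bound t \<and> sqrt_bound t \<le> 1"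
  by (induction t) (auto simp: power_le_one)

lemma sqrt_bound_mono: "sqrt_bound t \<le> sqrt_bound (Suc t)"
  using sum_squares_bound[of 1 "sqrt_bound t"] by simp

lemma convergent_sqrt_bound: "convergent sqrt_bound"
proof -
  have "incseq sqrt_bound" by (rule incseq_SucI) (rule sqrt_bound_mono)
  then show ?thesis
    using incseq_convergent[of sqrt_bound 1] sqrt_bound_range by (blast intro: convergentI)
qed

lemma scaleR_scaleC_commute: "c *\<^sub>C (r *\<^sub>R x) = r *\<^sub>R (c *\<^sub>C (x::'h::complex_hilbert))"
  by (simp add: scaleR_scaleC scaleC_scaleC mult.commute)

lemma absolute_value_exists:
  assumes V: "closed_csubspace V" and K: "bounded_operator_on V K"
    and K_adj: "\<And>x y. x \<in> V \<Longrightarrow> y \<in> V \<Longrightarrow> cinner (K x) y = cinner x (K y)"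
    and K_le: "\<And>x. x \<in> V \<Longrightarrow> norm (K x) \<le> norm x"
  obtains R where "bounded_operator_on V R"
    "\<And>x y. x \<in> V \<Longrightarrow> y \<in> V \<Longrightarrow> cinner (R x) y = cinner x (R y)"
    "\<And>x. x \<in> V \<Longrightarrow> R (R x) = K (K x)" "\<And>x. x \<in> V \<Longrightarrow> 0 \<le> inner (R x) x"
    "\<And>C x. bounded_operator_on V C \<Longrightarrow> (\<And>x. x \<in> V \<Longrightarrow> C (K x) = K (C x)) \<Longrightarrow>
       x \<in> V \<Longrightarrow> C (R x) = R (C x)"
proof -
  note VD = csubspaceD[OF V] and KD = bounded_operatorD[OF K]
  note Kdiff = bounded_operator_linear[OF V K]
  define T where "T x = x - K (K x)" for x
  have V_scaleR: "r *\<^sub>R x \<in> V" if "x \<in> V" for r x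
    using VD(4)[OF that] by (simp add: scaleR_scaleC)
  have T_in: "T x \<in> V" if "x \<in> V" for x using that KD(1) VD(6) by (simp add: T_def)
  have T_le: "norm (T x) \<le> norm x" if x: "x \<in> V" for x
  proof -
    have "cinner x (K (K x)) = complex_of_real ((norm (K x))\<^sup>2)"
      using K_adj[OF x KD(1)[OF x]] cinner_self[of "K x"] by simp
    then have "inner x (K (K x)) = (norm (K x))\<^sup>2"
      by (simp add: inner_eq_Re_cinner del: of_real_power)
    then have "(norm (T x))\<^sup>2 = (norm x)\<^sup>2 - 2 * (norm (K x))\<^sup>2 + (norm (K (K x)))\<^sup>2"
      using dot_norm_neg[of x "K (K x)"] by (simp add: T_def)
    moreover have "(norm (K (K x)))\<^sup>2 \<le> (norm (K x))\<^sup>2"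
      using K_le[OF KD(1)[OF x]] by (intro power_mono) auto
    ultimately have "(norm (T x))\<^sup>2 \<le> (norm x)\<^sup>2" by (smt (verit) zero_le_power2)
    then show ?thesis by (rule power2_le_imp_le) simp
  qed
  define Y where "Y = rec_nat (\<lambda>x. 0) (\<lambda>t F x. (1/2) *\<^sub>R (T x + F (F x)))"
  have Y0: "Y 0 x = 0" and YS: "Y (Suc t) x = (1/2) *\<^sub>R (T x + Y t (Y t x))" for t x
    by (simp_all add: Y_def)
  have Y_in: "Y t x \<in> V" if "x \<in> V" for t x
    using that by (induction t arbitrary: x) (auto simp: Y0 YS intro!: V_scaleR VD T_in)
  have Y_add: "Y t (x + y) = Y t x + Y t y" if "x \<in> V" "y \<in> V" for t x y
    using that
    by (induction t arbitrary: x y)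
      (simp_all add: Y0 YS T_def KD Y_in algebra_simps flip: scaleR_add_right)
  have Y_scale: "Y t (c *\<^sub>C x) = c *\<^sub>C Y t x" if "x \<in> V" for t c x
    using that
    by (induction t arbitrary: x)
      (simp_all add: Y0 YS T_def KD Y_in scaleR_scaleC_commute scaleC_diff_right scaleC_add_right)
  have Y_diff: "Y t (x - y) = Y t x - Y t y" if "x \<in> V" "y \<in> V" for t x y
    using Y_add[OF that(1) VD(5)[OF that(2)], of t] Y_scale[OF that(2), of t "-1"] by simp
  have Y_le: "norm (Y t x) \<le> sqrt_bound t * norm x" if "x \<in> V" for t x
    using that
  proof (induction t arbitrary: x)
    case (Suc t)
    have "norm (Y t (Y t x)) \<le> sqrt_bound t * norm (Y t x)" by (rule Suc.IH[OF Y_in[OF Suc.prems]])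
    also have "\<dots> \<le> sqrt_bound t * (sqrt_bound t * norm x)"
      using sqrt_bound_range[of t] Suc.IH[OF Suc.prems] by (intro mult_left_mono) auto
    finally have "norm (T x + Y t (Y t x)) \<le> norm x + sqrt_bound t * (sqrt_bound t * norm x)"
      using norm_triangle_ineq[of "T x" "Y t (Y t x)"] T_le[OF Suc.prems] by linarith
    moreover have "norm (Y (Suc t) x) = norm (T x + Y t (Y t x)) / 2" by (simp add: YS)
    ultimately show ?case by (simp add: algebra_simps power2_eq_square)
  qed (simp add: Y0)
  have Y_step: "norm (Y (Suc t) x - Y t x) \<le> (sqrt_bound (Suc t) - sqrt_bound t) * norm x"
    if "x \<in> V" for t x
    using that
  proof (induction t arbitrary: x)
    case 0
    then show ?case using T_le by (simp add: Y0 YS)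
  next
    case (Suc t)
    define a b where "a = sqrt_bound (Suc t)" and "b = sqrt_bound t"
    have ab: "0 \<le> b" "b \<le> a" using sqrt_bound_range[of t] sqrt_bound_mono[of t] by (auto simp: a_def b_def)
    define v where "v = Y (Suc t) x - Y t x"
    have v: "v \<in> V" using Suc.prems by (simp add: v_def Y_in VD(6))
    have "Y (Suc (Suc t)) x - Y (Suc t) x
        = (1/2) *\<^sub>R (Y (Suc t) (Y (Suc t) x) - Y t (Y t x))"
      unfolding YS[of "Suc t"] YS[of t x] by (simp add: algebra_simps)
    also have "Y (Suc t) (Y (Suc t) x) - Y t (Y t x)
        = Y (Suc t) v + (Y (Suc t) (Y t x) - Y t (Y t x))"
      using Suc.prems by (simp add: v_def Y_diff Y_in)
    finally have "norm (Y (Suc (Suc t)) x - Y (Suc t) x)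
        \<le> (norm (Y (Suc t) v) + norm (Y (Suc t) (Y t x) - Y t (Y t x))) / 2"
      using norm_triangle_ineq[of "Y (Suc t) v" "Y (Suc t) (Y t x) - Y t (Y t x)"] by simp
    also have "norm (Y (Suc t) v) \<le> a * norm v" unfolding a_def by (rule Y_le[OF v])
    also have "a * norm v \<le> a * ((a - b) * norm x)"
      using Suc.IH[OF Suc.prems] ab unfolding v_def a_def b_def by (intro mult_left_mono) auto
    also have "norm (Y (Suc t) (Y t x) - Y t (Y t x)) \<le> (a - b) * norm (Y t x)"
      unfolding a_def b_def by (rule Suc.IH[OF Y_in[OF Suc.prems]])
    also have "(a - b) * norm (Y t x) \<le> (a - b) * (b * norm x)"
      using Y_le[OF Suc.prems, of t] ab unfolding b_def by (intro mult_left_mono) auto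
    finally have "norm (Y (Suc (Suc t)) x - Y (Suc t) x)
        \<le> (a * ((a - b) * norm x) + (a - b) * (b * norm x)) / 2" by simp
    also have "\<dots> = ((1 + a\<^sup>2) / 2 - (1 + b\<^sup>2) / 2) * norm x"
      by (simp add: field_simps power2_eq_square)
    finally show ?case by (simp add: a_def b_def)
  qed
  have "\<exists>l. (\<lambda>t. Y t x) \<longlonglongrightarrow> l" if x: "x \<in> V" for x
  proof -
    obtain l where "sqrt_bound \<longlonglongrightarrow> l" using convergent_sqrt_bound by (auto simp: convergent_def)
    then have "convergent (\<lambda>t. sqrt_bound t * norm x)"
      by (rule convergentI[OF tendsto_mult[OF _ tendsto_const]])
    then have "Cauchy (\<lambda>t. Y t x)"
      by (rule norm_telescoping(2)[of "\<lambda>t. Y t x" "\<lambda>t. sqrt_bound t * norm x", rotated])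
        (use Y_step[OF x] in \<open>simp add: left_diff_distrib del: sqrt_bound.simps\<close>)
    then show ?thesis by (auto simp: Cauchy_convergent_iff convergent_def)
  qed
  then obtain L where L: "\<And>x. x \<in> V \<Longrightarrow> (\<lambda>t. Y t x) \<longlonglongrightarrow> L x" by metis
  have L_in: "L x \<in> V" if "x \<in> V" for x
    by (rule closed_sequentially[OF VD(1) Y_in[OF that] L[OF that]])
  have Y_le1: "norm (Y t x) \<le> norm x" if "x \<in> V" for t x
    using order_trans[OF Y_le[OF that] mult_right_mono[of "sqrt_bound t" 1 "norm x"]]
      sqrt_bound_range[of t] by simp
  have L_le: "norm (L x) \<le> norm x" if "x \<in> V" for x
    by (rule LIMSEQ_le_const2[OF tendsto_norm[OF L[OF that]]]) (use Y_le1[OF that] in blast)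
  have L_add: "L (x + y) = L x + L y" if xy: "x \<in> V" "y \<in> V" for x y
    using L[OF VD(3)[OF xy]] tendsto_add[OF L[OF xy(1)] L[OF xy(2)]]
    unfolding Y_add[OF xy] by (rule LIMSEQ_unique)
  have L_scale: "L (c *\<^sub>C x) = c *\<^sub>C L x" if x: "x \<in> V" for c x
    using L[OF VD(4)[OF x]] tendsto_scaleC[OF L[OF x]]
    unfolding Y_scale[OF x] by (rule LIMSEQ_unique)
  have L_bounded: "bounded_operator_on V L"
    unfolding bounded_operator_on_def using L_in L_add L_scale L_le
    by (auto intro!: exI[of _ 1])
  have Y_adj: "cinner (Y t x) y = cinner x (Y t y)" if "x \<in> V" "y \<in> V" for t x y
    using that
    by (induction t arbitrary: x y)
      (simp_all add: Y0 YS T_def K_adj KD Y_in cinner.zero_left cinner.zero_right cinner.scaleR_left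
        cinner.scaleR_right cinner.add_left cinner.add_right cinner.diff_left cinner.diff_right)
  have L_adj: "cinner (L x) y = cinner x (L y)" if "x \<in> V" "y \<in> V" for x y
  proof -
    have "(\<lambda>t. cinner (Y t x) y) \<longlonglongrightarrow> cinner (L x) y" "(\<lambda>t. cinner x (Y t y)) \<longlonglongrightarrow> cinner x (L y)"
      by (intro cinner.tendsto tendsto_const L that)+
    then show ?thesis unfolding Y_adj[OF that] by (rule LIMSEQ_unique)
  qed
  have L_square: "L x = (1/2) *\<^sub>R (T x + L (L x))" if x: "x \<in> V" for x
  proof -
    have "(\<lambda>t. Y t (Y t x) - Y t (L x)) \<longlonglongrightarrow> 0"
    proof (rule Lim_null_comparison)
      show "(\<lambda>t. norm (Y t x - L x)) \<longlonglongrightarrow> 0"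
        by (rule tendsto_norm_zero[OF LIM_zero[OF L[OF x]]])
      show "\<forall>\<^sub>F t in sequentially. norm (Y t (Y t x) - Y t (L x)) \<le> norm (Y t x - L x)"
        using Y_le1[OF VD(6)[OF Y_in[OF x] L_in[OF x]]]
        by (simp add: Y_diff[OF Y_in[OF x] L_in[OF x], symmetric])
    qed
    from tendsto_add[OF this L[OF L_in[OF x]]] have "(\<lambda>t. Y t (Y t x)) \<longlonglongrightarrow> L (L x)" by simp
    then have "(\<lambda>t. Y (Suc t) x) \<longlonglongrightarrow> (1/2) *\<^sub>R (T x + L (L x))"
      unfolding YS by (intro tendsto_intros)
    then show ?thesis using LIMSEQ_Suc[OF L[OF x]] by (rule LIMSEQ_unique[rotated])
  qed
  define R where "R x = x - L x" for x
  show thesis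
  proof
    show "bounded_operator_on V R"
      unfolding R_def by (rule bounded_operator_diff[OF V bounded_operator_id[OF V] L_bounded])
    show "cinner (R x) y = cinner x (R y)" if "x \<in> V" "y \<in> V" for x y
      using L_adj[OF that] by (simp add: R_def cinner.diff_left cinner.diff_right)
    show "R (R x) = K (K x)" if x: "x \<in> V" for x
    proof -
      have L_R: "L (R x) = L x - L (L x)"
        using bounded_operator_linear(3)[OF V L_bounded x L_in[OF x]] by (simp add: R_def)
      have "R (R x) = x - (2 *\<^sub>R L x - L (L x))"
        unfolding R_def[of "R x"] L_R unfolding R_def[of x] by (simp add: scaleR_2)
      moreover have "2 *\<^sub>R L x = T x + L (L x)"
        by (subst L_square[OF x]) simp
      ultimately have "R (R x) = x - T x" by simp
      then show ?thesis by (simp add: T_def)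
    qed
    show "0 \<le> inner (R x) x" if x: "x \<in> V" for x
    proof -
      have "inner (L x) x \<le> norm (L x) * norm x" by (rule norm_cauchy_schwarz)
      also have "\<dots> \<le> norm x * norm x" by (intro mult_right_mono L_le x) simp
      finally show ?thesis by (simp add: R_def inner_diff_left dot_square_norm power2_eq_square)
    qed
    fix C x
    assume C: "bounded_operator_on V C" and comm: "\<And>x. x \<in> V \<Longrightarrow> C (K x) = K (C x)" and x: "x \<in> V"
    note CD = bounded_operatorD[OF C] and CL = bounded_operator_linear[OF V C]
    have C_scaleR: "C (r *\<^sub>R x) = r *\<^sub>R C x" if "x \<in> V" for r x
      using CD(3)[OF that] by (simp add: scaleR_scaleC)
    have "C (Y t x) = Y t (C x)" if "x \<in> V" for t x
      using that
      by (induction t arbitrary: x)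
        (simp_all add: Y0 YS CL C_scaleR CD T_def KD(1) Y_in VD T_in comm)
    then have "(\<lambda>t. C (Y t x)) \<longlonglongrightarrow> L (C x)" using L[OF CD(1)[OF x]] x by simp
    moreover have "(\<lambda>t. C (Y t x)) \<longlonglongrightarrow> C (L x)"
      by (rule bounded_operator_tendsto[OF V C Y_in[OF x] L_in[OF x] L[OF x]])
    ultimately have "C (L x) = L (C x)" by (auto intro: LIMSEQ_unique)
    then show "C (R x) = R (C x)" using x by (simp add: R_def CL L_in)
  qed
qed

text \<open>
  If \<open>H\<close> is not a scalar, some real \<open>c\<close> lies strictly inside its numerical range. For a
  multiple \<open>K\<close> of \<open>H - c\<close>, neither \<open>\<bar>K\<bar> + K\<close> nor \<open>\<bar>K\<bar> - K\<close> vanishes, but their product does.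
\<close>

lemma self_adjoint_splits:
  assumes V: "closed_csubspace V" and H: "bounded_operator_on V H"
    and H_adj: "\<And>x y. x \<in> V \<Longrightarrow> y \<in> V \<Longrightarrow> cinner (H x) y = cinner x (H y)"
    and nonscalar: "\<And>c. \<exists>x\<in>V. H x \<noteq> c *\<^sub>R x"
  obtains F G a b where "bounded_operator_on V F" "bounded_operator_on V G"
    "\<And>x y. x \<in> V \<Longrightarrow> y \<in> V \<Longrightarrow> cinner (G x) y = cinner x (G y)"
    "a \<in> V" "F a \<noteq> 0" "b \<in> V" "G b \<noteq> 0" "\<And>x. x \<in> V \<Longrightarrow> G (F x) = 0"
    "\<And>C x. bounded_operator_on V C \<Longrightarrow> (\<And>x. x \<in> V \<Longrightarrow> C (H x) = H (C x)) \<Longrightarrow>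
       x \<in> V \<Longrightarrow> C (G x) = G (C x)"
proof -
  note VD = csubspaceD[OF V] and HD = bounded_operatorD[OF H]
  have V_scaleR: "r *\<^sub>R x \<in> V" if "x \<in> V" for r x
    using VD(4)[OF that] by (simp add: scaleR_scaleC)
  have H_scaleR: "H (r *\<^sub>R x) = r *\<^sub>R H x" if "x \<in> V" for r x
    using HD(3)[OF that] by (simp add: scaleR_scaleC)
  have H_sym: "inner (H x) y = inner x (H y)" if "x \<in> V" "y \<in> V" for x y
    using H_adj[OF that] by (simp add: inner_eq_Re_cinner)
  obtain x0 where x0: "x0 \<in> V" "x0 \<noteq> 0"
    using nonscalar[of 0] bounded_operator_linear(1)[OF V H] by (metis scaleR_zero_right)
  define c0 where "c0 = inner (H x0) x0 / (norm x0)\<^sup>2"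
  have c0: "inner (H x0) x0 = c0 * (norm x0)\<^sup>2" using x0 by (simp add: c0_def)
  have "\<exists>y\<in>V. inner (H y) y \<noteq> c0 * (norm y)\<^sup>2"
  proof (rule ccontr)
    assume "\<not> (\<exists>y\<in>V. inner (H y) y \<noteq> c0 * (norm y)\<^sup>2)"
    then have *: "inner (H y) y = c0 * inner y y" if "y \<in> V" for y
      using that by (simp add: power2_norm_eq_inner)
    have "H x = c0 *\<^sub>R x" if x: "x \<in> V" for x
    proof -
      define w where "w = H x - c0 *\<^sub>R x"
      have w: "w \<in> V" using x HD(1) V_scaleR VD(6) by (simp add: w_def)
      have "inner (H (x + w)) (x + w) = c0 * inner (x + w) (x + w)"
        by (rule *[OF VD(3)[OF x w]])
      then have "2 * inner (H x) w = 2 * (c0 * inner x w)"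
        using *[OF x] *[OF w] H_sym[OF w x] x w
        by (simp add: HD inner_add_left inner_add_right inner_commute algebra_simps)
      then have "inner (H x - c0 *\<^sub>R x) w = 0" by (simp add: inner_diff_left)
      then have "inner w w = 0" by (simp only: w_def[symmetric])
      then show ?thesis by (simp add: w_def)
    qed
    then show False using nonscalar[of c0] by blast
  qed
  then obtain y0 where y0: "y0 \<in> V" "inner (H y0) y0 \<noteq> c0 * (norm y0)\<^sup>2" by blast
  then have y0_ne: "y0 \<noteq> 0" by auto
  define c1 where "c1 = inner (H y0) y0 / (norm y0)\<^sup>2"
  have c1: "inner (H y0) y0 = c1 * (norm y0)\<^sup>2" using y0_ne by (simp add: c1_def)
  then have "c0 \<noteq> c1" using y0(2) by auto
  define c where "c = (c0 + c1) / 2"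
  obtain a b where ab: "a \<in> V" "b \<in> V" "c * (norm a)\<^sup>2 < inner (H a) a" "inner (H b) b < c * (norm b)\<^sup>2"
  proof (cases "c0 < c1")
    case True
    then show thesis
      using that[of y0 x0] x0 y0 y0_ne by (auto simp: c_def c0 c1)
  next
    case False
    then show thesis
      using that[of x0 y0] x0 y0 y0_ne \<open>c0 \<noteq> c1\<close> by (auto simp: c_def c0 c1)
  qed
  obtain M where M: "0 < M" "\<And>x. x \<in> V \<Longrightarrow> norm (H x) \<le> M * norm x"
    by (rule bounded_operator_bound[OF H]) blast
  define s where "s = 1 / (M + \<bar>c\<bar>)"
  have s: "0 < s" using M by (simp add: s_def add_pos_nonneg)
  define K where "K x = s *\<^sub>R (H x - c *\<^sub>R x)" for x
  have K_in: "K x \<in> V" if "x \<in> V" for x using that by (simp add: K_def V_scaleR VD HD)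
  have K_le: "norm (K x) \<le> norm x" if x: "x \<in> V" for x
  proof -
    have "norm (H x - c *\<^sub>R x) \<le> (M + \<bar>c\<bar>) * norm x"
      using norm_triangle_ineq4[of "H x" "c *\<^sub>R x"] M(2)[OF x] by (simp add: algebra_simps)
    then have "s * norm (H x - c *\<^sub>R x) \<le> s * ((M + \<bar>c\<bar>) * norm x)"
      using s by (intro mult_left_mono) auto
    also have "\<dots> = norm x" using M by (simp add: s_def)
    finally show ?thesis using s by (simp add: K_def)
  qed
  have K: "bounded_operator_on V K"
    using bounded_operator_combine[OF V H bounded_operator_id[OF V], of "of_real s" "- of_real (s * c)"]
    by (simp add: K_def[abs_def] scaleR_scaleC scaleC_diff_right scaleC_scaleC scaleC_minus_left)
  have K_adj: "cinner (K x) y = cinner x (K y)" if "x \<in> V" "y \<in> V" for x y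
    using H_adj[OF that]
    by (simp add: K_def cinner.scaleR_left cinner.scaleR_right cinner.diff_left cinner.diff_right)
  obtain R where R: "bounded_operator_on V R"
    "\<And>x y. x \<in> V \<Longrightarrow> y \<in> V \<Longrightarrow> cinner (R x) y = cinner x (R y)"
    "\<And>x. x \<in> V \<Longrightarrow> R (R x) = K (K x)" "\<And>x. x \<in> V \<Longrightarrow> 0 \<le> inner (R x) x"
    and R_comm: "\<And>C x. bounded_operator_on V C \<Longrightarrow> (\<And>x. x \<in> V \<Longrightarrow> C (K x) = K (C x)) \<Longrightarrow>
       x \<in> V \<Longrightarrow> C (R x) = R (C x)"
    using absolute_value_exists[OF V K K_adj K_le] by blast
  note RD = bounded_operatorD[OF R(1)] and KD = bounded_operatorD[OF K]
  have K_pos: "0 < inner (K a) a" and K_neg: "inner (K b) b < 0"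
    using s ab by (simp_all add: K_def inner_diff_left dot_square_norm mult_pos_pos mult_less_0_iff)
  show thesis
  proof
    show "bounded_operator_on V (\<lambda>x. R x + K x)"
      using bounded_operator_combine[OF V R(1) K, of 1 1] by simp
    show "bounded_operator_on V (\<lambda>x. R x - K x)" by (rule bounded_operator_diff[OF V R(1) K])
    show "cinner (R x - K x) y = cinner x (R y - K y)" if "x \<in> V" "y \<in> V" for x y
      using R(2)[OF that] K_adj[OF that] by (simp add: cinner.diff_left cinner.diff_right)
    show "a \<in> V" "b \<in> V" by fact+
    show "R a + K a \<noteq> 0"
    proof
      assume "R a + K a = 0"
      then have "inner (R a) a + inner (K a) a = 0" by (metis inner_add_left inner_zero_left)
      then show False using R(4)[OF ab(1)] K_pos by linarith
    qed
    show "R b - K b \<noteq> 0"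
      using R(4)[OF ab(2)] K_neg by (metis eq_iff_diff_eq_0 not_less)
    show "R (R x + K x) - K (R x + K x) = 0" if x: "x \<in> V" for x
      using R_comm[OF K _ x] R(3)[OF x] x by (simp add: RD KD)
    fix C x
    assume C: "bounded_operator_on V C" and comm: "\<And>x. x \<in> V \<Longrightarrow> C (H x) = H (C x)" and x: "x \<in> V"
    note CD = bounded_operatorD[OF C] and CL = bounded_operator_linear[OF V C]
    have C_scaleR: "C (r *\<^sub>R x) = r *\<^sub>R C x" if "x \<in> V" for r x
      using CD(3)[OF that] by (simp add: scaleR_scaleC)
    have CK: "C (K x) = K (C x)" if "x \<in> V" for x
      using that by (simp add: K_def C_scaleR CL VD V_scaleR HD comm)
    show "C (R x - K x) = R (C x) - K (C x)"
      using R_comm[OF C CK x] CK[OF x] x by (simp add: CL RD KD)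
  qed
qed

section \<open>Words in the creation operators\<close>

text \<open>
  Two tuples of operators are run in parallel, from pairs of starting vectors, through the
  creation operators with index above \<open>N\<close>. For a single pair of vacua this becomes the graph of
  the intertwining unitary; for equal tuples and diagonal pairs it is an invariant subspace.
\<close>

inductive_set words ::
  "nat \<Rightarrow> nat \<Rightarrow> (nat \<Rightarrow> 'h::complex_hilbert \<Rightarrow> 'h) \<Rightarrow> (nat \<Rightarrow> 'k::complex_hilbert \<Rightarrow> 'k) \<Rightarrow>
   ('h \<times> 'k) set \<Rightarrow> ('h \<times> 'k) set"
  for N n Z Z' W where
  base: "p \<in> W \<Longrightarrow> p \<in> words N n Z Z' W"
| add: "\<lbrakk>(x, y) \<in> words N n Z Z' W; (x', y') \<in> words N n Z Z' W\<rbrakk> \<Longrightarrow>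
    (x + x', y + y') \<in> words N n Z Z' W"
| scale: "(x, y) \<in> words N n Z Z' W \<Longrightarrow> (c *\<^sub>C x, c *\<^sub>C y) \<in> words N n Z Z' W"
| create: "\<lbrakk>j \<in> {N+1..n}; (x, y) \<in> words N n Z Z' W\<rbrakk> \<Longrightarrow> (Z j x, Z' j y) \<in> words N n Z Z' W"

locale ball_operators_pair =
  X: ball_operators q n X Z Zs + Y: ball_operators q n Y Z' Zs'
  for q n and X :: "'h::complex_hilbert set" and Z Zs and Y :: "'k::complex_hilbert set" and Z' Zs' +
  fixes N :: nat and W :: "('h \<times> 'k) set"
  assumes W: "W \<subseteq> X \<times> Y"
    and vanish: "\<And>i x. i \<in> {1..n} \<Longrightarrow> i < N \<Longrightarrow> x \<in> X \<Longrightarrow> Z i x = 0 \<and> Zs i x = 0"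
      "\<And>i y. i \<in> {1..n} \<Longrightarrow> i < N \<Longrightarrow> y \<in> Y \<Longrightarrow> Z' i y = 0 \<and> Zs' i y = 0"
    and annihilate: "\<And>i x y. i \<in> {N+1..n} \<Longrightarrow> (x, y) \<in> W \<Longrightarrow> Zs i x = 0 \<and> Zs' i y = 0"
    and diagonal: "\<And>x y. N \<in> {1..n} \<Longrightarrow> (x, y) \<in> W \<Longrightarrow>
      (Z N x, Z' N y) \<in> words N n Z Z' W \<and> (Zs N x, Zs' N y) \<in> words N n Z Z' W"
begin

abbreviation "G \<equiv> words N n Z Z' W"

lemma words_in: "(x, y) \<in> G \<Longrightarrow> x \<in> X \<and> y \<in> Y"
proof (induction rule: words.induct[split_format(complete)])
  case (create j x y)
  then have "j \<in> {1..n}" by auto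
  then show ?case using create X.Z_in Y.Z_in by blast
qed (use W X.X_simps Y.X_simps in auto)

lemma words_zero: "(x, y) \<in> G \<Longrightarrow> (0, 0) \<in> G"
  using words.scale[of x y N n Z Z' W 0] by simp

lemma words_diff: "(x, y) \<in> G \<Longrightarrow> (x', y') \<in> G \<Longrightarrow> (x - x', y - y') \<in> G"
  using words.add[of x y N n Z Z' W "- x'" "- y'"] words.scale[of x' y' N n Z Z' W "-1"] by simp

lemma words_sum:
  assumes "(x, y) \<in> G" and "\<And>i. i \<in> F \<Longrightarrow> (f i, g i) \<in> G"
  shows "(\<Sum>i\<in>F. f i, \<Sum>i\<in>F. g i) \<in> G"
  using assms(2)
  by (induction F rule: infinite_finite_induct) (auto intro: words.add words_zero[OF assms(1)])

text \<open>
  The adjoints commute past creation operators with another index; past the one with the same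
  index they leave \<open>D\<^sub>j\<close>, which involves only adjoints applied to the shorter word.
\<close>

lemma words_invariant:
  assumes "(x, y) \<in> G" and "i \<in> {1..n}"
  shows "(Z i x, Z' i y) \<in> G \<and> (Zs i x, Zs' i y) \<in> G"
proof -
  have low: "(Z i x, Z' i y) \<in> G \<and> (Zs i x, Zs' i y) \<in> G"
    if "(x, y) \<in> G" "i \<in> {1..n}" "i < N" for x y i
    using that vanish words_in[OF that(1)] words_zero[OF that(1)] by simp
  have star: "\<forall>i\<in>{1..n}. N \<le> i \<longrightarrow> (Zs i x, Zs' i y) \<in> G" if "(x, y) \<in> G" for x y
    using that
  proof (induction rule: words.induct[split_format(complete)])
    case (base x y)
    have "(Zs i x, Zs' i y) \<in> G" if i: "i \<in> {1..n}" "N \<le> i" for i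
    proof (cases "i = N")
      case False
      then have "Zs i x = 0 \<and> Zs' i y = 0" using annihilate[of i x y] i base by auto
      then show ?thesis using words_zero[OF words.base[OF base]] by simp
    qed (use diagonal base i in auto)
    then show ?case by blast
  next
    case (add x y x' y')
    then show ?case
      using words_in[OF add.hyps(1)] words_in[OF add.hyps(2)]
      by (auto simp: X.Zs_add Y.Zs_add intro: words.add)
  next
    case (scale x y c)
    then show ?case
      using words_in[OF scale.hyps] by (auto simp: X.Zs_scale Y.Zs_scale intro: words.scale)
  next
    case (create j x y)
    have j: "j \<in> {1..n}" "N < j" using create.hyps(1) by auto
    have xy: "x \<in> X" "y \<in> Y" using words_in[OF create.hyps(2)] by auto
    show ?case
    proof (intro ballI impI)
      fix i assume i: "i \<in> {1..n}" "N \<le> i"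
      show "(Zs i (Z j x), Zs' i (Z' j y)) \<in> G"
      proof (cases "i = j")
        case False
        have "(Zs i x, Zs' i y) \<in> G" using create.IH i by blast
        then show ?thesis
          using i j xy False create.hyps(1) by (auto simp: X.Zs_Z Y.Zs_Z intro!: words.scale words.create)
      next
        case True
        have "(X.D j x, Y.D j y) \<in> G"
          unfolding X.D_def Y.D_def
        proof (intro words_diff create.hyps(2) words_sum[OF create.hyps(2)])
          fix l assume "l \<in> {j+1..n}"
          then have l: "l \<in> {N+1..n}" "l \<in> {1..n}" "N \<le> l" using j by auto
          show "(Z l (Zs l x), Z' l (Zs' l y)) \<in> G"
            using create.IH l by (intro words.create) auto
        qed
        moreover have "(Z j (Zs j x), Z' j (Zs' j y)) \<in> G"
          using create.IH create.hyps(1) j by (intro words.create) auto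
        ultimately show ?thesis
          unfolding True X.Zs_Z_D[OF j(1) xy(1)] Y.Zs_Z_D[OF j(1) xy(2)]
          by (intro words.add words.scale)
      qed
    qed
  qed
  have diag: "(Z N x, Z' N y) \<in> G" if "(x, y) \<in> G" and N: "N \<in> {1..n}" for x y
    using that(1)
  proof (induction rule: words.induct[split_format(complete)])
    case (base x y)
    then show ?case using diagonal N by blast
  next
    case (add x y x' y')
    then show ?case
      using words_in[OF add.hyps(1)] words_in[OF add.hyps(2)] N
      by (auto simp: X.Z_add Y.Z_add intro: words.add)
  next
    case (scale x y c)
    then show ?case
      using words_in[OF scale.hyps] N by (auto simp: X.Z_scale Y.Z_scale intro: words.scale)
  next
    case (create j x y)
    have j: "j \<in> {1..n}" "N < j" using create.hyps(1) by auto
    have xy: "x \<in> X" "y \<in> Y" using words_in[OF create.hyps(2)] by auto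
    show ?case
      unfolding X.Z_Z[OF N j(1) j(2) xy(1)] Y.Z_Z[OF N j(1) j(2) xy(2)]
      by (intro words.scale words.create create)
  qed
  consider "i < N" | "i = N" | "i \<in> {N+1..n}" using assms(2) by force
  then show ?thesis
  proof cases
    case 3
    then show ?thesis using star[OF assms(1)] assms words.create[OF 3 assms(1)] by auto
  qed (use low star diag assms in auto)
qed

text \<open>
  The creation operators of the first word move to the second one as adjoints, which turn it
  into another word. In the end a starting vector remains on the left, and the adjoints of the
  creation operators of the second word kill it.
\<close>

lemma words_inner:
  assumes W_inner: "\<And>x y x' y'. (x, y) \<in> W \<Longrightarrow> (x', y') \<in> W \<Longrightarrow> cinner x x' = cinner y y'"
    and "(x, y) \<in> G" "(x', y') \<in> G"
  shows "cinner x x' = cinner y y'"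
  using assms(2,3)
proof (induction arbitrary: x' y' rule: words.induct[split_format(complete)])
  case (base x y)
  from base(2) show ?case
  proof (induction rule: words.induct[split_format(complete)])
    case (base x' y')
    then show ?case using W_inner \<open>(x, y) \<in> W\<close> by blast
  next
    case (create j x' y')
    then have j: "j \<in> {1..n}" by auto
    have "x \<in> X" "y \<in> Y" "x' \<in> X" "y' \<in> Y"
      using W \<open>(x, y) \<in> W\<close> words_in[OF create.hyps(2)] by auto
    then show ?case
      using annihilate[OF create.hyps(1) \<open>(x, y) \<in> W\<close>]
      by (simp add: X.adj[OF j, symmetric] Y.adj[OF j, symmetric] cinner.zero_left)
  qed (simp_all add: cinner_add_right cinner_scaleC_right)
next
  case (create j x y)
  then have j: "j \<in> {1..n}" by auto
  have "(Zs j x', Zs' j y') \<in> G" using words_invariant[OF create.prems j] by simp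
  then show ?case
    using create.IH words_in[OF create.hyps(2)] words_in[OF create.prems]
    by (simp add: X.adj'[OF j] Y.adj'[OF j])
qed (simp_all add: cinner_add_left cinner_scaleC_left)

end

section \<open>Structure of an irreducible tuple\<close>

locale irreducible_ball_operators = ball_operators +
  assumes nontrivial: "X \<noteq> {0}"
    and irreducible: "\<And>M. closed_csubspace M \<Longrightarrow> M \<subseteq> X \<Longrightarrow>
      (\<And>i x. i \<in> {1..n} \<Longrightarrow> x \<in> M \<Longrightarrow> Z i x \<in> M \<and> Zs i x \<in> M) \<Longrightarrow> M = {0} \<or> M = X"
begin

text \<open>
  \<open>N\<close> is the least index with \<open>D\<^sub>N \<noteq> 0\<close>. Below it all \<open>D\<^sub>i\<close> vanish, hence so do the differences
  \<open>z\<^sub>i z\<^sub>i\<^sup>* = D\<^sub>i - D\<^sub>i\<^sub>-\<^sub>1\<close>.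
\<close>

lemma threshold:
  obtains N x0 where "N \<le> n" "x0 \<in> X" "D N x0 \<noteq> 0"
    "\<And>i x. i \<in> {1..n} \<Longrightarrow> i < N \<Longrightarrow> x \<in> X \<Longrightarrow> Z i x = 0 \<and> Zs i x = 0"
    "\<And>x. 1 \<le> N \<Longrightarrow> x \<in> X \<Longrightarrow> Z N (Zs N x) = D N x \<and> Zs N (Z N x) = D N x"
proof -
  define N where "N = (LEAST i. \<exists>x\<in>X. D i x \<noteq> 0)"
  obtain x1 where "x1 \<in> X" "x1 \<noteq> 0" using nontrivial X_simps(1) by auto
  then have ex: "\<exists>x\<in>X. D n x \<noteq> 0" by (auto simp: D_n)
  have N: "\<exists>x\<in>X. D N x \<noteq> 0" unfolding N_def using ex by (rule LeastI)
  have "N \<le> n" unfolding N_def using ex by (rule Least_le)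
  have below: "D i x = 0" if "i < N" "x \<in> X" for i x
    using not_less_Least[of i "\<lambda>i. \<exists>x\<in>X. D i x \<noteq> 0"] that by (auto simp: N_def)
  have zero: "Z i x = 0 \<and> Zs i x = 0" if i: "i \<in> {1..n}" "i < N" and x: "x \<in> X" for i x
  proof -
    have Zs0: "Zs i y = 0" if y: "y \<in> X" for y
    proof -
      have "Z i (Zs i y) = 0" using D_pred[OF i(1), of y] below[of i y] below[of "i - 1" y] i y by simp
      then show ?thesis using Zs_eq_zero[of "{i}" y i] i y by simp
    qed
    have "Z i x = 0"
      by (rule eqI_cinner[of X])
        (use i x Zs0 in \<open>simp_all add: adj' Z_in X_simps cinner.zero_left cinner.zero_right\<close>)
    then show ?thesis using Zs0[OF x] by simp
  qed
  have normal: "Z N (Zs N x) = D N x \<and> Zs N (Z N x) = D N x" if N1: "1 \<le> N" and x: "x \<in> X" for x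
  proof -
    have N': "N \<in> {1..n}" using N1 \<open>N \<le> n\<close> by simp
    have eq: "Z N (Zs N x) = D N x" using D_pred[OF N', of x] below[of "N - 1" x] N1 x by simp
    have "Zs N (Z N x) = complex_of_real q *\<^sub>C D N x + complex_of_real (1 - q) *\<^sub>C D N x"
      by (simp only: Zs_Z_D[OF N' x] eq)
    then have "Zs N (Z N x) = D N x" by (simp flip: scaleC_add_left)
    then show ?thesis using eq by simp
  qed
  obtain x0 where "x0 \<in> X" "D N x0 \<noteq> 0" using N by blast
  then show thesis using that[of N x0] \<open>N \<le> n\<close> zero normal by blast
qed

text \<open>
  A vacuum \<open>v\<close> orthogonal to \<open>W\<close> is orthogonal to all words applied to \<open>W\<close>, because the adjoints
  of the creation operators kill it. The orthogonal complement of these words is invariant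
  under all operators and contains \<open>v\<close>, hence it is everything, although \<open>w\<close> is not orthogonal
  to itself.
\<close>

lemma no_reducing_vacuum_subspace:
  assumes N: "N \<in> {1..n}"
    and vanish: "\<And>i x. i \<in> {1..n} \<Longrightarrow> i < N \<Longrightarrow> x \<in> X \<Longrightarrow> Z i x = 0 \<and> Zs i x = 0"
    and W: "W \<subseteq> {x\<in>X. \<forall>j\<in>{N+1..n}. Zs j x = 0}"
    and inv: "\<And>x. x \<in> W \<Longrightarrow> Z N x \<in> W \<and> Zs N x \<in> W"
    and w: "w \<in> W" "w \<noteq> 0"
    and v: "v \<in> X" "v \<noteq> 0" "\<And>j. j \<in> {N+1..n} \<Longrightarrow> Zs j v = 0" "\<And>x. x \<in> W \<Longrightarrow> cinner v x = 0"
  shows False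
proof -
  define W2 where "W2 = (\<lambda>x. (x, x)) ` W"
  interpret pair: ball_operators_pair q n X Z Zs X Z Zs N W2
  proof
    show "W2 \<subseteq> X \<times> X" using W by (auto simp: W2_def)
    show "Z i x = 0 \<and> Zs i x = 0" if "i \<in> {1..n}" "i < N" "x \<in> X" for i x by (rule vanish[OF that])
    show "Zs i x = 0 \<and> Zs i y = 0" if "i \<in> {N+1..n}" "(x, y) \<in> W2" for i x y
      using that W by (auto simp: W2_def)
    show "(Z N x, Z N y) \<in> words N n Z Z W2 \<and> (Zs N x, Zs N y) \<in> words N n Z Z W2"
      if "(x, y) \<in> W2" for x y
      using that inv by (auto simp: W2_def intro!: words.base)
  qed
  define M where "M = {x\<in>X. \<forall>(s, t)\<in>pair.G. cinner x s = 0}"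
  have M: "x \<in> X" "(s, t) \<in> pair.G \<Longrightarrow> cinner x s = 0" if "x \<in> M" for x s t
    using that by (auto simp: M_def)
  have "M = {0} \<or> M = X"
  proof (rule irreducible)
    have "closed M"
    proof -
      have "M = X \<inter> (\<Inter>(s, t)\<in>pair.G. {x. cinner x s = 0})" by (auto simp: M_def)
      moreover have "closed {x. cinner x s = 0}" for s
        by (intro closed_Collect_eq continuous_intros
            bounded_linear.continuous_on[OF cinner.bounded_linear_left])
      ultimately show ?thesis using csubspaceD(1)[OF X] by (auto intro!: closed_Int closed_INT)
    qed
    then show "closed_csubspace M"
      unfolding closed_csubspace_def
      by (auto simp: M_def X_simps cinner_add_left cinner_scaleC_left cinner.zero_left; force)
    show "M \<subseteq> X" by (auto simp: M_def)
    fix i x assume i: "i \<in> {1..n}" and x: "x \<in> M"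
    have "cinner (Z i x) s = 0 \<and> cinner (Zs i x) s = 0" if st: "(s, t) \<in> pair.G" for s t
      using pair.words_invariant[OF st i] pair.words_in[OF st] M(1)[OF x] M(2)[OF x]
      by (auto simp: adj[OF i] adj'[OF i])
    then show "Z i x \<in> M \<and> Zs i x \<in> M" using i M(1)[OF x] by (auto simp: M_def Z_in Zs_in)
  qed
  moreover have "cinner v s = 0" if "(s, t) \<in> pair.G" for s t
    using that
  proof (induction rule: words.induct[split_format(complete)])
    case (base s t)
    then show ?case using v(4) by (auto simp: W2_def)
  next
    case (create j s t)
    then have "j \<in> {1..n}" by auto
    then show ?case
      using v(1) v(3)[OF create.hyps(1)] pair.words_in[OF create.hyps(2)]
      by (simp add: adj[symmetric] cinner.zero_left)
  qed (simp_all add: cinner_add_right cinner_scaleC_right)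
  then have "v \<in> M" using v(1) by (auto simp: M_def)
  ultimately have "M = X" using v(2) by blast
  moreover have "w \<in> X" using w(1) W by auto
  ultimately have "w \<in> M" by simp
  moreover have "(w, w) \<in> pair.G" using w(1) by (intro words.base) (auto simp: W2_def)
  ultimately have "cinner w w = 0" by (rule M(2))
  then show False using w(2) by (simp add: cinner_self)
qed

text \<open>
  On the space \<open>V\<close> of vacua, \<open>z\<^sub>N\<close> is unitary, since \<open>D\<^sub>N\<close> is the identity there. Its real and
  imaginary part are scalars on \<open>V\<close>: a nonscalar self-adjoint operator commuting with \<open>z\<^sub>N\<close>
  would provide operators \<open>F\<close> and \<open>G\<close> with \<open>G F = 0\<close>, and the kernel of \<open>G\<close> would be a reducing
  subspace of \<open>V\<close> orthogonal to the range of \<open>G\<close>.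
\<close>

lemma vacuum_eigenvalue:
  assumes N: "N \<in> {1..n}"
    and vanish: "\<And>i x. i \<in> {1..n} \<Longrightarrow> i < N \<Longrightarrow> x \<in> X \<Longrightarrow> Z i x = 0 \<and> Zs i x = 0"
    and normal: "\<And>x. x \<in> X \<Longrightarrow> Z N (Zs N x) = D N x \<and> Zs N (Z N x) = D N x"
    and \<Omega>: "\<Omega> \<in> X" "\<Omega> \<noteq> 0" "\<And>j. j \<in> {N+1..n} \<Longrightarrow> Zs j \<Omega> = 0"
  obtains \<theta> where "cmod \<theta> = 1" "Z N \<Omega> = \<theta> *\<^sub>C \<Omega>" "Zs N \<Omega> = cnj \<theta> *\<^sub>C \<Omega>"
proof -
  define V where "V = {x\<in>X. \<forall>j\<in>{N+1..n}. Zs j x = 0}"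
  have VX: "x \<in> X" if "x \<in> V" for x using that by (simp add: V_def)
  have Z0: "Z j 0 = 0" if "j \<in> {N+1..n}" for j using that Z_zero[of j] by auto
  have above: "j \<in> {1..n}" "N < j" if "j \<in> {N+1..n}" for j using that by auto
  have V: "closed_csubspace V"
  proof -
    have "closed V"
    proof -
      have "x \<in> V" if f: "\<And>k. f k \<in> V" and lim: "f \<longlonglongrightarrow> x" for f :: "nat \<Rightarrow> _" and x
      proof -
        have fX: "f k \<in> X" for k using f VX by blast
        have x: "x \<in> X" by (rule closed_sequentially[OF csubspaceD(1)[OF X] fX lim])
        have "Zs j x = 0" if j: "j \<in> {N+1..n}" for j
        proof -
          have "(\<lambda>k. Zs j (f k)) \<longlonglongrightarrow> Zs j x"
            by (rule bounded_operator_tendsto[OF X Zs[OF above(1)[OF j]] fX x lim])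
          moreover have "Zs j (f k) = 0" for k using f j by (simp add: V_def)
          ultimately show ?thesis by (simp add: LIMSEQ_const_iff)
        qed
        then show ?thesis using x by (simp add: V_def)
      qed
      then show ?thesis by (auto simp: closed_sequential_limits)
    qed
    then show ?thesis
      unfolding closed_csubspace_def
      using above by (auto simp: V_def X_simps Zs_add Zs_scale Zs_zero)
  qed
  have Z_V: "Z N x \<in> V" "Zs N x \<in> V" if x: "x \<in> V" for x
    using x N by (auto simp: V_def Z_in Zs_in Zs_Z Zs_Zs Z_zero Zs_zero)
  have bop: "bounded_operator_on V (Z N)" "bounded_operator_on V (Zs N)"
    by (rule bounded_operator_restrict[OF Z[OF N]] bounded_operator_restrict[OF Zs[OF N]];
        use Z_V VX in blast)+
  have D_V: "D N x = x" if "x \<in> V" for x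
    using that Z0 by (simp add: D_def V_def)
  have unitary: "Z N (Zs N x) = x" "Zs N (Z N x) = x" if "x \<in> V" for x
    using normal[OF VX[OF that]] D_V[OF that] by auto
  note VD = csubspaceD[OF V]
  have scalar: "\<exists>c. \<forall>x\<in>V. H x = c *\<^sub>R x"
    if H: "bounded_operator_on V H"
      and H_adj: "\<And>x y. x \<in> V \<Longrightarrow> y \<in> V \<Longrightarrow> cinner (H x) y = cinner x (H y)"
      and comm: "\<And>x. x \<in> V \<Longrightarrow> Z N (H x) = H (Z N x)" "\<And>x. x \<in> V \<Longrightarrow> Zs N (H x) = H (Zs N x)"
    for H
  proof (rule ccontr)
    assume "\<nexists>c. \<forall>x\<in>V. H x = c *\<^sub>R x"
    then have nonscalar: "\<And>c. \<exists>x\<in>V. H x \<noteq> c *\<^sub>R x" by blast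
    obtain F G a b where FG: "bounded_operator_on V F" "bounded_operator_on V G"
      "\<And>x y. x \<in> V \<Longrightarrow> y \<in> V \<Longrightarrow> cinner (G x) y = cinner x (G y)"
      "a \<in> V" "F a \<noteq> 0" "b \<in> V" "G b \<noteq> 0" "\<And>x. x \<in> V \<Longrightarrow> G (F x) = 0"
      and G_comm: "\<And>C x. bounded_operator_on V C \<Longrightarrow> (\<And>x. x \<in> V \<Longrightarrow> C (H x) = H (C x)) \<Longrightarrow>
       x \<in> V \<Longrightarrow> C (G x) = G (C x)"
      using self_adjoint_splits[OF V H H_adj nonscalar] by blast
    define W where "W = {x\<in>V. G x = 0}"
    have Fa: "F a \<in> V" and Gb: "G b \<in> V"
      using bounded_operatorD(1)[OF FG(1) FG(4)] bounded_operatorD(1)[OF FG(2) FG(6)] .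
    show False
    proof (rule no_reducing_vacuum_subspace[OF N vanish])
      show "W \<subseteq> {x\<in>X. \<forall>j\<in>{N+1..n}. Zs j x = 0}" by (auto simp: W_def V_def)
      show "Z N x \<in> W \<and> Zs N x \<in> W" if "x \<in> W" for x
        using that Z_V G_comm[OF bop(1) comm(1), of x] G_comm[OF bop(2) comm(2), of x]
          bounded_operator_linear(1)[OF V bop(1)] bounded_operator_linear(1)[OF V bop(2)]
        by (auto simp: W_def)
      show "F a \<in> W" "F a \<noteq> 0" using Fa FG by (auto simp: W_def)
      show "G b \<in> X" "G b \<noteq> 0" using VX[OF Gb] FG by auto
      show "Zs j (G b) = 0" if "j \<in> {N+1..n}" for j using Gb that by (simp add: V_def)
      show "cinner (G b) x = 0" if "x \<in> W" for x
        using FG(3)[OF FG(6), of x] that by (simp add: W_def cinner.zero_right)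
    qed
  qed
  \<comment> \<open>Self-adjoint for \<open>b = cnj a\<close>; \<open>a = 1\<close> and \<open>a = \<i>\<close> give twice the real part and minus
      twice the imaginary part of \<open>z\<^sub>N\<close>.\<close>
  define S where "S a b x = a *\<^sub>C Z N x + b *\<^sub>C Zs N x" for a b x
  have S: "\<exists>c. \<forall>x\<in>V. S a b x = c *\<^sub>R x" if ab: "b = cnj a" for a b
  proof (rule scalar)
    show "bounded_operator_on V (S a b)"
      unfolding S_def by (rule bounded_operator_combine[OF V bop])
    show "cinner (S a b x) y = cinner x (S a b y)" if "x \<in> V" "y \<in> V" for x y
      using that VX N ab
      by (simp add: S_def adj adj' cinner_add_left cinner_add_right cinner_scaleC_left cinner_scaleC_right)
    have lin: "Z N (S a b x) = a *\<^sub>C Z N (Z N x) + b *\<^sub>C Z N (Zs N x)"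
      "Zs N (S a b x) = a *\<^sub>C Zs N (Z N x) + b *\<^sub>C Zs N (Zs N x)" if "x \<in> V" for x
      using VX[OF that] N
      by (simp_all add: S_def Z_add Zs_add Z_scale Zs_scale Z_in Zs_in X_simps)
    show "Z N (S a b x) = S a b (Z N x)" "Zs N (S a b x) = S a b (Zs N x)" if "x \<in> V" for x
      using that by (simp_all add: lin unitary) (simp_all add: S_def unitary)
  qed
  obtain c d where c: "\<And>x. x \<in> V \<Longrightarrow> S 1 1 x = c *\<^sub>R x" and d: "\<And>x. x \<in> V \<Longrightarrow> S \<i> (- \<i>) x = d *\<^sub>R x"
    using S[of 1 1] S[of "- \<i>" \<i>] by auto
  define w where "w = complex_of_real c - \<i> * complex_of_real d"
  define \<theta> where "\<theta> = w / 2"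
  have \<Omega>V: "\<Omega> \<in> V" using \<Omega> by (simp add: V_def)
  have two: "2 *\<^sub>C x = x + x" for x :: 'a
    using scaleC_add_left[of 1 1 x] by simp
  have "2 *\<^sub>C Z N \<Omega> = S 1 1 \<Omega> - \<i> *\<^sub>C S \<i> (- \<i>) \<Omega>"
    by (simp add: two S_def scaleC_diff_right scaleC_scaleC scaleC_minus_left)
  also have "\<dots> = (2 * \<theta>) *\<^sub>C \<Omega>"
    by (simp add: c[OF \<Omega>V] d[OF \<Omega>V] scaleR_scaleC scaleC_scaleC \<theta>_def) (simp add: w_def scaleC_diff_left)
  finally have "(1/2) *\<^sub>C (2 *\<^sub>C Z N \<Omega>) = (1/2) *\<^sub>C ((2 * \<theta>) *\<^sub>C \<Omega>)" by simp
  then have eig: "Z N \<Omega> = \<theta> *\<^sub>C \<Omega>" by (simp add: scaleC_scaleC)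
  have "cinner (Z N \<Omega>) (Z N \<Omega>) = cinner \<Omega> \<Omega>"
    using adj'[OF N \<Omega>(1) Z_in[OF N \<Omega>(1)]] unitary(2)[OF \<Omega>V] by simp
  then have "norm (Z N \<Omega>) = norm \<Omega>" by (simp add: norm_eq_sqrt_inner inner_eq_Re_cinner)
  then have \<theta>: "cmod \<theta> = 1" using \<Omega>(2) by (simp add: eig norm_scaleC)
  have "\<Omega> = \<theta> *\<^sub>C Zs N \<Omega>" using unitary(2)[OF \<Omega>V] N \<Omega>(1) by (simp add: eig Zs_scale)
  then have "cnj \<theta> *\<^sub>C \<Omega> = (cnj \<theta> * \<theta>) *\<^sub>C Zs N \<Omega>" by (metis scaleC_scaleC)
  also have "cnj \<theta> * \<theta> = 1" using \<theta> by (simp add: complex_norm_square[symmetric] mult.commute[of "cnj _"])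
  finally show thesis using that[OF \<theta> eig] by simp
qed

end

section \<open>The representations of the universal algebra\<close>

lemma representation_ball_operators:
  assumes q: "0 < q" "q < 1" and univ: "universal_ball_algebra q n A z"
    and \<pi>: "representation A X \<pi>"
  shows "ball_operators q n X (\<lambda>i. \<pi> (z i)) (\<lambda>i. \<pi> (astar A (z i)))"
proof -
  interpret unital_cstar_algebra A using univ by (simp add: universal_ball_algebra_def)
  have rel: "ball_relations q n A z" using univ by (simp add: universal_ball_algebra_def)
  have z: "z i \<in> carrier A" "astar A (z i) \<in> carrier A" if "i \<in> {1..n}" for i
    using rel that by (auto simp: ball_relations_def astar_closed)
  note R = representationD[OF \<pi>]
  have half: "q powr (1/2) = sqrt q" using q by (simp add: powr_half_sqrt)
  have half_inverse: "complex_of_real (sqrt q) * complex_of_real (q powr (-1/2)) = 1"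
    using q by (simp add: powr_minus_divide powr_half_sqrt flip: of_real_mult)
  show ?thesis
  proof
    fix i j x assume i: "i \<in> {1..n}" and j: "j \<in> {1..n}" and "i < j" and x: "x \<in> X"
    have zz: "z i \<otimes>\<^bsub>A\<^esub> z j = ascale A (complex_of_real (q powr (1/2))) (z j \<otimes>\<^bsub>A\<^esub> z i)"
      "z i \<otimes>\<^bsub>A\<^esub> astar A (z j) = ascale A (complex_of_real (q powr (-1/2))) (astar A (z j) \<otimes>\<^bsub>A\<^esub> z i)"
      using rel i j \<open>i < j\<close> unfolding ball_relations_def by blast+
    have "\<pi> (z i) (\<pi> (z j) x) = \<pi> (z i \<otimes>\<^bsub>A\<^esub> z j) x"
      using z i j x by (simp add: R(4))
    also have "\<dots> = complex_of_real (sqrt q) *\<^sub>C \<pi> (z j) (\<pi> (z i) x)"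
      unfolding zz half using z[OF i] z[OF j] x by (simp add: R(4,5))
    finally show "\<pi> (z i) (\<pi> (z j) x) = complex_of_real (sqrt q) *\<^sub>C \<pi> (z j) (\<pi> (z i) x)" .
    have "\<pi> (z i) (\<pi> (astar A (z j)) x) = \<pi> (z i \<otimes>\<^bsub>A\<^esub> astar A (z j)) x"
      using z[OF i] z[OF j] x by (simp add: R(4))
    also have "\<dots> = complex_of_real (q powr (-1/2)) *\<^sub>C \<pi> (astar A (z j)) (\<pi> (z i) x)"
      unfolding zz using z[OF i] z[OF j] x by (simp add: R(4,5))
    finally show "\<pi> (astar A (z j)) (\<pi> (z i) x)
        = complex_of_real (sqrt q) *\<^sub>C \<pi> (z i) (\<pi> (astar A (z j)) x)"
      by (simp only: scaleC_scaleC half_inverse scaleC_one)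
  next
    fix i x assume i: "i \<in> {1..n}" and x: "x \<in> X"
    have eq: "(astar A (z i) \<otimes>\<^bsub>A\<^esub> z i) \<ominus>\<^bsub>A\<^esub> ascale A (complex_of_real q) (z i \<otimes>\<^bsub>A\<^esub> astar A (z i))
          = ascale A (complex_of_real (1 - q))
              (\<one>\<^bsub>A\<^esub> \<ominus>\<^bsub>A\<^esub> (\<Oplus>\<^bsub>A\<^esub>j\<in>{i+1..n}. z j \<otimes>\<^bsub>A\<^esub> astar A (z j)))"
      using rel i unfolding ball_relations_def by blast
    have zz: "z j \<otimes>\<^bsub>A\<^esub> astar A (z j) \<in> carrier A" if "j \<in> {i+1..n}" for j
      using that z[of j] by auto
    have sum: "\<pi> (\<Oplus>\<^bsub>A\<^esub>j\<in>{i+1..n}. z j \<otimes>\<^bsub>A\<^esub> astar A (z j)) x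
        = (\<Sum>j\<in>{i+1..n}. \<pi> (z j) (\<pi> (astar A (z j)) x))"
    proof -
      have "\<pi> (\<Oplus>\<^bsub>A\<^esub>j\<in>{i+1..n}. z j \<otimes>\<^bsub>A\<^esub> astar A (z j)) x
          = (\<Sum>j\<in>{i+1..n}. \<pi> (z j \<otimes>\<^bsub>A\<^esub> astar A (z j)) x)"
        by (rule representation_finsum[OF \<pi> x]) (use zz in auto)
      also have "\<dots> = (\<Sum>j\<in>{i+1..n}. \<pi> (z j) (\<pi> (astar A (z j)) x))"
        by (rule sum.cong) (use z x in \<open>auto simp: R(4)\<close>)
      finally show ?thesis .
    qed
    have sum_in: "(\<Oplus>\<^bsub>A\<^esub>j\<in>{i+1..n}. z j \<otimes>\<^bsub>A\<^esub> astar A (z j)) \<in> carrier A"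
      by (intro finsum_closed) (use zz in blast)
    have "\<pi> (astar A (z i)) (\<pi> (z i) x) - complex_of_real q *\<^sub>C \<pi> (z i) (\<pi> (astar A (z i)) x)
        = \<pi> ((astar A (z i) \<otimes>\<^bsub>A\<^esub> z i) \<ominus>\<^bsub>A\<^esub> ascale A (complex_of_real q) (z i \<otimes>\<^bsub>A\<^esub> astar A (z i))) x"
      using z[OF i] x by (simp add: representation_minus[OF \<pi> x] ascale_closed R(4,5))
    also have "\<dots> = complex_of_real (1 - q) *\<^sub>C (x - (\<Sum>j\<in>{i+1..n}. \<pi> (z j) (\<pi> (astar A (z j)) x)))"
      unfolding eq using x sum_in by (simp add: representation_minus[OF \<pi> x] R(5,6) sum[simplified])
    finally show "\<pi> (astar A (z i)) (\<pi> (z i) x) - complex_of_real q *\<^sub>C \<pi> (z i) (\<pi> (astar A (z i)) x)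
        = complex_of_real (1 - q) *\<^sub>C (x - (\<Sum>j\<in>{i+1..n}. \<pi> (z j) (\<pi> (astar A (z j)) x)))" .
  qed (use q R z in auto)
qed

lemma irreducible_representation_ball_operators:
  assumes q: "0 < q" "q < 1" and univ: "universal_ball_algebra q n A z"
    and \<pi>: "irreducible_representation A X \<pi>"
  shows "irreducible_ball_operators q n X (\<lambda>i. \<pi> (z i)) (\<lambda>i. \<pi> (astar A (z i)))"
proof -
  have rep: "representation A X \<pi>" using \<pi> by (simp add: irreducible_representation_def)
  interpret ball_operators q n X "\<lambda>i. \<pi> (z i)" "\<lambda>i. \<pi> (astar A (z i))"
    by (rule representation_ball_operators[OF q univ rep])
  show ?thesis
  proof
    show "X \<noteq> {0}" using \<pi> by (simp add: irreducible_representation_def)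
    fix M assume M: "closed_csubspace M" "M \<subseteq> X"
      and inv: "\<And>i x. i \<in> {1..n} \<Longrightarrow> x \<in> M \<Longrightarrow> \<pi> (z i) x \<in> M \<and> \<pi> (astar A (z i)) x \<in> M"
    then have "\<forall>a\<in>carrier A. \<forall>x\<in>M. \<pi> a x \<in> M"
      using subspace_invariant[OF univ rep M] by blast
    then show "M = {0} \<or> M = X"
      using \<pi> M by (simp add: irreducible_representation_def)
  qed
qed

text \<open>
  Inequivalent representations are told apart by the joint eigenvalues of the adjoints of the
  generators at the vacuum.
\<close>

lemma joint_eigenvector_transfer:
  assumes "unitarily_equivalent A X \<pi> Y \<rho>" and \<pi>: "representation A X \<pi>"
    and a: "\<And>i. i \<in> I \<Longrightarrow> a i \<in> carrier A"
  shows "(\<exists>x\<in>X. x \<noteq> 0 \<and> (\<forall>i\<in>I. \<pi> (a i) x = c i *\<^sub>C x)) \<longleftrightarrow>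
    (\<exists>y\<in>Y. y \<noteq> 0 \<and> (\<forall>i\<in>I. \<rho> (a i) y = c i *\<^sub>C y))"
proof -
  obtain U where U: "bij_betw U X Y" "\<And>c x. x \<in> X \<Longrightarrow> U (c *\<^sub>C x) = c *\<^sub>C U x"
    "\<And>x y. x \<in> X \<Longrightarrow> y \<in> X \<Longrightarrow> cinner (U x) (U y) = cinner x y"
    "\<And>a x. a \<in> carrier A \<Longrightarrow> x \<in> X \<Longrightarrow> U (\<pi> a x) = \<rho> a (U x)"
    using assms(1) unfolding unitarily_equivalent_def by blast
  note X = csubspaceD[OF representationD(1)[OF \<pi>]]
  have zero: "U x = 0 \<longleftrightarrow> x = 0" if "x \<in> X" for x
    using U(3)[OF that that] by (auto simp: cinner_self)
  have eig: "\<pi> (a i) x = c i *\<^sub>C x \<longleftrightarrow> \<rho> (a i) (U x) = c i *\<^sub>C U x" if "x \<in> X" "i \<in> I" for x i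
  proof -
    have "\<rho> (a i) (U x) = c i *\<^sub>C U x \<longleftrightarrow> U (\<pi> (a i) x) = U (c i *\<^sub>C x)"
      using that U(2,4) a by simp
    also have "\<dots> \<longleftrightarrow> \<pi> (a i) x = c i *\<^sub>C x"
      using that X(4) representationD(8)[OF \<pi> a] U(1) by (intro inj_on_eq_iff) (auto simp: bij_betw_def)
    finally show ?thesis by simp
  qed
  have "Y = U ` X" using U(1) by (simp add: bij_betw_def)
  then show ?thesis using zero eig by auto
qed

context ball_model
begin

abbreviation "vacuum \<equiv> ket (replicate m (0::nat))"

lemma norm_ket [simp]: "norm (ket k) = 1"
proof -
  have "cinner (ket k) (ket k) = (\<Sum>\<^sub>\<infinity>l\<in>{k}. 1)"
    unfolding cinner_ell2 by (rule infsum_cong_neutral) auto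
  then have "complex_of_real ((norm (ket k))\<^sup>2) = 1" by (simp only: cinner_self) simp
  then have "(norm (ket k))\<^sup>2 = 1" by (simp only: of_real_eq_1_iff)
  then show ?thesis by (metis abs_norm_cancel abs_one power2_eq_iff_nonneg norm_ge_zero one_power2 zero_le_one)
qed

lemma vacuum_in: "vacuum \<in> \<H> m"
  by (simp add: hilbert_H_ket)

lemma vacuum_nonzero: "vacuum \<noteq> 0"
  using norm_ket[of "replicate m 0"] by (metis norm_zero zero_neq_one)

lemma Zs_zero: "i < N \<Longrightarrow> Zs i f = 0"
  by (rule ell2_eqI) (simp add: Zs_apply coef_star_def)

lemma Zs_diag_apply:
  "length k = m \<Longrightarrow> ell2_apply (Zs N f) k = cnj \<theta> * complex_of_real (sqrt q ^ sum_list k) * ell2_apply f k"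
  using N by (simp add: Zs_apply coef_star_def src_star_def)

lemma Zs_diag_vacuum: "Zs N vacuum = cnj \<theta> *\<^sub>C vacuum"
  using N by (intro ell2_eqI) (auto simp: Zs_apply coef_star_def src_star_def sum_list_replicate)

lemma Z_diag_vacuum: "Z N vacuum = \<theta> *\<^sub>C vacuum"
  using Z_ket_diag[of "replicate m 0"] by (simp add: sum_list_replicate)

lemma vacuum_character:
  "Zs i vacuum = (if i = N then cnj \<theta> else 0) *\<^sub>C vacuum"
  using Zs_zero[of i] Zs_vacuum[of i] Zs_diag_vacuum by (cases i N rule: linorder_cases) auto

text \<open>
  In the model, \<open>z\<^sub>i\<^sup>*\<close> vanishes for \<open>i < N\<close>, while \<open>z\<^sub>N\<^sup>*\<close> is injective with eigenvalues
  \<open>cnj \<theta> q\<^bsup>|k|/2\<^esup>\<close>. So the eigenvalues of a vacuum with a smaller index \<open>N'\<close> cannot occur, and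
  an eigenvalue of modulus 1 of \<open>z\<^sub>N\<^sup>*\<close> is \<open>cnj \<theta>\<close>.
\<close>

lemma character_unique:
  assumes x: "x \<in> \<H> m" "x \<noteq> 0" and "N' \<le> N" and \<theta>': "cmod \<theta>' = 1"
    and eig: "\<And>i. i \<in> {1..n} \<Longrightarrow> Zs i x = (if i = N' then cnj \<theta>' else 0) *\<^sub>C x"
  shows "N' = N \<and> (1 \<le> N \<longrightarrow> \<theta>' = \<theta>)"
proof -
  obtain k where k: "ell2_apply x k \<noteq> 0" using x(2) ell2_eqI[of x 0] by auto
  then have len: "length k = m" using x(1) by (auto simp: hilbert_H_def)
  have \<theta>0: "\<theta> \<noteq> 0" "\<theta>' \<noteq> 0" using \<theta> \<theta>' by auto
  have "N' = N"
  proof (rule ccontr)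
    assume "N' \<noteq> N"
    then have less: "N' < N" using assms(3) by simp
    show False
    proof (cases "N' = 0")
      case True
      then have "Zs N x = 0" using eig[of N] less N by simp
      then show False using Zs_diag_apply[OF len, of x] k \<theta>0 q by simp
    next
      case False
      then have "cnj \<theta>' *\<^sub>C x = 0" using eig[of N'] Zs_zero[OF less, of x] less N by simp
      then show False using x(2) \<theta>' norm_scaleC[of "cnj \<theta>'" x] by simp
    qed
  qed
  moreover have "\<theta>' = \<theta>" if "1 \<le> N"
  proof -
    have "cnj \<theta>' * ell2_apply x k = cnj \<theta> * complex_of_real (sqrt q ^ sum_list k) * ell2_apply x k"
      using eig[of N] that N \<open>N' = N\<close> Zs_diag_apply[OF len, of x] by simp
    then have eq: "cnj \<theta>' = cnj \<theta> * complex_of_real (sqrt q ^ sum_list k)" using k by simp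
    have "cmod (cnj \<theta>') = cmod (cnj \<theta>) * cmod (complex_of_real (sqrt q ^ sum_list k))"
      unfolding eq by (rule norm_mult)
    then have "sqrt q ^ sum_list k = 1" using \<theta> \<theta>' sqrt_q(1) by (simp add: norm_power)
    then show ?thesis using eq by simp
  qed
  ultimately show ?thesis by blast
qed

lemma Z_ket_basis:
  assumes "length k = m" "i \<in> {1..n}"
  shows "Z i (ket k) =
    (if i < N then 0
     else if i = N then (\<theta> * complex_of_real (q powr (real (sum_list k) / 2))) *\<^sub>C ket k
     else weighted_shift q (i - N) k)"
proof -
  have "q powr (real s / 2) = sqrt q ^ s" for s
    using q by (simp add: powr_half_sqrt[symmetric] powr_realpow[symmetric] powr_powr)
  moreover have "Z i (ket k) = weighted_shift q (i - N) k" if "N < i"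
    using that assms
    by (simp add: Z_ket wt_def up_def weighted_shift_def real_sqrt_mult real_sqrt_power Suc_diff_Suc)
  ultimately show ?thesis
    using assms Z_ket_diag[of k] Z_zero[of i] by (cases i N rule: linorder_cases) auto
qed

text \<open>
  The model operators satisfy the relations in the C*-algebra of operators on \<open>\<H> (n - N)\<close>, so
  universality turns them into a representation.
\<close>

lemma model_representation:
  fixes A :: "('a, 'b) cstar_scheme"
  assumes univ: "universal_ball_algebra q n A z"
  obtains \<phi> where "irreducible_representation A (\<H> m) \<phi>"
    "\<And>i. i \<in> {1..n} \<Longrightarrow> \<phi> (z i) = Z i \<and> \<phi> (astar A (z i)) = Zs i"
proof -
  have "unital_cstar_algebra B \<and> ball_relations q n B Z"
    using unital_cstar_algebra_corner ball_relations_model by blast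
  then obtain \<phi> where \<phi>: "star_hom A B \<phi>" and \<phi>_z: "\<And>i. i \<in> {1..n} \<Longrightarrow> \<phi> (z i) = Z i"
    using univ unfolding universal_ball_algebra_def by metis
  have zA: "z i \<in> carrier A" "astar A (z i) \<in> carrier A" if "i \<in> {1..n}" for i
    using univ that
    by (auto simp: universal_ball_algebra_def ball_relations_def unital_cstar_algebra.astar_closed)
  have \<phi>_zs: "\<phi> (astar A (z i)) = Zs i" if "i \<in> {1..n}" for i
    using \<phi> zA[OF that] \<phi>_z[OF that] corner_astar[OF Z_adjoint] by (simp add: star_hom_def)
  have rep: "representation A (\<H> m) \<phi>"
    using representation_corner[OF \<phi>] by (simp add: Proj_fixed)
  have "irreducible_representation A (\<H> m) \<phi>"
    unfolding irreducible_representation_def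
  proof (intro conjI allI impI rep)
    have "vacuum \<in> \<H> m" "vacuum \<noteq> 0" by (rule vacuum_in vacuum_nonzero)+
    then show "\<H> m \<noteq> {0}" by blast
    fix M assume M: "closed_csubspace M \<and> M \<subseteq> \<H> m \<and> (\<forall>a\<in>carrier A. \<forall>x\<in>M. \<phi> a x \<in> M)"
    show "M = {0} \<or> M = \<H> m"
    proof (cases "M = {0}")
      case False
      have MH: "closed_csubspace M" "M \<subseteq> \<H> m" and inv: "\<And>a x. a \<in> carrier A \<Longrightarrow> x \<in> M \<Longrightarrow> \<phi> a x \<in> M"
        using M by auto
      obtain x where x: "x \<in> M" "x \<noteq> 0" using False csubspaceD(2)[OF MH(1)] by auto
      have "M = \<H> m"
      proof (rule invariant_subspace_model[OF MH _ _ x])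
        show "Z i y \<in> M" if "i \<in> {1..n}" "y \<in> M" for i y
          using inv[OF zA(1)[OF that(1)] that(2)] \<phi>_z[OF that(1)] by simp
        show "Zs i y \<in> M" if "i \<in> {1..n}" "y \<in> M" for i y
          using inv[OF zA(2)[OF that(1)] that(2)] \<phi>_zs[OF that(1)] by simp
      qed
      then show ?thesis ..
    qed simp
  qed
  then show thesis using \<phi>_z \<phi>_zs by (intro that) auto
qed

text \<open>
  The words that start from the normalized vacuum of \<open>X\<close> and the vacuum of the model form an
  isometric relation that is compatible with the generators.
\<close>

lemma equivalent_to_model:
  fixes A :: "('a, 'b) cstar_scheme"
  assumes univ: "universal_ball_algebra q n A z"
    and \<pi>: "irreducible_representation A X \<pi>" and \<phi>: "irreducible_representation A (\<H> m) \<phi>"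
    and \<phi>_z: "\<And>i. i \<in> {1..n} \<Longrightarrow> \<phi> (z i) = Z i \<and> \<phi> (astar A (z i)) = Zs i"
    and \<Omega>: "\<Omega> \<in> X" "\<Omega> \<noteq> 0" "\<And>j. j \<in> {N+1..n} \<Longrightarrow> \<pi> (astar A (z j)) \<Omega> = 0"
    and vanish: "\<And>i x. i \<in> {1..n} \<Longrightarrow> i < N \<Longrightarrow> x \<in> X \<Longrightarrow> \<pi> (z i) x = 0 \<and> \<pi> (astar A (z i)) x = 0"
    and eig: "1 \<le> N \<Longrightarrow> \<pi> (z N) \<Omega> = \<theta> *\<^sub>C \<Omega> \<and> \<pi> (astar A (z N)) \<Omega> = cnj \<theta> *\<^sub>C \<Omega>"
  shows "unitarily_equivalent A X \<pi> (\<H> m) \<phi>"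
proof -
  have rep: "representation A X \<pi>" "representation A (\<H> m) \<phi>"
    using \<pi> \<phi> by (auto simp: irreducible_representation_def)
  interpret X: ball_operators q n X "\<lambda>i. \<pi> (z i)" "\<lambda>i. \<pi> (astar A (z i))"
    by (rule representation_ball_operators[OF q univ rep(1)])
  interpret H: ball_operators q n "\<H> m" "\<lambda>i. \<phi> (z i)" "\<lambda>i. \<phi> (astar A (z i))"
    by (rule representation_ball_operators[OF q univ rep(2)])
  define r where "r = complex_of_real (1 / norm \<Omega>)"
  define \<Omega>1 where "\<Omega>1 = r *\<^sub>C \<Omega>"
  have \<Omega>1: "\<Omega>1 \<in> X" "norm \<Omega>1 = 1"
    using \<Omega> X.X_simps(3)[OF \<Omega>(1), of r] by (auto simp: \<Omega>1_def r_def norm_scaleC norm_divide)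
  define W where "W = {(\<Omega>1, vacuum)}"
  interpret pair: ball_operators_pair q n X "\<lambda>i. \<pi> (z i)" "\<lambda>i. \<pi> (astar A (z i))"
    "\<H> m" "\<lambda>i. \<phi> (z i)" "\<lambda>i. \<phi> (astar A (z i))" N W
  proof
    show "W \<subseteq> X \<times> \<H> m" using \<Omega>1 by (simp add: W_def hilbert_H_ket)
    show "\<pi> (z i) x = 0 \<and> \<pi> (astar A (z i)) x = 0" if "i \<in> {1..n}" "i < N" "x \<in> X" for i x
      by (rule vanish[OF that])
    show "\<phi> (z i) y = 0 \<and> \<phi> (astar A (z i)) y = 0" if "i \<in> {1..n}" "i < N" "y \<in> \<H> m" for i y
      using that \<phi>_z Z_zero Zs_zero by simp
    show "\<pi> (astar A (z i)) x = 0 \<and> \<phi> (astar A (z i)) y = 0"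
      if i: "i \<in> {N+1..n}" and xy: "(x, y) \<in> W" for i x y
    proof -
      have i': "i \<in> {1..n}" "N < i" using i by auto
      show ?thesis
        using xy \<Omega>(1) \<Omega>(3)[OF i] \<phi>_z[OF i'(1)] Zs_vacuum[OF i'(2)]
        by (simp add: W_def \<Omega>1_def X.Zs_scale[OF i'(1)])
    qed
    show "(\<pi> (z N) x, \<phi> (z N) y) \<in> words N n (\<lambda>i. \<pi> (z i)) (\<lambda>i. \<phi> (z i)) W \<and>
      (\<pi> (astar A (z N)) x, \<phi> (astar A (z N)) y) \<in> words N n (\<lambda>i. \<pi> (z i)) (\<lambda>i. \<phi> (z i)) W"
      if N': "N \<in> {1..n}" and xy: "(x, y) \<in> W" for x y
    proof -
      have "\<pi> (z N) x = \<theta> *\<^sub>C x" "\<pi> (astar A (z N)) x = cnj \<theta> *\<^sub>C x"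
        using xy \<Omega>(1) eig N'
        by (auto simp: W_def \<Omega>1_def X.Zs_scale X.Z_scale scaleC_scaleC mult.commute)
      moreover have "\<phi> (z N) y = \<theta> *\<^sub>C y" "\<phi> (astar A (z N)) y = cnj \<theta> *\<^sub>C y"
        using xy \<phi>_z[OF N'] Z_diag_vacuum Zs_diag_vacuum by (auto simp: W_def)
      ultimately show ?thesis using words.base[OF xy] by (auto intro: words.scale)
    qed
  qed
  have W_inner: "cinner x x' = cinner y y'" if "(x, y) \<in> W" "(x', y') \<in> W" for x y x' y'
    using that \<Omega>1(2) by (auto simp: W_def cinner_self)
  show ?thesis
  proof (rule unitarily_equivalentI[OF univ \<pi> \<phi>])
    show "pair.G \<subseteq> X \<times> \<H> m" using pair.words_in by auto
    show "(\<Omega>1, vacuum) \<in> pair.G" by (intro words.base) (simp add: W_def)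
    show "\<Omega>1 \<noteq> 0" using \<Omega>1(2) by auto
    show "cinner x x' = cinner y y'" if "(x, y) \<in> pair.G" "(x', y') \<in> pair.G" for x y x' y'
      using pair.words_inner[OF W_inner that] .
  qed (use pair.words_invariant words.add words.scale in blast)+
qed

end

theorem proposition7p1:
  fixes q :: real and n :: nat
    and A :: "('a, 'm) cstar_scheme" and z :: "nat \<Rightarrow> 'a"
  assumes "0 < q" and "q < 1" and "1 \<le> n"
    and "universal_ball_algebra q n A z"
  shows "\<exists>(\<rho> :: nat \<Rightarrow> complex \<Rightarrow> 'a \<Rightarrow> nat list ell2 \<Rightarrow> nat list ell2) \<sigma>.
    (\<forall>j\<in>{1..n}. \<forall>\<theta>. cmod \<theta> = 1 \<longrightarrow>
       irreducible_representation A (\<H> (j - 1)) (\<rho> j \<theta>) \<and>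
       (\<forall>i\<in>{1..n}. \<forall>k. length k = j - 1 \<longrightarrow> \<rho> j \<theta> (z i) (ket k) = rho_on_basis q n j \<theta> i k)) \<and>
    irreducible_representation A (\<H> n) \<sigma> \<and>
    (\<forall>i\<in>{1..n}. \<forall>k. length k = n \<longrightarrow> \<sigma> (z i) (ket k) = sigma_on_basis q i k) \<and>
    (\<forall>j\<in>{1..n}. \<forall>j'\<in>{1..n}. \<forall>\<theta> \<theta>'. cmod \<theta> = 1 \<and> cmod \<theta>' = 1 \<and> (j, \<theta>) \<noteq> (j', \<theta>') \<longrightarrow>
       \<not> unitarily_equivalent A (\<H> (j - 1)) (\<rho> j \<theta>) (\<H> (j' - 1)) (\<rho> j' \<theta>')) \<and>
    (\<forall>j\<in>{1..n}. \<forall>\<theta>. cmod \<theta> = 1 \<longrightarrow>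
       \<not> unitarily_equivalent A (\<H> (j - 1)) (\<rho> j \<theta>) (\<H> n) \<sigma>) \<and>
    (\<forall>(X :: 'h::complex_hilbert set) \<pi>. irreducible_representation A X \<pi> \<longrightarrow>
       (\<exists>j\<in>{1..n}. \<exists>\<theta>. cmod \<theta> = 1 \<and> unitarily_equivalent A X \<pi> (\<H> (j - 1)) (\<rho> j \<theta>)) \<or>
       unitarily_equivalent A X \<pi> (\<H> n) \<sigma>)"
proof -
  note q = assms(1,2) and univ = assms(4)
  have model: "ball_model q n N \<theta>" if "N \<le> n" "cmod \<theta> = 1" for N \<theta>
    using that q by unfold_locales auto
  define P where "P N \<theta> \<phi> \<longleftrightarrow> irreducible_representation A (\<H> (n - N)) \<phi> \<and>
    (\<forall>i\<in>{1..n}. \<phi> (z i) = ball_model.Z q n N \<theta> i \<and> \<phi> (astar A (z i)) = ball_model.Zs q n N \<theta> i)"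
    for N \<theta> and \<phi> :: "'a \<Rightarrow> nat list ell2 \<Rightarrow> nat list ell2"
  have "\<exists>\<phi>. N \<le> n \<and> cmod \<theta> = 1 \<longrightarrow> P N \<theta> \<phi>" for N \<theta>
    using ball_model.model_representation[OF model univ, of N \<theta>] by (metis P_def)
  then obtain \<Phi> where "\<And>N \<theta>. N \<le> n \<and> cmod \<theta> = 1 \<longrightarrow> P N \<theta> (\<Phi> N \<theta>)" by metis
  then have irr: "irreducible_representation A (\<H> (n - N)) (\<Phi> N \<theta>)"
    and \<Phi>_z: "\<And>i. i \<in> {1..n} \<Longrightarrow> \<Phi> N \<theta> (z i) = ball_model.Z q n N \<theta> i \<and>
      \<Phi> N \<theta> (astar A (z i)) = ball_model.Zs q n N \<theta> i"
    if "N \<le> n" "cmod \<theta> = 1" for N \<theta>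
    using that by (auto simp: P_def)
  have zA: "astar A (z i) \<in> carrier A" if "i \<in> {1..n}" for i
    using univ that
    by (auto simp: universal_ball_algebra_def ball_relations_def unital_cstar_algebra.astar_closed)
  have inequivalent: "N = N' \<and> (1 \<le> N \<longrightarrow> \<theta> = \<theta>')"
    if N: "N \<le> n" "cmod \<theta> = 1" and N': "N' \<le> n" "cmod \<theta>' = 1"
      and equiv: "unitarily_equivalent A (\<H> (n - N)) (\<Phi> N \<theta>) (\<H> (n - N')) (\<Phi> N' \<theta>')"
    for N \<theta> N' \<theta>'
  proof -
    have rep: "representation A (\<H> (n - N)) (\<Phi> N \<theta>)"
      using irr[OF N] by (simp add: irreducible_representation_def)
    have eigenvector: "\<exists>x\<in>\<H> (n - N). x \<noteq> 0 \<and>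
        (\<forall>i\<in>{1..n}. \<Phi> N \<theta> (astar A (z i)) x = (if i = N then cnj \<theta> else 0) *\<^sub>C x)"
      if Nt: "N \<le> n" "cmod \<theta> = 1" for N \<theta>
    proof -
      interpret ball_model q n N \<theta> by (rule model[OF Nt])
      have "vacuum \<in> \<H> m" "vacuum \<noteq> 0" by (rule vacuum_in vacuum_nonzero)+
      moreover have "\<Phi> N \<theta> (astar A (z i)) vacuum = (if i = N then cnj \<theta> else 0) *\<^sub>C vacuum"
        if "i \<in> {1..n}" for i
        using \<Phi>_z[OF Nt that] vacuum_character[of i] by (simp only:)
      ultimately show ?thesis by blast
    qed
    have unique: "N' = N \<and> (1 \<le> N \<longrightarrow> \<theta>' = \<theta>)"
      if Nt: "N \<le> n" "cmod \<theta> = 1" and "N' \<le> N" and \<theta>': "cmod \<theta>' = 1"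
        and ev: "\<exists>x\<in>\<H> (n - N). x \<noteq> 0 \<and>
          (\<forall>i\<in>{1..n}. \<Phi> N \<theta> (astar A (z i)) x = (if i = N' then cnj \<theta>' else 0) *\<^sub>C x)"
      for N \<theta> N' \<theta>'
    proof -
      interpret ball_model q n N \<theta> by (rule model[OF Nt])
      obtain x where x: "x \<in> \<H> m" "x \<noteq> 0"
        "\<And>i. i \<in> {1..n} \<Longrightarrow> Zs i x = (if i = N' then cnj \<theta>' else 0) *\<^sub>C x"
        using ev \<Phi>_z[OF Nt] by auto
      show ?thesis by (rule character_unique[OF x(1,2) \<open>N' \<le> N\<close> \<theta>' x(3)])
    qed
    note transfer = joint_eigenvector_transfer[OF equiv rep zA, of "{1..n}" "\<lambda>i. i"]
    show ?thesis
    proof (cases "N \<le> N'")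
      case True
      then show ?thesis
        using unique[OF N' True N(2)] transfer[of "\<lambda>i. if i = N then cnj \<theta> else 0"] eigenvector[OF N]
        by auto
    next
      case False
      then show ?thesis
        using unique[OF N _ N'(2), of N'] transfer[of "\<lambda>i. if i = N' then cnj \<theta>' else 0"]
          eigenvector[OF N'] by auto
    qed
  qed
  have basis: "\<Phi> N \<theta> (z i) (ket k) =
      (if i < N then 0
       else if i = N then (\<theta> * complex_of_real (q powr (real (sum_list k) / 2))) *\<^sub>C ket k
       else weighted_shift q (i - N) k)"
    if "N \<le> n" "cmod \<theta> = 1" "i \<in> {1..n}" "length k = n - N" for N \<theta> i k
    using ball_model.Z_ket_basis[OF model[OF that(1,2)] that(4,3)] \<Phi>_z[OF that(1,2,3)] by simp
  have complete: "\<exists>N \<theta>. N \<le> n \<and> cmod \<theta> = 1 \<and> (N = 0 \<longrightarrow> \<theta> = 1) \<and>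
      unitarily_equivalent A X \<pi> (\<H> (n - N)) (\<Phi> N \<theta>)"
    if \<pi>: "irreducible_representation A X \<pi>" for X :: "'h set" and \<pi>
  proof -
    interpret irreducible_ball_operators q n X "\<lambda>i. \<pi> (z i)" "\<lambda>i. \<pi> (astar A (z i))"
      by (rule irreducible_representation_ball_operators[OF q univ \<pi>])
    obtain N x0 where N: "N \<le> n" "x0 \<in> X" "D N x0 \<noteq> 0"
      and vanish: "\<And>i x. i \<in> {1..n} \<Longrightarrow> i < N \<Longrightarrow> x \<in> X \<Longrightarrow> \<pi> (z i) x = 0 \<and> \<pi> (astar A (z i)) x = 0"
      and normal: "\<And>x. 1 \<le> N \<Longrightarrow> x \<in> X \<Longrightarrow> \<pi> (z N) (\<pi> (astar A (z N)) x) = D N x \<and>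
        \<pi> (astar A (z N)) (\<pi> (z N) x) = D N x"
      using threshold by blast
    obtain \<Omega> where \<Omega>: "\<Omega> \<in> X" "\<Omega> \<noteq> 0" "\<And>j. j \<in> {N+1..n} \<Longrightarrow> \<pi> (astar A (z j)) \<Omega> = 0"
      using vacuum_exists[OF N] by blast
    have "\<exists>\<theta>. cmod \<theta> = 1 \<and> (N = 0 \<longrightarrow> \<theta> = 1) \<and>
      (1 \<le> N \<longrightarrow> \<pi> (z N) \<Omega> = \<theta> *\<^sub>C \<Omega> \<and> \<pi> (astar A (z N)) \<Omega> = cnj \<theta> *\<^sub>C \<Omega>)"
    proof (cases "N = 0")
      case False
      then have N1: "N \<in> {1..n}" "1 \<le> N" using N(1) by auto
      obtain \<theta> where "cmod \<theta> = 1" "\<pi> (z N) \<Omega> = \<theta> *\<^sub>C \<Omega>" "\<pi> (astar A (z N)) \<Omega> = cnj \<theta> *\<^sub>C \<Omega>"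
        by (rule vacuum_eigenvalue[OF N1(1) vanish normal[OF N1(2)] \<Omega>])
      then show ?thesis using False by blast
    qed (intro exI[of _ 1], simp)
    then obtain \<theta> where \<theta>: "cmod \<theta> = 1" "N = 0 \<longrightarrow> \<theta> = 1"
      "1 \<le> N \<longrightarrow> \<pi> (z N) \<Omega> = \<theta> *\<^sub>C \<Omega> \<and> \<pi> (astar A (z N)) \<Omega> = cnj \<theta> *\<^sub>C \<Omega>" by blast
    have "unitarily_equivalent A X \<pi> (\<H> (n - N)) (\<Phi> N \<theta>)"
      by (rule ball_model.equivalent_to_model[OF model[OF N(1) \<theta>(1)] univ \<pi> irr[OF N(1) \<theta>(1)]
            \<Phi>_z[OF N(1) \<theta>(1)] \<Omega> vanish \<theta>(3)[rule_format]])
    then show ?thesis using N(1) \<theta> by blast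
  qed
  \<comment> \<open>\<open>\<rho>\<^sub>j\<close> is the member \<open>N = n - j + 1 \<ge> 1\<close> of the family, \<open>\<sigma>\<close> is the member \<open>N = 0\<close> with
      the phase set to 1.\<close>
  define \<rho> where "\<rho> j \<theta> = \<Phi> (n - j + 1) \<theta>" for j \<theta>
  define \<sigma> where "\<sigma> = \<Phi> 0 1"
  have j_le: "n - j + 1 \<le> n" "n - (n - j + 1) = j - 1" if "j \<in> {1..n}" for j
    using that by auto
  show ?thesis
  proof (intro exI[of _ \<rho>] exI[of _ \<sigma>] conjI ballI allI impI)
    fix j \<theta> assume j: "j \<in> {1..n}" and \<theta>: "cmod \<theta> = 1"
    show "irreducible_representation A (\<H> (j - 1)) (\<rho> j \<theta>)"
      using irr[OF j_le(1)[OF j] \<theta>] by (simp only: \<rho>_def j_le[OF j])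
    fix i and k :: "nat list" assume i: "i \<in> {1..n}" and k: "length k = j - 1"
    have "i - (n - j + 1) = i + j - n - 1" using j by auto
    moreover have "i \<le> n - j \<longleftrightarrow> i < n - j + 1" by auto
    ultimately show "\<rho> j \<theta> (z i) (ket k) = rho_on_basis q n j \<theta> i k"
      using basis[OF j_le(1)[OF j] \<theta> i, of k] k j_le(2)[OF j]
      by (simp only: \<rho>_def rho_on_basis_def)
  next
    show "irreducible_representation A (\<H> n) \<sigma>" using irr[of 0 1] by (simp add: \<sigma>_def)
  next
    fix i and k :: "nat list" assume "i \<in> {1..n}" "length k = n"
    then show "\<sigma> (z i) (ket k) = sigma_on_basis q i k"
      using basis[of 0 1 i k] by (auto simp: \<sigma>_def sigma_on_basis_def)
  next
    fix j j' \<theta> \<theta>' assume j: "j \<in> {1..n}" and j': "j' \<in> {1..n}"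
      and *: "cmod \<theta> = 1 \<and> cmod \<theta>' = 1 \<and> (j, \<theta>) \<noteq> (j', \<theta>')"
    have "j = j'" if "n - j + 1 = n - j' + 1" using that j j' by auto
    then show "\<not> unitarily_equivalent A (\<H> (j - 1)) (\<rho> j \<theta>) (\<H> (j' - 1)) (\<rho> j' \<theta>')"
      using inequivalent[OF j_le(1)[OF j] _ j_le(1)[OF j'], of \<theta> \<theta>'] *
      unfolding \<rho>_def j_le(2)[OF j] j_le(2)[OF j'] by auto
  next
    fix j \<theta> assume j: "j \<in> {1..n}" and \<theta>: "cmod \<theta> = 1"
    show "\<not> unitarily_equivalent A (\<H> (j - 1)) (\<rho> j \<theta>) (\<H> n) \<sigma>"
      using inequivalent[OF j_le(1)[OF j] \<theta>, of 0 1]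
      unfolding \<rho>_def \<sigma>_def j_le(2)[OF j] by auto
  next
    fix X :: "'h set" and \<pi> assume "irreducible_representation A X \<pi>"
    then obtain N \<theta> where N: "N \<le> n" "cmod \<theta> = 1" "N = 0 \<longrightarrow> \<theta> = 1"
      "unitarily_equivalent A X \<pi> (\<H> (n - N)) (\<Phi> N \<theta>)"
      using complete by blast
    show "(\<exists>j\<in>{1..n}. \<exists>\<theta>. cmod \<theta> = 1 \<and> unitarily_equivalent A X \<pi> (\<H> (j - 1)) (\<rho> j \<theta>)) \<or>
       unitarily_equivalent A X \<pi> (\<H> n) \<sigma>"
    proof (cases "N = 0")
      case True
      then show ?thesis using N by (simp add: \<sigma>_def)
    next
      case False
      then have "n - N + 1 \<in> {1..n}" "n - (n - N + 1) + 1 = N" "n - N + 1 - 1 = n - N"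
        using N(1) by auto
      then show ?thesis using N by (intro disjI1 bexI[of _ "n - N + 1"] exI[of _ \<theta>]) (simp_all only: \<rho>_def)
    qed
  qed
qed

end
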